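(* Let $U$ be the subalgebra of the $q$-shuffle algebra $(\mathbb V,\star)$ generated by $x$ and $y$. Let $\Omega$ be the set of elements $$\{W_{-i}\}_{i\in\mathbb N},\qquad \{G_{j+1}\}_{j\in\mathbb N},\qquad \{W_{k+1}\}_{k\in\mathbb N}.$$ Let $<$ be any linear order on $\Omega$ satisfying one of the following, for all $i,j,k\in\mathbb N$: (i) $W_{-i}<G_{j+1}<W_{k+1}$; (ii) $W_{k+1}<G_{j+1}<W_{-i}$; (iii) $W_{k+1}<W_{-i}<G_{j+1}$; (iv) $W_{-i}<W_{k+1}<G_{j+1}$; (v) $G_{j+1}<W_{k+1}<W_{-i}$; (vi) $G_{j+1}<W_{-i}<W_{k+1}$. Then the elements $a_1\star\cdots\star a_n$, where $n\in\mathbb N$, $a_i\in\Omega$ and $a_1\le\cdots\le a_n$, form a basis for $U$. That is, $\Omega$ with the order $<$ is a PBW basis for $U$.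
   Context: Let $\mathbb F$ be a field and let $q\in\mathbb F$ be nonzero and not a root of unity. Let $\mathbb V$ be the free associative $\mathbb F$-algebra on noncommuting generators $x,y$. The words in $x,y$, including the empty word $1$, form a basis of $\mathbb V$. Juxtaposition denotes concatenation of words. Set $\langle x,x\rangle=\langle y,y\rangle=2$ and $\langle x,y\rangle=\langle y,x\rangle=-2$. The $q$-shuffle product $\star$ on $\mathbb V$ is the bilinear product determined as follows: - $1\star v=v\star 1=v$; - for nontrivial words $u=u_1\cdots u_r$ and $v=v_1\cdots v_s$, $$u\star v=u_1\big((u_2\cdots u_r)\star v\big)+v_1\big(u\star (v_2\cdots v_s)\big)q^{\langle u_1,v_1\rangle+\cdots+\langle u_r,v_1\rangle}.$$ This makes $\mathbb V$ an associative algebra, the $q$-shuffle algebra. Alternating words: for $k\in\mathbb N$, - $W_{-k}=xyxy\cdots x$ is the alternating word of length $2k+1$ beginning and ending with $x$ (so $W_0=x$); - $W_{k+1}=yxyx\cdots y$ is the alternating word of length $2k+1$ beginning and ending with $y$ (so $W_1=y$); - $G_k=yxyx\cdots yx$ is the word of length $2k$ (so $G_1=yx$), with $G_0=1$. *)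

theory Defs
  imports Main
begin

datatype letter = X | Y

definition ip :: "letter \<Rightarrow> letter \<Rightarrow> int" where
  "ip a b = (if a = b then 2 else -2)"

text \<open>Coefficient of the word w in the q-shuffle product u \<star> v of two words.\<close>
function wstar :: "'a::field \<Rightarrow> letter list \<Rightarrow> letter list \<Rightarrow> letter list \<Rightarrow> 'a" where
  "wstar q [] v w = (if w = v then 1 else 0)"
| "wstar q (a # u) [] w = (if w = a # u then 1 else 0)"
| "wstar q (a # u) (b # v) w =
     (case w of [] \<Rightarrow> 0
      | c # w' \<Rightarrow> (if c = a then wstar q u (b # v) w' else 0)
                 + (if c = b then q powi (sum_list (map (\<lambda>d. ip d b) (a # u)))
                                   * wstar q (a # u) v w' else 0))"
  by pat_completeness auto
termination by (relation "measure (\<lambda>(q, u, v, w). length u + length v)") auto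

text \<open>Elements of the free algebra V: finitely supported functions from words to the field.\<close>
definition supp :: "(letter list \<Rightarrow> 'a::zero) \<Rightarrow> letter list set" where
  "supp f = {w. f w \<noteq> 0}"

definition inV :: "(letter list \<Rightarrow> 'a::zero) \<Rightarrow> bool" where
  "inV f \<longleftrightarrow> finite (supp f)"

definition qstar :: "'a::field \<Rightarrow> (letter list \<Rightarrow> 'a) \<Rightarrow> (letter list \<Rightarrow> 'a) \<Rightarrow> (letter list \<Rightarrow> 'a)" where
  "qstar q f g = (\<lambda>w. \<Sum>u\<in>supp f. \<Sum>v\<in>supp g. f u * g v * wstar q u v w)"

definition word :: "letter list \<Rightarrow> letter list \<Rightarrow> 'a::{zero,one}" where
  "word u = (\<lambda>w. if w = u then 1 else 0)"

inductive_set U_alg :: "'a::field \<Rightarrow> (letter list \<Rightarrow> 'a) set" for q :: "'a" where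
  one: "word [] \<in> U_alg q"
| gen_x: "word [X] \<in> U_alg q"
| gen_y: "word [Y] \<in> U_alg q"
| add: "f \<in> U_alg q \<Longrightarrow> g \<in> U_alg q \<Longrightarrow> (\<lambda>w. f w + g w) \<in> U_alg q"
| smult: "f \<in> U_alg q \<Longrightarrow> (\<lambda>w. c * f w) \<in> U_alg q"
| mult: "f \<in> U_alg q \<Longrightarrow> g \<in> U_alg q \<Longrightarrow> qstar q f g \<in> U_alg q"

text \<open>Index set Omega: Wneg i = W_{-i}, Gs j = G_{j+1}, Wpos k = W_{k+1}.\<close>
datatype omega = Wneg nat | Gs nat | Wpos nat

definition W_neg_word :: "nat \<Rightarrow> letter list" where
  "W_neg_word k = concat (replicate k [X, Y]) @ [X]"

definition W_pos_word :: "nat \<Rightarrow> letter list" where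
  "W_pos_word k = concat (replicate k [Y, X]) @ [Y]"   \<comment> \<open>this is W_{k+1}\<close>

definition G_word :: "nat \<Rightarrow> letter list" where
  "G_word k = concat (replicate k [Y, X])"

fun omega_word :: "omega \<Rightarrow> letter list" where
  "omega_word (Wneg i) = W_neg_word i"
| "omega_word (Gs j) = G_word (Suc j)"
| "omega_word (Wpos k) = W_pos_word k"

definition omega_elt :: "omega \<Rightarrow> letter list \<Rightarrow> 'a::{zero,one}" where
  "omega_elt a = word (omega_word a)"

definition pbw_prod :: "'a::field \<Rightarrow> omega list \<Rightarrow> letter list \<Rightarrow> 'a" where
  "pbw_prod q as = foldr (\<lambda>a p. qstar q (omega_elt a) p) as (word [])"

definition lt_rel :: "omega rel \<Rightarrow> omega \<Rightarrow> omega \<Rightarrow> bool" where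
  "lt_rel r a b \<longleftrightarrow> (a, b) \<in> r \<and> a \<noteq> b"

definition admissible_order :: "omega rel \<Rightarrow> bool" where
  "admissible_order r \<longleftrightarrow>
     (\<forall>i j k. lt_rel r (Wneg i) (Gs j) \<and> lt_rel r (Gs j) (Wpos k)) \<or>
     (\<forall>i j k. lt_rel r (Wpos k) (Gs j) \<and> lt_rel r (Gs j) (Wneg i)) \<or>
     (\<forall>i j k. lt_rel r (Wpos k) (Wneg i) \<and> lt_rel r (Wneg i) (Gs j)) \<or>
     (\<forall>i j k. lt_rel r (Wneg i) (Wpos k) \<and> lt_rel r (Wpos k) (Gs j)) \<or>
     (\<forall>i j k. lt_rel r (Gs j) (Wpos k) \<and> lt_rel r (Wpos k) (Wneg i)) \<or>
     (\<forall>i j k. lt_rel r (Gs j) (Wneg i) \<and> lt_rel r (Wneg i) (Wpos k))"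

definition pbw_index :: "omega rel \<Rightarrow> omega list set" where
  "pbw_index r = {as. sorted_wrt (\<lambda>a b. (a, b) \<in> r) as}"

end

theory Submission
  imports Defs "HOL-Library.Function_Algebras" "HOL-Computational_Algebra.Polynomial" "HOL-Library.Multiset"
begin

text \<open>
  Deleting the first letter of a word is a twisted derivation of the \<open>q\<close>-shuffle product. Hence
  identities between alternating words follow by induction on words from the closed system of their
  derivatives.

  For the order \<open>W\<^sub>-\<^sub>i < G\<^sub>j\<^sub>+\<^sub>1 < W\<^sub>k\<^sub>+\<^sub>1\<close> the ordered monomials span a space that is stable under left multiplication
  by \<open>x\<close> and, by induction on the degree, by \<open>y\<close>: moving \<open>y\<close> to the right only creates words \<open>G\<close> and the
  words \<open>xy\<dots>xy\<close>, and the latter are expressed by a quadratic relation.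

  For independence consider, for scalars, the generating functions \<open>gW t\<close>, \<open>gG s\<close>, \<open>gP r\<close> of the three
  families. Their ordered products are eigenvectors, with eigenvalue
  \<open>\<Sum>t - q\<^sup>2 (\<Sum>s + \<Sum>r)\<close>, of a quadratic expression \<open>E\<close> in the deletion operators, while deleting \<open>x\<close> turns one
  factor \<open>gW\<close> into \<open>gG\<close>, as in the algebraic Bethe ansatz. Commutators with \<open>E\<close> produce operators that replace
  all factors \<open>gW t\<close>, \<open>gP r\<close> by \<open>\<phi> t\<close> times \<open>gG t\<close> and \<open>\<chi> r\<close> times \<open>gG r\<close>, for arbitrary polynomials \<open>\<phi>\<close>, \<open>\<chi>\<close>.
  As these are arbitrary, the exponents of the two outer families can be read off.

  The remaining orders follow from commutation rules, from the symmetry \<open>q \<mapsto> 1/q\<close>, which reverses products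
  up to scalars, and from counting monomials in each degree.
\<close>

section \<open>The shuffle product through deletion operators\<close>

text \<open>Independence by counting needs the graded dimension of U, which is not known in advance.
  So one order is treated by operators, and its monomial count then serves as the dimension for the
  other five.

  Straightening G_j \<star> W_{-i} for single words gives long sums, whereas \<open>gG t\<close> and
  \<open>gW s\<close> with t \<noteq> s exchange with two terms. Differences of scalars are
  denominators, hence the restriction to distinct scalars; the field is infinite, as q is not a root
  of unity, so such values still determine all coefficients.

  Deleting x sums over the choice of the factor \<open>gW u\<close> that becomes
  \<open>gG u\<close>, with a rational scalar for each choice. All \<open>gG\<close> commute, so
  when only these remain every sequence of choices has produced the same vector, and it is enough to
  add scalars. To weight a choice by u, some operator has to read off u. This is the role of E: its
  commutator multiplies by the sum of the parameters of the \<open>gW\<close>, up to the factor 1 +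
  q^2, and u is the difference of this sum before and after the deletion. Without weights the
  scalars add up to a nonzero Gaussian integer.\<close>

type_synonym 'a vec = "letter list \<Rightarrow> 'a"

fun letter_sign :: "letter \<Rightarrow> int" where
  "letter_sign X = 1"
| "letter_sign Y = -1"

definition weight :: "letter list \<Rightarrow> int" where
  "weight w = sum_list (map letter_sign w)"

lemma weight_simps [simp]: "weight [] = 0" "weight (c # w) = letter_sign c + weight w" "weight (v @ w) = weight v + weight w"
  by (simp_all add: weight_def)

definition sc :: "'a::field \<Rightarrow> 'a vec \<Rightarrow> 'a vec" where
  "sc c f = (\<lambda>w. c * f w)"

definition dL :: "letter \<Rightarrow> 'a::field vec \<Rightarrow> 'a vec" where
  "dL c f = (\<lambda>w. f (c # w))"

definition dR :: "letter \<Rightarrow> 'a::field vec \<Rightarrow> 'a vec" where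
  "dR c f = (\<lambda>w. f (w @ [c]))"

text \<open>The exponent is the pairing of w with c: the form on letters is twice the product of
  their signs, so summing over the letters of w gives
  \<open>2 * letter_sign c * weight w\<close>.\<close>

definition twist :: "'a::field \<Rightarrow> letter \<Rightarrow> 'a vec \<Rightarrow> 'a vec" where
  "twist q c f = (\<lambda>w. q powi (2 * letter_sign c * weight w) * f w)"

text \<open>Recursion on the argument word instead of on the factors makes the product total on all
  functions on words. Generating functions with infinite support are then ordinary elements, and
  deletion of a first letter is a twisted derivation by definition.\<close>

fun star :: "'a::field \<Rightarrow> 'a vec \<Rightarrow> 'a vec \<Rightarrow> 'a vec" where
  "star q f g [] = f [] * g []"
| "star q f g (c # w) = star q (dL c f) g w + star q (twist q c f) (dL c g) w"

abbreviation one :: "'a::field vec" where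
  "one \<equiv> word []"

lemma sc_apply: "sc c f w = c * f w"
  by (simp add: sc_def)

interpretation fn: vector_space "sc :: 'a::field \<Rightarrow> 'a vec \<Rightarrow> 'a vec"
  by standard (auto simp: sc_def algebra_simps)

lemma dL_apply: "dL c f w = f (c # w)"
  by (simp add: dL_def)

lemma minus_fun_apply: "(- f) x = - f x" for f :: "'b \<Rightarrow> 'a::uminus"
  by simp

lemma diff_fun_apply: "(f - g) x = f x - g x" for f g :: "'b \<Rightarrow> 'a::minus"
  by simp

lemmas vec_apply = sc_apply dL_apply plus_fun_apply zero_fun_apply minus_fun_apply diff_fun_apply

declare plus_fun_apply [simp del] zero_fun_apply [simp del]

lemma dL_add [simp]: "dL c (f + g) = dL c f + dL c g"
  and dL_diff [simp]: "dL c (f - g) = dL c f - dL c g"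
  and dL_zero [simp]: "dL c 0 = 0"
  and dL_sc [simp]: "dL c (sc a f) = sc a (dL c f)"
  by (auto simp: dL_def fun_eq_iff vec_apply)

lemma dL_sum [simp]: "dL c (sum F A) = (\<Sum>i\<in>A. dL c (F i))"
  by (induction A rule: infinite_finite_induct) simp_all

lemma twist_add [simp]: "twist q c (f + g) = twist q c f + twist q c g"
  and twist_sc [simp]: "twist q c (sc a f) = sc a (twist q c f)"
  by (auto simp: twist_def fun_eq_iff vec_apply algebra_simps)

lemma twist_Nil [simp]: "twist q c f [] = f []"
  by (simp add: twist_def)

lemma star_add_left [simp]: "star q (f + f') g = star q f g + star q f' g"
proof
  fix w show "star q (f + f') g w = (star q f g + star q f' g) w"
    by (induction w arbitrary: f f' g) (simp_all add: vec_apply algebra_simps)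
qed

lemma star_add_right [simp]: "star q f (g + g') = star q f g + star q f g'"
proof
  fix w show "star q f (g + g') w = (star q f g + star q f g') w"
    by (induction w arbitrary: f g g') (simp_all add: vec_apply algebra_simps)
qed

lemma star_sc_left [simp]: "star q (sc a f) g = sc a (star q f g)"
proof
  fix w show "star q (sc a f) g w = sc a (star q f g) w"
    by (induction w arbitrary: f g) (simp_all add: vec_apply algebra_simps)
qed

lemma star_sc_right [simp]: "star q f (sc a g) = sc a (star q f g)"
proof
  fix w show "star q f (sc a g) w = sc a (star q f g) w"
    by (induction w arbitrary: f g) (simp_all add: vec_apply algebra_simps)
qed

lemma sc_zero [simp]: "sc 0 f = 0" "sc a 0 = 0" and sc_one [simp]: "sc 1 f = f"
  and sc_sc [simp]: "sc a (sc b f) = sc (a * b) f"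
  and sc_add: "sc a (f + g) = sc a f + sc a g"
  and sc_minus_one: "sc (-1) f = - f"
  by (auto simp: fun_eq_iff vec_apply algebra_simps)

lemma star_zero [simp]: "star q 0 g = 0" "star q f 0 = 0"
  using star_sc_left[of q 0 0 g] star_sc_right[of q f 0 0] by simp_all

lemma star_minus_left [simp]: "star q (- f) g = - star q f g"
  and star_minus_right [simp]: "star q f (- g) = - star q f g"
  using star_sc_left[of q "-1" f g] star_sc_right[of q f "-1" g] by (simp_all add: sc_minus_one)

lemma star_diff_left [simp]: "star q (f - f') g = star q f g - star q f' g"
  and star_diff_right [simp]: "star q f (g - g') = star q f g - star q f g'"
  by (simp_all only: diff_conv_add_uminus star_add_left star_add_right star_minus_left star_minus_right)

lemma star_sum_left: "star q (sum F A) g = (\<Sum>i\<in>A. star q (F i) g)"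
  by (induction A rule: infinite_finite_induct) simp_all

lemma star_sum_right: "star q f (sum F A) = (\<Sum>i\<in>A. star q f (F i))"
  by (induction A rule: infinite_finite_induct) simp_all

lemma dL_star [simp]: "dL c (star q f g) = star q (dL c f) g + star q (twist q c f) (dL c g)"
  by (auto simp: fun_eq_iff vec_apply)

lemma dL_one [simp]: "dL c one = 0" and twist_one [simp]: "twist q c one = one"
  by (auto simp: fun_eq_iff word_def twist_def vec_apply)

lemma star_one_left [simp]: "star q one f = f"
proof
  fix w show "star q one f w = f w"
    by (induction w arbitrary: f) (simp_all add: vec_apply, simp add: word_def)
qed

lemma star_one_right [simp]: "star q f one = f"
proof
  fix w show "star q f one w = f w"
    by (induction w arbitrary: f) (simp_all add: vec_apply, simp add: word_def)
qed

text \<open>The value at a word depends only on values at words of at most the same length, so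
  infinite series may be truncated before they are multiplied.\<close>

lemma star_cong:
  assumes "\<And>v. length v \<le> length w \<Longrightarrow> f v = f' v" "\<And>v. length v \<le> length w \<Longrightarrow> g v = g' v"
  shows "star q f g w = star q f' g' w"
  using assms
proof (induction w arbitrary: f f' g g')
  case (Cons c w)
  have "star q (dL c f) g w = star q (dL c f') g' w"
    by (rule Cons.IH) (use Cons.prems in \<open>auto simp: vec_apply\<close>)
  moreover have "star q (twist q c f) (dL c g) w = star q (twist q c f') (dL c g') w"
    by (rule Cons.IH) (use Cons.prems in \<open>auto simp: twist_def vec_apply\<close>)
  ultimately show ?case by simp
qed simp

section \<open>Weights: the number of x minus the number of y\<close>

definition has_weight :: "int \<Rightarrow> 'a::field vec \<Rightarrow> bool" where
  "has_weight a f \<longleftrightarrow> (\<forall>w. f w \<noteq> 0 \<longrightarrow> weight w = a)"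

lemma twist_has_weight: "has_weight a f \<Longrightarrow> twist q c f = sc (q powi (2 * letter_sign c * a)) f"
  by (auto simp: has_weight_def twist_def fun_eq_iff vec_apply)

lemma has_weight_dL: "has_weight a f \<Longrightarrow> has_weight (a - letter_sign c) (dL c f)"
  by (auto simp: has_weight_def dL_def)

lemma has_weight_word: "has_weight (weight u) (word u)"
  by (auto simp: has_weight_def word_def)

lemma has_weight_one: "has_weight 0 one"
  by (auto simp: has_weight_def word_def)

lemma has_weight_star: "has_weight a f \<Longrightarrow> has_weight b g \<Longrightarrow> has_weight (a + b) (star q f g)"
proof -
  have "star q f g w \<noteq> 0 \<Longrightarrow> has_weight a f \<Longrightarrow> has_weight b g \<Longrightarrow> weight w = a + b" for w
  proof (induction w arbitrary: f g a b)
    case Nil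
    then have "f [] \<noteq> 0" "g [] \<noteq> 0" by auto
    then show ?case using Nil by (metis has_weight_def add_0 weight_simps(1))
  next
    case (Cons c w)
    from Cons.prems(1) consider "star q (dL c f) g w \<noteq> 0" | "star q f (dL c g) w \<noteq> 0"
      using twist_has_weight[OF Cons.prems(2), of q c] by (fastforce simp: vec_apply)
    then show ?case
    proof cases
      case 1
      then have "weight w = (a - letter_sign c) + b"
        using Cons.IH[OF 1] has_weight_dL[OF Cons.prems(2), of c] Cons.prems(3) by blast
      then show ?thesis by simp
    next
      case 2
      then have "weight w = a + (b - letter_sign c)"
        using Cons.IH[OF 2] has_weight_dL[OF Cons.prems(3), of c] Cons.prems(2) by blast
      then show ?thesis by simp
    qed
  qed
  then show "has_weight a f \<Longrightarrow> has_weight b g \<Longrightarrow> ?thesis"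
    by (auto simp: has_weight_def)
qed

section \<open>The map that reverses words and exchanges x and y\<close>

fun swap_letter :: "letter \<Rightarrow> letter" where
  "swap_letter X = Y"
| "swap_letter Y = X"

lemma swap_letter_swap_letter [simp]: "swap_letter (swap_letter c) = c" and letter_sign_swap_letter [simp]: "letter_sign (swap_letter c) = - letter_sign c"
  by (cases c; simp)+

lemma weight_rev [simp]: "weight (rev w) = weight w" and weight_swap_letter [simp]: "weight (map swap_letter w) = - weight w"
  by (induction w) auto

definition rev_swap :: "'a::field vec \<Rightarrow> 'a vec" where
  "rev_swap f = (\<lambda>w. f (map swap_letter (rev w)))"

lemma rev_swap_rev_swap [simp]: "rev_swap (rev_swap f) = f"
  by (simp add: rev_swap_def rev_map comp_def)

lemma rev_swap_add [simp]: "rev_swap (f + g) = rev_swap f + rev_swap g"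
  and rev_swap_diff [simp]: "rev_swap (f - g) = rev_swap f - rev_swap g"
  and rev_swap_zero [simp]: "rev_swap 0 = 0"
  and rev_swap_sc [simp]: "rev_swap (sc c f) = sc c (rev_swap f)"
  by (auto simp: rev_swap_def fun_eq_iff vec_apply)

lemma rev_swap_word: "rev_swap (word u) = word (map swap_letter (rev u))"
proof -
  have "map swap_letter (rev w) = u \<longleftrightarrow> w = map swap_letter (rev u)" for w
    by (auto simp: rev_map comp_def)
  then show ?thesis by (auto simp: rev_swap_def word_def)
qed

section \<open>Associativity and symmetries of the product\<close>

locale qshuffle =
  fixes q :: "'a::field"
  assumes q_nz: "q \<noteq> 0" and q_nru: "n > 0 \<Longrightarrow> q ^ n \<noteq> 1"
begin

abbreviation st :: "'a vec \<Rightarrow> 'a vec \<Rightarrow> 'a vec" (infixr "\<star>" 70) where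
  "f \<star> g \<equiv> star q f g"

lemma powi_add: "q powi (a + b) = q powi a * q powi b"
  using q_nz by (simp add: power_int_add)

lemma dL_twist: "dL d (twist q c F) = sc (q powi (2 * letter_sign c * letter_sign d)) (twist q c (dL d F))"
  by (rule ext) (simp add: twist_def distrib_left powi_add mult.assoc vec_apply)

lemma dR_twist: "dR c (twist q d F) = sc (q powi (2 * letter_sign d * letter_sign c)) (twist q d (dR c F))"
  by (rule ext) (simp add: dR_def twist_def distrib_left powi_add mult.assoc mult.left_commute vec_apply)

text \<open>The twist is multiplicative because weights add; associativity needs this after a letter
  has been deleted.\<close>

lemma twist_star: "twist q c (f \<star> g) = twist q c f \<star> twist q c g"
proof
  fix w show "twist q c (f \<star> g) w = (twist q c f \<star> twist q c g) w"
  proof (induction w arbitrary: f g)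
    case (Cons d w)
    have k: "twist q c (F \<star> H) w = (twist q c F \<star> twist q c H) w" for F H
      by (rule Cons)
    have e: "q powi (2 * letter_sign c * weight (d # w)) = q powi (2 * letter_sign c * letter_sign d) * q powi (2 * letter_sign c * weight w)"
      by (simp add: powi_add[symmetric] distrib_left)
    have "twist q c (f \<star> g) (d # w) = q powi (2 * letter_sign c * letter_sign d) * (twist q c (dL d f \<star> g) w + twist q c (twist q d f \<star> dL d g) w)"
      by (simp only: twist_def e star.simps) (simp add: algebra_simps)
    moreover have "twist q c (twist q d f) = twist q d (twist q c f)"
      by (auto simp: twist_def)
    ultimately show ?case
      by (simp add: k dL_twist vec_apply algebra_simps)
  qed simp
qed

lemma star_assoc: "(f \<star> g) \<star> h = f \<star> (g \<star> h)"
proof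
  fix w show "((f \<star> g) \<star> h) w = (f \<star> (g \<star> h)) w"
    by (induction w arbitrary: f g h) (simp_all add: twist_star vec_apply algebra_simps)
qed

text \<open>Deleting the last letter is a twisted derivation as well, now with the twist on the
  right factor. It is needed because \<open>rev_swap\<close> turns first letters into last
  ones.\<close>

lemma star_snoc: "(f \<star> g) (w @ [c]) = (f \<star> dR c g) w + (dR c f \<star> twist q c g) w"
proof (induction w arbitrary: f g)
  case Nil
  then show ?case by (simp add: dR_def dL_def)
next
  case (Cons d w)
  have 1: "dR c (dL d f) = dL d (dR c f)" for f :: "'a vec"
    by (auto simp: dR_def vec_apply)
  show ?case
    by (simp only: append_Cons star.simps Cons 1 dL_twist dR_twist star_sc_left)
      (simp add: sc_apply mult.assoc mult.commute[of "letter_sign c"])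
qed

lemma rev_swap_star: "rev_swap (f \<star> g) = rev_swap g \<star> rev_swap f"
proof
  fix w show "rev_swap (f \<star> g) w = (rev_swap g \<star> rev_swap f) w"
  proof (induction w arbitrary: f g)
    case Nil
    then show ?case by (simp add: rev_swap_def)
  next
    case (Cons c w)
    have 1: "rev_swap (dR (swap_letter c) F) = dL c (rev_swap F)" for F :: "'a vec"
      by (auto simp: rev_swap_def dR_def dL_def)
    have 2: "rev_swap (twist q (swap_letter c) F) = twist q c (rev_swap F)" for F :: "'a vec"
      by (auto simp: rev_swap_def twist_def)
    have "rev_swap (f \<star> g) (c # w) = rev_swap (f \<star> dR (swap_letter c) g) w + rev_swap (dR (swap_letter c) f \<star> twist q (swap_letter c) g) w"
      by (simp add: rev_swap_def star_snoc vec_apply)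
    also have "\<dots> = (rev_swap g \<star> rev_swap f) (c # w)"
      by (simp add: Cons 1 2)
    finally show ?case .
  qed
qed

text \<open>Exchanging the factors means that the complementary pairs of letters are counted as
  crossings. All pairings between a word of weight a and one of weight b sum to
  \<open>2 * a * b\<close>, so the exponents for the two orders differ by this total and a
  sign.\<close>

lemma star_inverse:
  assumes "has_weight a f" "has_weight b g"
  shows "f \<star> g = sc (q powi (2 * a * b)) (star (inverse q) g f)"
proof
  fix w show "(f \<star> g) w = sc (q powi (2 * a * b)) (star (inverse q) g f) w"
    using assms
  proof (induction w arbitrary: f g a b)
    case Nil
    show ?case
    proof (cases "f [] = 0 \<or> g [] = 0")
      case False
      with Nil have "a = 0" "b = 0" by (auto simp: has_weight_def)
      then show ?thesis by (simp add: vec_apply)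
    qed (auto simp: vec_apply)
  next
    case (Cons c w)
    have 1: "(dL c f \<star> g) w = q powi (2 * (a - letter_sign c) * b) * star (inverse q) g (dL c f) w"
      using Cons.IH[OF has_weight_dL[OF Cons.prems(1)] Cons.prems(2)] by (simp add: sc_apply)
    have 2: "(f \<star> dL c g) w = q powi (2 * a * (b - letter_sign c)) * star (inverse q) (dL c g) f w"
      using Cons.IH[OF Cons.prems(1) has_weight_dL[OF Cons.prems(2)]] by (simp add: sc_apply)
    have 3: "q powi (2 * letter_sign c * a) * q powi (2 * a * (b - letter_sign c)) = q powi (2 * a * b)"
      by (simp add: powi_add[symmetric] algebra_simps)
    have 4: "q powi (2 * a * b) * inverse q powi (2 * letter_sign c * b) = q powi (2 * (a - letter_sign c) * b)"
      using q_nz by (simp add: power_int_inverse power_int_minus[symmetric] powi_add[symmetric] algebra_simps)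
    show ?case
      using Cons.prems 1 2 3 4
      by (simp add: twist_has_weight distrib_left mult.assoc[symmetric] sc_apply)
  qed
qed

end

section \<open>Relations between alternating words\<close>

lemma vec_eqI:
  assumes "f [] = g []" "dL X f = dL X g" "dL Y f = dL Y g"
  shows "f = g"
proof
  fix w show "f w = g w"
  proof (cases w)
    case Nil
    then show ?thesis using assms by simp
  next
    case (Cons c w')
    have "dL c f w' = dL c g w'"
      using assms by (cases c) simp_all
    then show ?thesis using Cons by (simp add: dL_apply)
  qed
qed

section \<open>Alternating words and their deletions\<close>

definition Wm :: "nat \<Rightarrow> 'a::field vec" where
  "Wm i = word (W_neg_word i)"

definition Gg :: "nat \<Rightarrow> 'a::field vec" where
  "Gg j = word (G_word j)"

definition Wp :: "nat \<Rightarrow> 'a::field vec" where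
  "Wp k = word (W_pos_word k)"

text \<open>\<open>Gt j\<close> is the word usually written with a tilde, \<open>xy\<dots>xy\<close>.\<close>
definition Gt :: "nat \<Rightarrow> 'a::field vec" where
  "Gt j = word (concat (replicate j [X, Y]))"

lemma alternating_shift: "concat (replicate k [a, b]) @ [a] = a # concat (replicate k [b, a])"
  by (induction k) auto

lemma W_neg_word_Cons: "W_neg_word k = X # G_word k"
  by (simp add: W_neg_word_def G_word_def alternating_shift)

lemma W_pos_word_Cons: "W_pos_word k = Y # concat (replicate k [X, Y])"
  by (simp add: W_pos_word_def alternating_shift)

lemma G_word_Suc: "G_word (Suc k) = Y # W_neg_word k"
  by (simp add: G_word_def W_neg_word_Cons)

lemma dL_word: "dL c (word u) = (case u of [] \<Rightarrow> 0 | d # v \<Rightarrow> if c = d then word v else 0)"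
  by (cases u) (auto simp: word_def dL_def fun_eq_iff vec_apply)

lemma Gg_0 [simp]: "Gg 0 = one" and Gt_0 [simp]: "Gt 0 = one"
  by (simp_all add: Gg_def Gt_def G_word_def)

lemma dL_Wm [simp]: "dL X (Wm i) = Gg i" "dL Y (Wm i) = 0"
  by (simp_all add: Wm_def Gg_def dL_word W_neg_word_Cons)

lemma dL_Gg [simp]: "dL X (Gg j) = 0" "dL Y (Gg (Suc j)) = Wm j"
  by (cases j; simp add: Wm_def Gg_def dL_word G_word_Suc del: Gg_0; simp add: G_word_def)+

lemma dL_Wp [simp]: "dL Y (Wp i) = Gt i" "dL X (Wp i) = 0"
  by (simp_all add: Wp_def Gt_def dL_word W_pos_word_Cons)

lemma dL_Gt [simp]: "dL Y (Gt j) = 0" "dL X (Gt (Suc j)) = Wp j"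
  by (cases j; simp add: Wp_def Gt_def dL_word W_pos_word_Cons del: Gt_0)+

lemma Wm_Y [simp]: "Wm i (Y # w) = 0"
  using dL_Wm(2)[of i] by (metis dL_apply zero_fun_apply)

lemma Nil_alternating [simp]: "Wm i [] = 0" "Wp i [] = 0" "Gg (Suc j) [] = 0" "Gt (Suc j) [] = 0" "word [] [] = 1"
  by (simp_all add: Wm_def Wp_def Gg_def Gt_def word_def W_neg_word_Cons W_pos_word_Cons G_word_Suc)

lemma weight_G_word [simp]: "weight (G_word k) = 0" and weight_Gt_word [simp]: "weight (concat (replicate k [X, Y])) = 0"
  by (induction k) (auto simp: G_word_def)

lemma has_weight_Wm: "has_weight 1 (Wm i)" and has_weight_Gg: "has_weight 0 (Gg i)" and has_weight_Wp: "has_weight (-1) (Wp i)" and has_weight_Gt: "has_weight 0 (Gt i)"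
  using has_weight_word[of "W_neg_word i"] has_weight_word[of "W_pos_word i"] has_weight_word[of "G_word i"]
    has_weight_word[of "concat (replicate i [X, Y])"]
  by (simp_all add: Wm_def Wp_def Gg_def Gt_def W_neg_word_Cons W_pos_word_Cons)

lemma twist_wtd1: "has_weight 1 f \<Longrightarrow> twist q X f = sc (q\<^sup>2) f" "has_weight 1 f \<Longrightarrow> twist q Y f = sc (inverse (q\<^sup>2)) f"
  and twist_wtd0: "has_weight 0 f \<Longrightarrow> twist q c f = f"
  and twist_wtdm1: "has_weight (-1) f \<Longrightarrow> twist q Y f = sc (q\<^sup>2) f" "has_weight (-1) f \<Longrightarrow> twist q X f = sc (inverse (q\<^sup>2)) f"
  by (simp_all add: twist_has_weight power_int_minus)

lemmas twist_alternating [simp] =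
  twist_wtd1[OF has_weight_Wm] twist_wtd0[OF has_weight_Gg] twist_wtdm1[OF has_weight_Wp] twist_wtd0[OF has_weight_Gt]

lemma rev_concat_replicate: "rev (concat (replicate k [a, b])) = concat (replicate k [b, a])"
  by (simp add: rev_concat)

lemma rev_swap_Wm [simp]: "rev_swap (Wm i) = Wp i" and rev_swap_Gg [simp]: "rev_swap (Gg i) = Gg i"
  by (simp_all add: Wm_def Wp_def Gg_def rev_swap_word W_pos_word_Cons W_neg_word_def G_word_def
      rev_concat_replicate map_concat)

lemma rev_swap_Wp [simp]: "rev_swap (Wp i) = Wm i"
  by (metis rev_swap_Wm rev_swap_rev_swap)

lemma rev_swap_one [simp]: "rev_swap one = one"
  by (metis Gg_0 rev_swap_Gg)

text \<open>The series of t^i W_{-i} and of t^i G_i, described by their deletions: only alternating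
  words have nonzero values, and each letter y contributes one factor t.\<close>

fun gW :: "'a::field \<Rightarrow> 'a vec" and gG :: "'a \<Rightarrow> 'a vec" where
  "gW t [] = 0"
| "gW t (X # w) = gG t w"
| "gW t (Y # w) = 0"
| "gG t [] = 1"
| "gG t (X # w) = 0"
| "gG t (Y # w) = t * gW t w"

definition gP :: "'a::field \<Rightarrow> 'a vec" where
  "gP t = rev_swap (gW t)"

lemma dL_gW [simp]: "dL X (gW t) = gG t" "dL Y (gW t) = 0"
  and dL_gG [simp]: "dL X (gG t) = 0" "dL Y (gG t) = sc t (gW t)"
  by (auto simp: fun_eq_iff vec_apply)

lemma has_weight_gW: "has_weight 1 (gW t)" and has_weight_gG: "has_weight 0 (gG t)"
proof -
  have "(gW t w \<noteq> 0 \<longrightarrow> weight w = 1) \<and> (gG t w \<noteq> 0 \<longrightarrow> weight w = 0)" for w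
    by (induction w) (simp, case_tac a, auto)
  then show "has_weight 1 (gW t)" "has_weight 0 (gG t)" by (auto simp: has_weight_def)
qed

lemmas twist_gen [simp] = twist_wtd1[OF has_weight_gW] twist_wtd0[OF has_weight_gG]

text \<open>\<open>F t\<close> is the power series with coefficients \<open>f i\<close>. At each
  word the sum is finite, with a bound uniform in t; the slack D leaves room for multiplying a
  series by a polynomial.\<close>

definition gen :: "('a::field \<Rightarrow> 'a vec) \<Rightarrow> (nat \<Rightarrow> 'a vec) \<Rightarrow> bool" where
  "gen F f \<longleftrightarrow> (\<exists>D. \<forall>t w B. B \<ge> length w + D \<longrightarrow> F t w = (\<Sum>i<B. t ^ i * f i w))"

lemma gW_gG_sum:
  "length w < B \<Longrightarrow> gW t w = (\<Sum>i<B. t ^ i * Wm i w) \<and> gG t w = (\<Sum>i<B. t ^ i * Gg i w)"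
proof (induction w arbitrary: B)
  case Nil
  then obtain B' where "B = Suc B'" by (cases B) auto
  then show ?case by (simp add: sum.lessThan_Suc_shift del: sum.lessThan_Suc)
next
  case (Cons c w)
  then obtain B' where B: "B = Suc B'" by (cases B) auto
  have IH: "gW t w = (\<Sum>i<B. t ^ i * Wm i w)" "gG t w = (\<Sum>i<B. t ^ i * Gg i w)"
    "gW t w = (\<Sum>i<B'. t ^ i * Wm i w)"
    using Cons.IH[of B] Cons.IH[of B'] Cons.prems B by auto
  have d: "Wm i (c' # w) = dL c' (Wm i) w" "Gg i (c' # w) = dL c' (Gg i) w" for c' i and w
    by (simp_all add: dL_apply)
  show ?case
  proof (cases c)
    case X
    then show ?thesis using IH(1,2) by (simp add: d zero_fun_apply del: sum.lessThan_Suc)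
  next
    case Y
    have "gG t (Y # w) = (\<Sum>i<B'. t ^ Suc i * Wm i w)"
      by (simp add: IH(3) sum_distrib_left mult.assoc)
    also have "\<dots> = (\<Sum>i<B. t ^ i * Gg i (Y # w))"
      unfolding B d by (simp add: sum.lessThan_Suc_shift zero_fun_apply del: sum.lessThan_Suc)
    finally show ?thesis using Y by (simp add: d zero_fun_apply)
  qed
qed

lemma gen_gW: "gen gW Wm" and gen_gG: "gen gG Gg"
  unfolding gen_def
  by (intro exI[of _ 1] allI impI, rule gW_gG_sum[THEN conjunct1] gW_gG_sum[THEN conjunct2], simp)+

lemma gP_sum: "length w < B \<Longrightarrow> gP t w = (\<Sum>i<B. t ^ i * Wp i w)"
  using gW_gG_sum[of "map swap_letter (rev w)" B t] by (simp add: gP_def rev_swap_def flip: rev_swap_Wm)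

lemma gen_gP: "gen gP Wp"
  unfolding gen_def by (intro exI[of _ 1] allI impI, rule gP_sum, simp)

lemma rev_swap_gG [simp]: "rev_swap (gG t) = gG t" for t :: "'a::field"
proof
  fix w
  have "(Gg i :: 'a vec) (map swap_letter (rev w)) = Gg i w" for i
    using fun_cong[OF rev_swap_Gg[of i], of w] by (simp only: rev_swap_def)
  then show "rev_swap (gG t) w = gG t w"
    using gW_gG_sum[of "map swap_letter (rev w)" "Suc (length w)" t] gW_gG_sum[of w "Suc (length w)" t]
    by (simp only: rev_swap_def length_map length_rev lessI)
qed

lemma rev_swap_gP [simp]: "rev_swap (gP t) = gW t" and rev_swap_gW: "rev_swap (gW t) = gP t"
  by (simp_all add: gP_def)

lemma has_weight_rev_swap: "has_weight a f \<Longrightarrow> has_weight (- a) (rev_swap f)"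
  by (force simp: has_weight_def rev_swap_def)

lemma has_weight_gP: "has_weight (-1) (gP t)"
  unfolding gP_def by (rule has_weight_rev_swap[OF has_weight_gW])

lemmas twist_gP [simp] = twist_wtdm1[OF has_weight_gP]

lemma dL_gP [simp]: "dL X (gP t) = 0" "dL X (dL Y (gP t)) = sc t (gP t)"
proof -
  show "dL X (gP t) = 0"
  proof
    fix w
    have "dL X (gP t) w = (\<Sum>i<length w + 2. t ^ i * dL X (Wp i) w)"
      by (simp only: dL_apply, rule gP_sum) simp
    then show "dL X (gP t) w = 0 w" by (simp add: zero_fun_apply)
  qed
  show "dL X (dL Y (gP t)) = sc t (gP t)"
  proof
    fix w
    have "dL X (dL Y (gP t)) w = (\<Sum>i<Suc (length w + 2). t ^ i * dL X (dL Y (Wp i)) w)"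
      by (simp only: dL_apply, rule gP_sum) simp
    also have "\<dots> = (\<Sum>i<length w + 2. t ^ Suc i * Wp i w)"
      by (simp add: sum.lessThan_Suc_shift zero_fun_apply del: sum.lessThan_Suc)
    also have "\<dots> = t * gP t w"
      by (subst gP_sum[of w "length w + 2"]) (simp_all add: sum_distrib_left mult.assoc del: sum.lessThan_Suc add_2_eq_Suc')
    finally show "dL X (dL Y (gP t)) w = sc t (gP t) w" by (simp add: sc_apply)
  qed
qed

section \<open>Commutation rules and the quadratic relation\<close>

context qshuffle
begin

lemma q2_nz: "q\<^sup>2 \<noteq> 0"
  using q_nz by simp

lemma q2_cancel [simp]: "q\<^sup>2 * (inverse (q\<^sup>2) * x) = x"
  using q2_nz by (simp flip: mult.assoc)

text \<open>The four relations are closed under deletion. Deleting x turns commutation of the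
  \<open>Wm\<close> into the third relation, and the third and fourth into commutation of the
  \<open>Gg\<close>. Deleting y turns commutation of the \<open>Gg\<close> into the fourth relation,
  and the third and fourth into commutation of the \<open>Wm\<close>.\<close>

lemma Wm_Gg_relations:
  shows Wm_commute: "Wm k \<star> Wm l = Wm l \<star> Wm k"
    and Gg_commute: "Gg k \<star> Gg l = Gg l \<star> Gg k"
    and Wm_Gg_sym: "sc (q\<^sup>2) (Wm k \<star> Gg l) - Gg l \<star> Wm k = sc (q\<^sup>2) (Wm l \<star> Gg k) - Gg k \<star> Wm l"
    and Wm_Gg_Suc: "Wm k \<star> Gg (Suc l) - Gg (Suc l) \<star> Wm k = Wm l \<star> Gg (Suc k) - Gg (Suc k) \<star> Wm l"
proof -
  have "(Wm k \<star> Wm l) w = (Wm l \<star> Wm k) w \<and> (Gg k \<star> Gg l) w = (Gg l \<star> Gg k) w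
    \<and> q\<^sup>2 * (Wm k \<star> Gg l) w - (Gg l \<star> Wm k) w = q\<^sup>2 * (Wm l \<star> Gg k) w - (Gg k \<star> Wm l) w
    \<and> (Wm k \<star> Gg (Suc l)) w - (Gg (Suc l) \<star> Wm k) w = (Wm l \<star> Gg (Suc k)) w - (Gg (Suc k) \<star> Wm l) w"
    for w
  proof (induction w arbitrary: k l)
    case (Cons c w)
    note IH = Cons[THEN conjunct1] Cons[THEN conjunct2, THEN conjunct1]
      Cons[THEN conjunct2, THEN conjunct2, THEN conjunct1] Cons[THEN conjunct2, THEN conjunct2, THEN conjunct2]
    show ?case
    proof (cases c)
      case X
      have 1: "(Gg k \<star> Wm l) w + q\<^sup>2 * (Wm k \<star> Gg l) w = (Gg l \<star> Wm k) w + q\<^sup>2 * (Wm l \<star> Gg k) w"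
        using IH(3)[of k l] by (simp add: algebra_simps)
      show ?thesis
        unfolding X using 1 IH(2)[of k l] IH(2)[of l "Suc k"] IH(2)[of k "Suc l"]
        by (simp add: vec_apply algebra_simps)
    next
      case Y
      show ?thesis
        unfolding Y
        by (cases k; cases l) (use q2_nz in \<open>simp_all add: vec_apply IH(1)\<close>,
          use IH(1,4) in \<open>simp_all add: algebra_simps\<close>)
    qed
  qed (cases k; cases l; simp)
  then show "Wm k \<star> Wm l = Wm l \<star> Wm k" "Gg k \<star> Gg l = Gg l \<star> Gg k"
    "sc (q\<^sup>2) (Wm k \<star> Gg l) - Gg l \<star> Wm k = sc (q\<^sup>2) (Wm l \<star> Gg k) - Gg k \<star> Wm l"
    "Wm k \<star> Gg (Suc l) - Gg (Suc l) \<star> Wm k = Wm l \<star> Gg (Suc k) - Gg (Suc k) \<star> Wm l"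
    by (auto simp: fun_eq_iff vec_apply)
qed

text \<open>The same closed system with scalars in place of indices: the index shift in the fourth
  relation becomes multiplication by the parameter.\<close>

lemma gW_gG_relations:
  shows gW_commute: "gW s \<star> gW t = gW t \<star> gW s"
    and gG_commute: "gG s \<star> gG t = gG t \<star> gG s"
    and gW_gG_sym: "sc (q\<^sup>2) (gW s \<star> gG t) - gG t \<star> gW s = sc (q\<^sup>2) (gW t \<star> gG s) - gG s \<star> gW t"
    and gW_gG_scale: "sc s (gW s \<star> gG t - gG t \<star> gW s) = sc t (gW t \<star> gG s - gG s \<star> gW t)"
proof -
  have "(gW s \<star> gW t) w = (gW t \<star> gW s) w \<and> (gG s \<star> gG t) w = (gG t \<star> gG s) w
    \<and> q\<^sup>2 * (gW s \<star> gG t) w - (gG t \<star> gW s) w = q\<^sup>2 * (gW t \<star> gG s) w - (gG s \<star> gW t) w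
    \<and> s * ((gW s \<star> gG t) w - (gG t \<star> gW s) w) = t * ((gW t \<star> gG s) w - (gG s \<star> gW t) w)"
    for w
  proof (induction w)
    case (Cons c w)
    then show ?case
      by (cases c) (use q2_nz in \<open>simp_all add: vec_apply algebra_simps\<close>)
  qed simp
  then show "gW s \<star> gW t = gW t \<star> gW s" "gG s \<star> gG t = gG t \<star> gG s"
    "sc (q\<^sup>2) (gW s \<star> gG t) - gG t \<star> gW s = sc (q\<^sup>2) (gW t \<star> gG s) - gG s \<star> gW t"
    "sc s (gW s \<star> gG t - gG t \<star> gW s) = sc t (gW t \<star> gG s - gG s \<star> gW t)"
    by (auto simp: fun_eq_iff vec_apply)
qed

lemma Wp_commute: "Wp k \<star> Wp l = Wp l \<star> Wp k"
  using arg_cong[OF Wm_commute[of l k], of rev_swap] by (simp add: rev_swap_star)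

text \<open>A closed system again: deleting y from the first relation leads to the second, deleting
  x from the second leads to the first, and the other two deletions are immediate.\<close>

lemma Y_relations:
  shows Gg_Y: "Gg k \<star> Wp 0 - sc (inverse (q\<^sup>2)) (Wp 0 \<star> Gg k) = sc (1 - inverse (q\<^sup>2)) (Wp k)"
    and Y_Wm: "Wp 0 \<star> Wm k - Wm k \<star> Wp 0 = sc (1 - inverse (q\<^sup>2)) (Gg (Suc k) - Gt (Suc k))"
proof -
  define p where "p = inverse (q\<^sup>2)"
  have p: "p * q\<^sup>2 = 1" "q\<^sup>2 * p = 1" using q2_nz by (simp_all add: p_def)
  have "(Gg k \<star> Wp 0) w - p * (Wp 0 \<star> Gg k) w = (1 - p) * Wp k w
    \<and> (Wp 0 \<star> Wm k) w - (Wm k \<star> Wp 0) w = (1 - p) * (Gg (Suc k) w - Gt (Suc k) w)" for w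
  proof (induction w arbitrary: k)
    case (Cons c w)
    note IH = Cons[THEN conjunct1] Cons[THEN conjunct2]
    have d: "Wp i (c' # w) = dL c' (Wp i) w" "Gg i (c' # w) = dL c' (Gg i) w" "Gt i (c' # w) = dL c' (Gt i) w" for c' i
      by (simp_all add: dL_apply)
    show ?case
    proof (cases c)
      case X
      show ?thesis using IH(1)[of k] by (simp add: d X vec_apply p_def[symmetric] algebra_simps)
    next
      case Y
      have "(Gg k \<star> Wp 0) (Y # w) - p * (Wp 0 \<star> Gg k) (Y # w) = (1 - p) * Gt k w"
      proof (cases k)
        case (Suc j)
        show ?thesis
          using IH(2)[of j] p by (simp add: Suc vec_apply p_def[symmetric] algebra_simps flip: mult.assoc[of p "q\<^sup>2"])
      qed (simp add: vec_apply d algebra_simps)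
      then show ?thesis by (simp add: d Y vec_apply p_def[symmetric] algebra_simps)
    qed
  qed (cases k; simp)
  then show "Gg k \<star> Wp 0 - sc (inverse (q\<^sup>2)) (Wp 0 \<star> Gg k) = sc (1 - inverse (q\<^sup>2)) (Wp k)"
    "Wp 0 \<star> Wm k - Wm k \<star> Wp 0 = sc (1 - inverse (q\<^sup>2)) (Gg (Suc k) - Gt (Suc k))"
    by (auto simp: fun_eq_iff vec_apply p_def)
qed

text \<open>Both sides have the same deletions, term by term, and no constant term. The summand k =
  0 on the left is q^(2n) times \<open>Gt n\<close>, so \<open>Gt n\<close> is expressed through the
  other families and shorter words of its own family.\<close>

lemma Gt_relation:
  assumes "n > 0"
  shows "(\<Sum>k\<le>n. sc ((q\<^sup>2) ^ (n - k)) (Gg k \<star> Gt (n - k)))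
    = (\<Sum>k<n. sc ((q\<^sup>2) ^ (n - k)) (Wm k \<star> Wp (n - Suc k)))"
proof (rule vec_eqI)
  obtain m where n: "n = Suc m" using assms by (cases n) auto
  have "(\<Sum>k\<in>A. F k) [] = (\<Sum>k\<in>A. F k [])" if "finite A" for A and F :: "nat \<Rightarrow> 'a vec"
    using that by induction (auto simp: vec_apply)
  \<comment> \<open>As n > 0, one of the indices k and n - k is positive, and that factor has no
    constant term.\<close>
  moreover have "(\<Sum>k\<le>n. c k * (Gg k [] * Gt (n - k) [])) = 0" for c :: "nat \<Rightarrow> 'a"
    by (rule sum.neutral, rule ballI, case_tac x; case_tac "n - x") (use n in auto)
  ultimately show "(\<Sum>k\<le>n. sc ((q\<^sup>2) ^ (n - k)) (Gg k \<star> Gt (n - k))) []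
    = (\<Sum>k<n. sc ((q\<^sup>2) ^ (n - k)) (Wm k \<star> Wp (n - Suc k))) []"
    by (simp add: sc_apply)
  have 1: "dL X (Gt (n - k)) = Wp (n - Suc k)" if "k < n" for k
    using that by (metis Suc_diff_Suc dL_Gt(2))
  show "dL X (\<Sum>k\<le>n. sc ((q\<^sup>2) ^ (n - k)) (Gg k \<star> Gt (n - k)))
    = dL X (\<Sum>k<n. sc ((q\<^sup>2) ^ (n - k)) (Wm k \<star> Wp (n - Suc k)))"
    by (simp add: lessThan_Suc_atMost[symmetric] 1)
  \<comment> \<open>On the left, deleting y shifts the index, which costs one power of q^2; on the
    right the same loss is the twist of \<open>Wm k\<close> by y.\<close>
  have 2: "(q\<^sup>2) ^ (n - k) * inverse (q\<^sup>2) = (q\<^sup>2) ^ (m - k)" if "k < n" for k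
    using that q2_nz n by (simp add: Suc_diff_le)
  have "dL Y (\<Sum>k\<le>n. sc ((q\<^sup>2) ^ (n - k)) (Gg k \<star> Gt (n - k)))
    = (\<Sum>k<n. sc ((q\<^sup>2) ^ (m - k)) (Wm k \<star> Gt (m - k)))"
    by (simp add: lessThan_Suc_atMost[symmetric] n sum.lessThan_Suc_shift del: sum.lessThan_Suc)
  also have "\<dots> = (\<Sum>k<n. sc ((q\<^sup>2) ^ (n - k) * inverse (q\<^sup>2)) (Wm k \<star> Gt (m - k)))"
    by (intro sum.cong refl) (simp only: lessThan_iff 2)
  also have "\<dots> = dL Y (\<Sum>k<n. sc ((q\<^sup>2) ^ (n - k)) (Wm k \<star> Wp (n - Suc k)))"
    by (simp add: n del: sum.lessThan_Suc)
  finally show "dL Y (\<Sum>k\<le>n. sc ((q\<^sup>2) ^ (n - k)) (Gg k \<star> Gt (n - k)))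
    = dL Y (\<Sum>k<n. sc ((q\<^sup>2) ^ (n - k)) (Wm k \<star> Wp (n - Suc k)))" .
qed

end

section \<open>Spanning\<close>

lemma UNIV_letter: "UNIV = {X, Y}"
  using letter.exhaust by auto

lemma finite_words: "finite {w :: letter list. length w \<le> n}"
proof -
  have "finite (UNIV :: letter set)" by (simp add: UNIV_letter)
  then show ?thesis using finite_lists_length_le[of "UNIV :: letter set" n] by simp
qed

lemma inV_iff: "inV f \<longleftrightarrow> (\<exists>n. \<forall>w. length w > n \<longrightarrow> f w = 0)"
proof
  assume "inV f"
  then have "finite (length ` supp f)" by (simp add: inV_def)
  then obtain n where "\<forall>m\<in>length ` supp f. m \<le> n"
    using finite_nat_set_iff_bounded_le by blast
  then show "\<exists>n. \<forall>w. length w > n \<longrightarrow> f w = 0"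
    by (intro exI[of _ n]) (auto simp: supp_def)
next
  assume "\<exists>n. \<forall>w. length w > n \<longrightarrow> f w = 0"
  then obtain n where "\<forall>w. length w > n \<longrightarrow> f w = 0" by blast
  then have "supp f \<subseteq> {w. length w \<le> n}"
    by (auto simp: supp_def) (meson not_le)
  then show "inV f"
    unfolding inV_def using finite_words finite_subset by blast
qed

lemma star_length:
  assumes "\<forall>w. length w > m \<longrightarrow> f w = 0" "\<forall>w. length w > n \<longrightarrow> g w = 0" "length w > m + n"
  shows "star q f g w = 0"
  using assms
proof (induction w arbitrary: m n f g)
  case (Cons c w)
  have "star q (dL c f) g w = 0"
  proof (cases m)
    case 0
    then have "dL c f = 0" using Cons.prems(1) by (auto simp: fun_eq_iff vec_apply)
    then show ?thesis by (simp add: zero_fun_apply)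
  next
    case (Suc m')
    then show ?thesis
      using Cons.IH[of m' "dL c f" n g] Cons.prems unfolding dL_apply by simp
  qed
  moreover have "star q (twist q c f) (dL c g) w = 0"
  proof (cases n)
    case 0
    then have "dL c g = 0" using Cons.prems(2) by (auto simp: fun_eq_iff vec_apply)
    then show ?thesis by (simp add: zero_fun_apply)
  next
    case (Suc n')
    then show ?thesis
      using Cons.IH[of m "twist q c f" n' "dL c g"] Cons.prems unfolding dL_apply by (simp add: twist_def)
  qed
  ultimately show ?case by simp
qed simp

lemma inV_star: "inV f \<Longrightarrow> inV g \<Longrightarrow> inV (star q f g)"
  unfolding inV_iff using star_length by metis

lemma inV_word: "inV (word u)"
  unfolding inV_iff word_def by (auto intro: exI[of _ "length u"])

lemma wstar_star: "wstar q u v w = star q (word u) (word v) w"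
proof (induction q u v w rule: wstar.induct)
  case (1 q v w)
  show ?case by simp (simp add: word_def)
next
  case (2 q a u w)
  show ?case by simp (simp add: word_def)
next
  case (3 q a u b v w)
  have ip0: "ip d c = 2 * letter_sign c * letter_sign d" for c d
    by (cases c; cases d; simp add: ip_def)
  then have ip: "sum_list (map (\<lambda>d. ip d c) x) = 2 * letter_sign c * weight x" for c x
    by (induction x) (simp_all add: ip0 distrib_left)
  have ip1: "ip d c + 2 * letter_sign c * weight x = 2 * letter_sign c * (letter_sign d + weight x)" for c d x
    by (simp add: ip0 distrib_left)
  have k: "twist q c (word x) = sc (q powi (2 * letter_sign c * weight x)) (word x)" for c x
    by (rule twist_has_weight[OF has_weight_word])
  show ?case
  proof (cases w)
    case Nil
    then show ?thesis by simp (simp add: word_def)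
  next
    case (Cons c w')
    show ?thesis
      using 3[of c w'] by (auto simp: Cons ip ip1 k dL_word zero_fun_apply sc_apply)
  qed
qed

lemma inV_expand: "inV f \<Longrightarrow> f = (\<Sum>u\<in>supp f. sc (f u) (word u))"
proof
  fix w assume "inV f"
  then have fin: "finite (supp f)" by (simp add: inV_def)
  have "(\<Sum>u\<in>A. sc (f u) (word u)) w = (\<Sum>u\<in>A. f u * word u w)" if "finite A" for A
    using that by induction (auto simp: vec_apply)
  then have "(\<Sum>u\<in>supp f. sc (f u) (word u)) w = (\<Sum>u\<in>supp f. if w = u then f u else 0)"
    using fin by (simp add: word_def if_distrib cong: if_cong)
  then show "f w = (\<Sum>u\<in>supp f. sc (f u) (word u)) w"
    using fin by (simp add: supp_def)
qed

lemma sum_fun_apply: "(\<Sum>i\<in>A. F i) w = (\<Sum>i\<in>A. F i w)" for F :: "'i \<Rightarrow> 'a::field vec"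
  by (induction A rule: infinite_finite_induct) (auto simp: vec_apply)

lemma qstar_eq_star:
  assumes "inV f" "inV g"
  shows "qstar q f g = star q f g"
proof
  fix w
  have "star q f g w = star q (\<Sum>u\<in>supp f. sc (f u) (word u)) (\<Sum>v\<in>supp g. sc (g v) (word v)) w"
    using inV_expand assms by metis
  also have "\<dots> = qstar q f g w"
    by (simp add: star_sum_left)
      (simp add: star_sum_right sum_fun_apply sc_apply qstar_def wstar_star mult.assoc sum_distrib_left)
  finally show "qstar q f g w = star q f g w" by simp
qed

lemma U_add: "f \<in> U_alg q \<Longrightarrow> g \<in> U_alg q \<Longrightarrow> f + g \<in> U_alg q"
  using U_alg.add[of f q g] by (simp add: plus_fun_def)

lemma U_sc: "f \<in> U_alg q \<Longrightarrow> sc c f \<in> U_alg q"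
  using U_alg.smult[of f q c] by (simp add: sc_def)

lemma U_zero: "0 \<in> U_alg q"
  using U_sc[OF U_alg.one[of q], of 0] by simp

lemma U_subspace: "fn.subspace (U_alg q)"
  by (simp add: fn.subspace_def U_add U_sc U_zero)

lemma U_diff: "f \<in> U_alg q \<Longrightarrow> g \<in> U_alg q \<Longrightarrow> f - g \<in> U_alg q"
  using fn.subspace_diff[OF U_subspace] .

lemma U_sum: "(\<And>i. i \<in> A \<Longrightarrow> F i \<in> U_alg q) \<Longrightarrow> sum F A \<in> U_alg q"
  using fn.subspace_sum[OF U_subspace] .

lemma U_sc_cancel: "sc c f \<in> U_alg q \<Longrightarrow> c \<noteq> 0 \<Longrightarrow> f \<in> U_alg q"
  using U_sc[of "sc c f" q "inverse c"] by simp

lemma U_inV: "f \<in> U_alg q \<Longrightarrow> inV f"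
proof (induction rule: U_alg.induct)
  case (add f g)
  then obtain m n where "\<forall>w. length w > m \<longrightarrow> f w = 0" "\<forall>w. length w > n \<longrightarrow> g w = 0"
    unfolding inV_iff by blast
  then show ?case
    unfolding inV_iff by (intro exI[of _ "max m n"]) auto
next
  case (smult f c)
  then show ?case unfolding inV_iff by (metis mult_zero_right)
next
  case (mult f g)
  then show ?case by (simp add: qstar_eq_star inV_star)
qed (rule inV_word)+

lemma U_star: "f \<in> U_alg q \<Longrightarrow> g \<in> U_alg q \<Longrightarrow> star q f g \<in> U_alg q"
  using U_alg.mult[of f q g] qstar_eq_star U_inV by metis

lemma word_letter: "Wm 0 = word [X]" "Wp 0 = word [Y]"
  by (simp_all add: Wm_def Wp_def W_neg_word_def W_pos_word_def)

lemma span_closed: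
  assumes "v \<in> fn.span B" "fn.subspace T" "\<And>b. b \<in> B \<Longrightarrow> F b \<in> T"
    and "\<And>f g. F (f + g) = F f + F g" "\<And>c f. F (sc c f) = sc c (F f)" "F 0 = 0"
  shows "F v \<in> T"
  using assms(1)
proof (rule fn.span_induct)
  show "fn.subspace {v. F v \<in> T}"
    using assms(2,4-6) by (auto simp: fn.subspace_def)
qed (use assms in auto)

lemmas span_closed_right = span_closed[where F = "star q f" for q f, OF _ _ _ star_add_right star_sc_right star_zero(2)]
lemmas span_closed_left = span_closed[where F = "\<lambda>f. star q f g" for q g, OF _ _ _ star_add_left star_sc_left star_zero(1)]

definition star_list :: "'a::field \<Rightarrow> 'a vec list \<Rightarrow> 'a vec" where
  "star_list q fs = foldr (star q) fs one"

lemma star_list_simps [simp]: "star_list q [] = one" "star_list q (f # fs) = star q f (star_list q fs)"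
  by (simp_all add: star_list_def)

lemma omega_elt_simps [simp]:
  "omega_elt (Wneg i) = Wm i" "omega_elt (Gs j) = Gg (Suc j)" "omega_elt (Wpos k) = Wp k"
  by (simp_all add: omega_elt_def Wm_def Gg_def Wp_def)

lemma pbw_prod_eq: "pbw_prod q as = star_list q (map omega_elt as)" and inV_star_list_omega: "inV (star_list q (map omega_elt as))"
proof -
  have "pbw_prod q as = star_list q (map omega_elt as) \<and> inV (star_list q (map omega_elt as))"
    by (induction as) (auto simp: pbw_prod_def inV_star inV_word omega_elt_def qstar_eq_star)
  then show "pbw_prod q as = star_list q (map omega_elt as)" "inV (star_list q (map omega_elt as))" by auto
qed

text \<open>Modulo the span of the p, the relations make \<open>r k l\<close> symmetric in k and l
  and identify \<open>r k (Suc l)\<close> with \<open>r l (Suc k)\<close>. Hence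
  \<open>r k (Suc l)\<close> equals \<open>r (Suc k) l\<close>, and the second index descends to 0,
  where p and r agree. As \<alpha> is invertible, the argument also works with p and r
  exchanged.\<close>

lemma swap_span:
  fixes p r :: "nat \<Rightarrow> nat \<Rightarrow> 'a::field vec"
  assumes "\<alpha> \<noteq> 0"
    and sym: "\<And>k l. sc \<alpha> (p k l) - r k l = sc \<alpha> (p l k) - r l k"
    and shift: "\<And>k l. p k (Suc l) - r k (Suc l) = p l (Suc k) - r l (Suc k)"
    and base: "\<And>n. p n 0 = r n 0"
  shows swap_span_r: "r k l \<in> fn.span {p a b |a b. a + b = k + l}"
    and swap_span_p: "p k l \<in> fn.span {r a b |a b. a + b = k + l}"
proof -
  have main: "y k l \<in> Q"
    if Q: "fn.subspace Q" and 1: "\<And>k l. k + l = n \<Longrightarrow> y k l - y l k \<in> Q"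
      and 2: "\<And>k l. k + Suc l = n \<Longrightarrow> y k (Suc l) - y l (Suc k) \<in> Q" and 3: "y n 0 \<in> Q" and n: "k + l = n"
    for y :: "nat \<Rightarrow> nat \<Rightarrow> 'a vec" and Q n k l
    using n
  proof (induction l arbitrary: k)
    case 0
    then show ?case using 3 by simp
  next
    case (Suc l)
    have "y k (Suc l) = (y k (Suc l) - y l (Suc k)) + (y l (Suc k) - y (Suc k) l) + y (Suc k) l"
      by simp
    moreover have "\<dots> \<in> Q"
      using Suc by (intro fn.subspace_add[OF Q] 1 2 Suc.IH) auto
    ultimately show ?case by simp
  qed
  let ?P = "fn.span {p a b |a b. a + b = k + l}" and ?R = "fn.span {r a b |a b. a + b = k + l}"
  have P: "p a b \<in> ?P" and R: "r a b \<in> ?R" if "a + b = k + l" for a b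
    using that by (blast intro: fn.span_base)+
  show "r k l \<in> ?P"
  proof (rule main[OF fn.subspace_span _ _ _ refl])
    fix a b
    show "r a b - r b a \<in> ?P" if "a + b = k + l"
    proof -
      have "r a b - r b a = sc \<alpha> (p a b) - sc \<alpha> (p b a)"
        using sym[of a b] by (simp add: algebra_simps)
      then show ?thesis using that P by (simp add: fn.span_diff fn.span_scale add.commute)
    qed
    show "r a (Suc b) - r b (Suc a) \<in> ?P" if "a + Suc b = k + l"
    proof -
      have "r a (Suc b) - r b (Suc a) = p a (Suc b) - p b (Suc a)"
        using shift[of a b] by (simp add: algebra_simps)
      then show ?thesis using that P by (simp add: fn.span_diff)
    qed
    show "r (k + l) 0 \<in> ?P" using P[of "k + l" 0] by (simp add: base)
  qed
  show "p k l \<in> ?R"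
  proof (rule main[OF fn.subspace_span _ _ _ refl])
    fix a b
    show "p a b - p b a \<in> ?R" if "a + b = k + l"
    proof -
      have "sc \<alpha> (p a b - p b a) = r a b - r b a"
        using sym[of a b] by (simp add: algebra_simps fn.scale_right_diff_distrib)
      then have "p a b - p b a = sc (inverse \<alpha>) (r a b - r b a)"
        using \<open>\<alpha> \<noteq> 0\<close> by (metis fn.scale_one left_inverse sc_sc)
      then show ?thesis using that R by (simp add: fn.span_diff fn.span_scale add.commute)
    qed
    show "p a (Suc b) - p b (Suc a) \<in> ?R" if "a + Suc b = k + l"
    proof -
      have "p a (Suc b) - p b (Suc a) = r a (Suc b) - r b (Suc a)"
        using shift[of a b] by (simp add: algebra_simps)
      then show ?thesis using that R by (simp add: fn.span_diff)
    qed
    show "p (k + l) 0 \<in> ?R" using R[of "k + l" 0] by (simp add: base[symmetric])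
  qed
qed

section \<open>Straightening into the order W_-, G, W_+\<close>

context qshuffle
begin

lemma star_list_append: "star_list q (xs @ ys) = star_list q xs \<star> star_list q ys"
  by (induction xs) (simp_all add: star_assoc)

text \<open>The induction shows that left multiplication by f preserves T, a property that passes to
  products by associativity; applied to 1 it gives f itself.\<close>

lemma U_subset:
  assumes T: "fn.subspace T" "one \<in> T"
    and left: "\<And>g. g \<in> T \<Longrightarrow> Wm 0 \<star> g \<in> T" "\<And>g. g \<in> T \<Longrightarrow> Wp 0 \<star> g \<in> T"
  shows "U_alg q \<subseteq> T"
proof
  fix f assume f: "f \<in> U_alg q"
  then have "\<forall>g\<in>T. f \<star> g \<in> T"
  proof (induction rule: U_alg.induct)
    case (add f g)
    have "(\<lambda>w. f w + g w) = f + g" by (simp add: plus_fun_def)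
    then show ?case using add fn.subspace_add[OF T(1)] by simp
  next
    case (smult f c)
    have "(\<lambda>w. c * f w) = sc c f" by (simp add: sc_def)
    then show ?case using smult fn.subspace_scale[OF T(1)] by simp
  next
    case (mult f g)
    then show ?case by (simp add: qstar_eq_star U_inV star_assoc)
  qed (use left in \<open>simp_all add: word_letter\<close>)
  then show "f \<in> T" using T(2) star_one_right by metis
qed

lemma one_minus_q2: "1 - inverse (q\<^sup>2) \<noteq> 0"
  using q_nru[of 2] by simp_all

text \<open>Were (q^2)^n equal to -1, its square q^(4n) would be 1.\<close>

lemma q2_pow_ne: "n > 0 \<Longrightarrow> (q\<^sup>2) ^ n \<noteq> 1" and q2_pow_plus: "n > 0 \<Longrightarrow> (q\<^sup>2) ^ n + 1 \<noteq> 0"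
proof -
  assume n: "n > 0"
  show "(q\<^sup>2) ^ n \<noteq> 1" using q_nru[of "2 * n"] n by (simp add: power_mult)
  have "(q\<^sup>2) ^ (2 * n) \<noteq> 1" using q_nru[of "2 * (2 * n)"] n by (simp add: power_mult)
  then show "(q\<^sup>2) ^ n + 1 \<noteq> 0"
    by (metis add_eq_0_iff2 mult.commute power2_minus power_mult power_one)
qed

lemma X_Gg: "Wm 0 \<star> Gg k - sc (inverse (q\<^sup>2)) (Gg k \<star> Wm 0) = sc (1 - inverse (q\<^sup>2)) (Wm k)"
  using arg_cong[OF Gg_Y[of k], of rev_swap] by (simp add: rev_swap_star)

lemma Gt_solve:
  assumes "n > 0"
  shows "sc ((q\<^sup>2) ^ n) (Gt n) = (\<Sum>k<n. sc ((q\<^sup>2) ^ (n - k)) (Wm k \<star> Wp (n - Suc k)))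
    - (\<Sum>k\<in>{1..n}. sc ((q\<^sup>2) ^ (n - k)) (Gg k \<star> Gt (n - k)))"
proof -
  have "{..n} = insert 0 {1..n}" by auto
  then show ?thesis using Gt_relation[OF assms] by (simp add: algebra_simps)
qed

text \<open>\<open>Gg n\<close> and \<open>Gt n\<close> are found together: the commutator of y with
  W_{-(n-1)} gives their difference, and the quadratic relation gives \<open>Gg n\<close> plus
  q^(2n) \<open>Gt n\<close> in terms of smaller indices. The determinant q^(2n) + 1 is nonzero. The
  q-commutators with x and y then yield \<open>Wm n\<close> and \<open>Wp n\<close>.\<close>

lemma alternating_in_U: "Wm n \<in> U_alg q \<and> Wp n \<in> U_alg q \<and> Gg n \<in> U_alg q \<and> Gt n \<in> U_alg q"
proof (induction n rule: less_induct)
  case (less n)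
  have xy: "Wm 0 \<in> U_alg q" "Wp 0 \<in> U_alg q"
    by (simp_all add: word_letter U_alg.intros)
  have G: "Gg n \<in> U_alg q \<and> Gt n \<in> U_alg q"
  proof (cases n)
    case 0
    then show ?thesis by (simp add: U_alg.one)
  next
    case (Suc m)
    have "Wp 0 \<star> Wm m - Wm m \<star> Wp 0 \<in> U_alg q"
      using less[of m] xy Suc by (intro U_diff U_star) auto
    then have d: "Gg n - Gt n \<in> U_alg q"
      unfolding Y_Wm Suc using U_sc_cancel one_minus_q2 by blast
    \<comment> \<open>The summand k = n is \<open>Gg n\<close> itself, not yet known to lie in U, so
      it is moved to the other side.\<close>
    have "{1..n} = insert n {1..<n}" using Suc by auto
    then have e: "sc ((q\<^sup>2) ^ n) (Gt n) + Gg n = (\<Sum>k<n. sc ((q\<^sup>2) ^ (n - k)) (Wm k \<star> Wp (n - Suc k)))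
      - (\<Sum>k\<in>{1..<n}. sc ((q\<^sup>2) ^ (n - k)) (Gg k \<star> Gt (n - k)))"
      using Gt_solve[of n] Suc by (simp add: algebra_simps)
    have "\<dots> \<in> U_alg q"
      using less Suc by (intro U_diff U_sum U_sc U_star) auto
    then have "(sc ((q\<^sup>2) ^ n) (Gt n) + Gg n) - (Gg n - Gt n) \<in> U_alg q"
      using d e by (simp only: U_diff)
    then have "sc ((q\<^sup>2) ^ n + 1) (Gt n) \<in> U_alg q"
      by (simp add: fn.scale_left_distrib)
    then have "Gt n \<in> U_alg q" using U_sc_cancel q2_pow_plus[of n] Suc by blast
    then show ?thesis using U_add[OF d] by force
  qed
  have "Wm 0 \<star> Gg n - sc (inverse (q\<^sup>2)) (Gg n \<star> Wm 0) \<in> U_alg q"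
    "Gg n \<star> Wp 0 - sc (inverse (q\<^sup>2)) (Wp 0 \<star> Gg n) \<in> U_alg q"
    using G xy by (intro U_diff U_star U_sc; simp)+
  then show ?case
    using G unfolding X_Gg Gg_Y using U_sc_cancel one_minus_q2 by blast
qed

lemma star_list_omega_in_U: "star_list q (map omega_elt as) \<in> U_alg q"
proof (induction as)
  case (Cons a as)
  have "omega_elt a \<in> U_alg q" using alternating_in_U by (cases a) auto
  then show ?case using Cons by (simp add: U_star)
qed (simp add: U_alg.one)

lemma rev_swap_Gg_Wp_sym: "sc (q\<^sup>2) (Gg l \<star> Wp k) - Wp k \<star> Gg l = sc (q\<^sup>2) (Gg k \<star> Wp l) - Wp l \<star> Gg k"
  using arg_cong[OF Wm_Gg_sym[of k l], of rev_swap] by (simp add: rev_swap_star)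

lemma rev_swap_Gg_Wp_Suc: "Gg (Suc l) \<star> Wp k - Wp k \<star> Gg (Suc l) = Gg (Suc k) \<star> Wp l - Wp l \<star> Gg (Suc k)"
  using arg_cong[OF Wm_Gg_Suc[of k l], of rev_swap] by (simp add: rev_swap_star)

lemma Gg_Wm_span: "Gg l \<star> Wm k \<in> fn.span {Wm a \<star> Gg b |a b. a + b = k + l}"
  and Wm_Gg_span: "Wm k \<star> Gg l \<in> fn.span {Gg b \<star> Wm a |a b. a + b = k + l}"
  using swap_span[of "q\<^sup>2" "\<lambda>k l. Wm k \<star> Gg l" "\<lambda>k l. Gg l \<star> Wm k" k l, OF q2_nz Wm_Gg_sym Wm_Gg_Suc]
  by simp_all

lemma Wp_Gg_span: "Wp k \<star> Gg l \<in> fn.span {Gg b \<star> Wp a |a b. a + b = k + l}"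
  and Gg_Wp_span: "Gg l \<star> Wp k \<in> fn.span {Wp a \<star> Gg b |a b. a + b = k + l}"
  using swap_span[of "q\<^sup>2" "\<lambda>k l. Gg l \<star> Wp k" "\<lambda>k l. Wp k \<star> Gg l" k l, OF q2_nz rev_swap_Gg_Wp_sym rev_swap_Gg_Wp_Suc]
  by simp_all

text \<open>The indices of \<open>Gg\<close> are not shifted, so an entry 0 of js contributes the
  factor 1 and the exchange rules apply to all indices alike. Independence will be stated with
  \<open>map Suc js\<close>.\<close>

definition M :: "nat list \<Rightarrow> nat list \<Rightarrow> nat list \<Rightarrow> 'a vec" where
  "M is js ks = star_list q (map Wm is @ map Gg js @ map Wp ks)"

lemma M_simps: "M (i # is) js ks = Wm i \<star> M is js ks" "M [] (j # js) ks = Gg j \<star> M [] js ks"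
  "M [] [] (k # ks) = Wp k \<star> M [] [] ks" "M [] [] [] = one"
  by (simp_all add: M_def)

text \<open>The common length of the words that occur in the monomial.\<close>

definition M_degree :: "nat list \<Rightarrow> nat list \<Rightarrow> nat list \<Rightarrow> nat" where
  "M_degree is js ks = (\<Sum>i\<leftarrow>is. 2 * i + 1) + (\<Sum>j\<leftarrow>js. 2 * j) + (\<Sum>k\<leftarrow>ks. 2 * k + 1)"

lemma M_degree_simps [simp]: "M_degree (i # is) js ks = 2 * i + 1 + M_degree is js ks" "M_degree is (j # js) ks = 2 * j + M_degree is js ks"
  "M_degree is js (k # ks) = 2 * k + 1 + M_degree is js ks"
  by (simp_all add: M_degree_def)

definition M_span :: "nat \<Rightarrow> 'a vec set" where
  "M_span e = fn.span {M is js ks |is js ks. M_degree is js ks = e}"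

lemma M_span_subspace: "fn.subspace (M_span e)"
  by (simp add: M_span_def)

lemmas M_span_add = fn.subspace_add[OF M_span_subspace]
  and M_span_diff = fn.subspace_diff[OF M_span_subspace]
  and M_span_sc = fn.subspace_scale[OF M_span_subspace]
  and M_span_sum = fn.subspace_sum[OF M_span_subspace]

lemma M_in_M_span: "M_degree is js ks = e \<Longrightarrow> M is js ks \<in> M_span e"
  unfolding M_span_def by (blast intro: fn.span_base)

lemma M_span_left:
  assumes "f \<in> M_span e" "\<And>is js ks. M_degree is js ks = e \<Longrightarrow> g \<star> M is js ks \<in> M_span e'"
  shows "g \<star> f \<in> M_span e'"
  using assms(1) unfolding M_span_def[of e] by (rule span_closed_right[OF _ M_span_subspace]) (use assms(2) in auto)

lemma Wm_M_span: "f \<in> M_span e \<Longrightarrow> e' = 2 * i + 1 + e \<Longrightarrow> Wm i \<star> f \<in> M_span e'"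
  by (erule M_span_left) (simp add: M_in_M_span flip: M_simps(1))

lemma Gg_M: "Gg k \<star> M is js ks \<in> M_span (2 * k + M_degree is js ks)"
proof (induction "is" arbitrary: k)
  case Nil
  show ?case by (simp add: M_in_M_span flip: M_simps(2))
next
  case (Cons i "is")
  have "(Gg k \<star> Wm i) \<star> M is js ks \<in> M_span (2 * k + M_degree (i # is) js ks)"
  proof (rule span_closed_left[OF Gg_Wm_span M_span_subspace])
    fix b :: "'a vec" assume "b \<in> {Wm a \<star> Gg b |a b. a + b = i + k}"
    then obtain a c where b: "b = Wm a \<star> Gg c" "a + c = i + k" by blast
    show "b \<star> M is js ks \<in> M_span (2 * k + M_degree (i # is) js ks)"
      unfolding b star_assoc by (rule Wm_M_span[OF Cons]) (use b(2) in simp)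
  qed
  then show ?case by (simp add: M_simps star_assoc)
qed

lemma Gg_M_span: "f \<in> M_span e \<Longrightarrow> e' = 2 * i + e \<Longrightarrow> Gg i \<star> f \<in> M_span e'"
  by (erule M_span_left) (use Gg_M in auto)

lemma Wp_M: "Wp m \<star> M [] js ks \<in> M_span (2 * m + 1 + M_degree [] js ks)"
proof (induction js arbitrary: m)
  case Nil
  show ?case by (simp add: M_in_M_span flip: M_simps(3))
next
  case (Cons j js)
  have "(Wp m \<star> Gg j) \<star> M [] js ks \<in> M_span (2 * m + 1 + M_degree [] (j # js) ks)"
  proof (rule span_closed_left[OF Wp_Gg_span M_span_subspace])
    fix b :: "'a vec" assume "b \<in> {Gg b \<star> Wp a |a b. a + b = m + j}"
    then obtain a c where b: "b = Gg c \<star> Wp a" "a + c = m + j" by blast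
    show "b \<star> M [] js ks \<in> M_span (2 * m + 1 + M_degree [] (j # js) ks)"
      unfolding b star_assoc by (rule Gg_M_span[OF Cons]) (use b(2) in simp)
  qed
  then show ?case by (simp add: M_simps star_assoc)
qed

text \<open>In degree d the claim for \<open>Gt\<close> comes first: the quadratic relation leaves
  \<open>Wp\<close> and \<open>Gt\<close> acting in smaller degrees only. Moving y past a leading
  \<open>Wm i\<close> then costs a \<open>Gg\<close> and a \<open>Gt\<close> in the same degree d,
  which are already settled. Finally \<open>Wp m\<close> is a q-commutator of \<open>Gg m\<close>
  and y.\<close>

lemma Gt_Wp_M_span:
  "(\<forall>n is js ks. 2 * n + M_degree is js ks = d \<longrightarrow> Gt n \<star> M is js ks \<in> M_span d)
  \<and> (\<forall>m is js ks. 2 * m + 1 + M_degree is js ks = d \<longrightarrow> Wp m \<star> M is js ks \<in> M_span d)"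
proof (induction d rule: less_induct)
  case (less d)
  have IHt: "Gt n \<star> M is js ks \<in> M_span e" if "e < d" "2 * n + M_degree is js ks = e" for n "is" js ks e
    using less that by blast
  have IHp: "Wp n \<star> M is js ks \<in> M_span e" if "e < d" "2 * n + 1 + M_degree is js ks = e" for n "is" js ks e
    using less that by blast
  have T: "Gt n \<star> M is js ks \<in> M_span d" if d: "2 * n + M_degree is js ks = d" for n "is" js ks
  proof (cases "n = 0")
    case True
    then show ?thesis using d by (simp add: M_in_M_span)
  next
    case False
    have "sc ((q\<^sup>2) ^ n) (Gt n) \<star> M is js ks
      = (\<Sum>k<n. sc ((q\<^sup>2) ^ (n - k)) (Wm k \<star> (Wp (n - Suc k) \<star> M is js ks)))
      - (\<Sum>k\<in>{1..n}. sc ((q\<^sup>2) ^ (n - k)) (Gg k \<star> (Gt (n - k) \<star> M is js ks)))"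
      using Gt_solve[of n] False by (simp del: star_sc_left add: star_sum_left) (simp add: star_assoc)
    moreover have "\<dots> \<in> M_span d"
    proof (intro M_span_diff M_span_sum M_span_sc)
      fix k assume k: "k \<in> {..<n}"
      show "Wm k \<star> (Wp (n - Suc k) \<star> M is js ks) \<in> M_span d"
        by (rule Wm_M_span[OF IHp[OF _ refl]]) (use k d in auto)
    next
      fix k assume k: "k \<in> {1..n}"
      show "Gg k \<star> (Gt (n - k) \<star> M is js ks) \<in> M_span d"
        by (rule Gg_M_span[OF IHt[OF _ refl]]) (use k d in auto)
    qed
    ultimately have "sc ((q\<^sup>2) ^ n) (Gt n \<star> M is js ks) \<in> M_span d" by simp
    then have "sc (inverse ((q\<^sup>2) ^ n)) (sc ((q\<^sup>2) ^ n) (Gt n \<star> M is js ks)) \<in> M_span d" by (rule M_span_sc)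
    then show ?thesis using q_nz by simp
  qed
  have P0: "Wp 0 \<star> M is js ks \<in> M_span d" if d: "1 + M_degree is js ks = d" for "is" js ks
  proof (cases "is")
    case Nil
    then show ?thesis using Wp_M[of 0 js ks] d by simp
  next
    case (Cons i is')
    have "Wp 0 \<star> Wm i = Wm i \<star> Wp 0 + sc (1 - inverse (q\<^sup>2)) (Gg (Suc i) - Gt (Suc i))"
      using Y_Wm[of i] by (simp add: algebra_simps)
    then have "Wp 0 \<star> M is js ks = Wm i \<star> (Wp 0 \<star> M is' js ks)
      + sc (1 - inverse (q\<^sup>2)) (Gg (Suc i) \<star> M is' js ks - Gt (Suc i) \<star> M is' js ks)"
      by (simp add: Cons M_simps flip: star_assoc)
    moreover have "\<dots> \<in> M_span d"
    proof (intro M_span_add M_span_sc M_span_diff)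
      show "Wm i \<star> (Wp 0 \<star> M is' js ks) \<in> M_span d"
        by (rule Wm_M_span[OF IHp[OF _ refl]]) (use d Cons in auto)
      show "Gg (Suc i) \<star> M is' js ks \<in> M_span d"
        by (rule Gg_M_span[OF M_in_M_span[OF refl]]) (use d Cons in auto)
      show "Gt (Suc i) \<star> M is' js ks \<in> M_span d"
        by (rule T) (use d Cons in auto)
    qed
    ultimately show ?thesis by simp
  qed
  have P: "Wp m \<star> M is js ks \<in> M_span d" if d: "2 * m + 1 + M_degree is js ks = d" for m "is" js ks
  proof (cases "m = 0")
    case False
    have "sc (1 - inverse (q\<^sup>2)) (Wp m \<star> M is js ks)
      = Gg m \<star> (Wp 0 \<star> M is js ks) - sc (inverse (q\<^sup>2)) (Wp 0 \<star> (Gg m \<star> M is js ks))"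
      using arg_cong[OF Gg_Y[of m], of "\<lambda>f. f \<star> M is js ks"] by (simp add: star_assoc)
    moreover have "\<dots> \<in> M_span d"
    proof (intro M_span_diff M_span_sc)
      show "Gg m \<star> (Wp 0 \<star> M is js ks) \<in> M_span d"
        by (rule Gg_M_span[OF IHp[OF _ refl]]) (use d False in auto)
      show "Wp 0 \<star> (Gg m \<star> M is js ks) \<in> M_span d"
        by (rule M_span_left[OF Gg_M P0]) (use d in auto)
    qed
    ultimately have "sc (inverse (1 - inverse (q\<^sup>2))) (sc (1 - inverse (q\<^sup>2)) (Wp m \<star> M is js ks)) \<in> M_span d"
      using M_span_sc by presburger
    then show ?thesis using one_minus_q2 by simp
  qed (use P0 d in simp)
  show ?case using T P by blast
qed

lemma U_subset_M: "U_alg q \<subseteq> fn.span {M is js ks |is js ks. True}"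
proof (rule U_subset)
  let ?T = "fn.span {M is js ks |is js ks. True}"
  have sub: "M_span e \<subseteq> ?T" for e
    unfolding M_span_def by (rule fn.span_mono) blast
  have MT: "M is js ks \<in> ?T" for "is" js ks
    by (blast intro: fn.span_base)
  show "one \<in> ?T" unfolding M_simps(4)[symmetric] by (blast intro: fn.span_base)
  have PT: "Wp 0 \<star> M is js ks \<in> ?T" for "is" js ks
    using Gt_Wp_M_span[of "2 * 0 + 1 + M_degree is js ks"] sub by blast
  fix g assume g: "g \<in> ?T"
  show "Wm 0 \<star> g \<in> ?T"
    using g by (rule span_closed_right) (simp, use MT in \<open>auto simp flip: M_simps(1)\<close>)
  show "Wp 0 \<star> g \<in> ?T"
    using g by (rule span_closed_right) (simp, use PT in auto)
qed simp

end

section \<open>Operators on products of generating functions\<close>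

text \<open>Besides linearity, the value at w may involve only words of length at most
  \<open>length w + d\<close> for a fixed d. This bounded range lets the operator act
  coefficientwise on series with infinite support.\<close>

definition local_linear :: "('a::field vec \<Rightarrow> 'a vec) \<Rightarrow> bool" where
  "local_linear T \<longleftrightarrow> (\<forall>f g. T (f + g) = T f + T g) \<and> (\<forall>c f. T (sc c f) = sc c (T f))
    \<and> (\<exists>d. \<forall>w f g. (\<forall>v. length v \<le> length w + d \<longrightarrow> f v = g v) \<longrightarrow> T f w = T g w)"

lemma local_linear_add: "local_linear T \<Longrightarrow> T (f + g) = T f + T g" and local_linear_sc: "local_linear T \<Longrightarrow> T (sc c f) = sc c (T f)"
  by (simp_all add: local_linear_def)

lemma local_linear_zero: "local_linear T \<Longrightarrow> T 0 = 0"
  using local_linear_sc[of T 0 0] by simp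

lemma local_linear_sum: "local_linear T \<Longrightarrow> T (sum F A) = (\<Sum>i\<in>A. T (F i))"
  by (induction A rule: infinite_finite_induct) (simp_all add: local_linear_zero local_linear_add)

lemma local_linear_sum_list: "local_linear T \<Longrightarrow> T (sum_list (map F xs)) = (\<Sum>x\<leftarrow>xs. T (F x))"
  by (induction xs) (simp_all add: local_linear_zero local_linear_add)

lemma local_linear_id: "local_linear (\<lambda>f. f)"
  unfolding local_linear_def by auto

lemma local_linear_dL: "local_linear (dL c)"
proof -
  have "\<forall>w f g. (\<forall>v. length v \<le> length w + 1 \<longrightarrow> f v = g v) \<longrightarrow> dL c f w = dL c g w" for c :: letter
    by (auto simp: dL_def)
  then show ?thesis unfolding local_linear_def dL_add dL_sc by blast
qed

lemma local_linear_rev_swap: "local_linear rev_swap"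
proof -
  have "\<forall>w f g. (\<forall>v. length v \<le> length w + 0 \<longrightarrow> f v = g v) \<longrightarrow> rev_swap f w = rev_swap g w"
    by (auto simp: rev_swap_def)
  then show ?thesis unfolding local_linear_def rev_swap_add rev_swap_sc by blast
qed

lemma local_linear_comp: "local_linear T \<Longrightarrow> local_linear T' \<Longrightarrow> local_linear (\<lambda>f. T (T' f))"
proof -
  assume T: "local_linear T" and T': "local_linear T'"
  then obtain d d' where
    d: "\<And>w f g. (\<forall>v. length v \<le> length w + d \<longrightarrow> f v = g v) \<Longrightarrow> T f w = T g w" and
    d': "\<And>w f g. (\<forall>v. length v \<le> length w + d' \<longrightarrow> f v = g v) \<Longrightarrow> T' f w = T' g w"
    unfolding local_linear_def by blast
  have "T (T' f) w = T (T' g) w" if "\<forall>v. length v \<le> length w + (d + d') \<longrightarrow> f v = g v" for w f g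
    by (rule d, intro allI impI, rule d') (use that in auto)
  then show ?thesis using T T' unfolding local_linear_def by auto
qed

lemma local_linear_plus: "local_linear T \<Longrightarrow> local_linear T' \<Longrightarrow> local_linear (\<lambda>f. T f + T' f)"
proof -
  assume T: "local_linear T" and T': "local_linear T'"
  then obtain d d' where
    d: "\<And>w f g. (\<forall>v. length v \<le> length w + d \<longrightarrow> f v = g v) \<Longrightarrow> T f w = T g w" and
    d': "\<And>w f g. (\<forall>v. length v \<le> length w + d' \<longrightarrow> f v = g v) \<Longrightarrow> T' f w = T' g w"
    unfolding local_linear_def by blast
  have "(T f + T' f) w = (T g + T' g) w" if "\<forall>v. length v \<le> length w + (d + d') \<longrightarrow> f v = g v" for w f g
    using d[of w f g] d'[of w f g] that by (simp add: plus_fun_apply)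
  then have "\<exists>d. \<forall>w f g. (\<forall>v. length v \<le> length w + d \<longrightarrow> f v = g v) \<longrightarrow> (T f + T' f) w = (T g + T' g) w"
    by blast
  then show ?thesis using T T' by (simp add: local_linear_def sc_add)
qed

lemma local_linear_scale: "local_linear T \<Longrightarrow> local_linear (\<lambda>f. sc a (T f))"
  unfolding local_linear_def by (simp add: sc_add mult.commute) (metis sc_apply)

lemma local_linear_diff: "local_linear T \<Longrightarrow> local_linear T' \<Longrightarrow> local_linear (\<lambda>f. T f - T' f)"
  using local_linear_plus[OF _ local_linear_scale[of T' "-1"], of T] by (simp add: sc_minus_one)

text \<open>Each entry selects one element \<open>u\<close>; its scalar \<open>\<Prod>(q\<^sup>2 u - x) / (u - x)\<close> arises from moving \<open>gG u\<close> to the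
  right through the factors \<open>gW x\<close>.\<close>
fun sel :: "'a::field \<Rightarrow> 'a list \<Rightarrow> ('a \<times> 'a \<times> 'a list) list" where
  "sel q [] = []"
| "sel q (t # ts) = ((\<Prod>x\<leftarrow>ts. (q\<^sup>2 * t - x) / (t - x)), t, ts)
    # map (\<lambda>(c, u, us). (c * ((q\<^sup>2 * u - t) / (u - t)), u, t # us)) (sel q ts)"

lemma sel_mset: "(c, u, us) \<in> set (sel q ts) \<Longrightarrow> mset ts = add_mset u (mset us)"
  by (induction ts arbitrary: c u us) auto

lemma sel_props:
  fixes F :: "'a::field \<Rightarrow> 'a"
  assumes "(c, u, us) \<in> set (sel q ts)"
  shows "length ts = Suc (length us)" "u \<in> set ts" "distinct ts \<Longrightarrow> distinct us"
    "prod_list (map F ts) = F u * prod_list (map F us)" "sum_list ts = u + sum_list us"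
proof -
  have m: "mset ts = add_mset u (mset us)" using sel_mset[OF assms] .
  then have m': "mset ts = mset (u # us)" by simp
  show "length ts = Suc (length us)" using mset_eq_length[OF m'] by simp
  show "u \<in> set ts" using mset_eq_setD[OF m'] by simp
  show "distinct ts \<Longrightarrow> distinct us" using mset_eq_imp_distinct_iff[OF m'] by simp
  show "prod_list (map F ts) = F u * prod_list (map F us)"
  proof -
    have "prod_mset (image_mset F (mset ts)) = F u * prod_mset (image_mset F (mset us))"
      by (simp add: m)
    then show ?thesis by (simp only: mset_map[symmetric] prod_mset_prod_list)
  qed
  show "sum_list ts = u + sum_list us"
  proof -
    have "sum_mset (mset ts) = u + sum_mset (mset us)"
      by (simp add: m)
    then show ?thesis by (simp only: sum_mset_sum_list)
  qed
qed

lemma star_sum_list_right: "star q f (\<Sum>x\<leftarrow>xs. F x) = (\<Sum>x\<leftarrow>xs. star q f (F x))"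
  by (induction xs) simp_all

lemma sc_sum_list: "sc a (\<Sum>x\<leftarrow>xs. F x) = (\<Sum>x\<leftarrow>xs. sc a (F x))"
  by (induction xs) (simp_all add: sc_add)

lemma sum_list_fun_apply: "(\<Sum>x\<leftarrow>xs. F x) w = (\<Sum>x\<leftarrow>xs. F x w)" for F :: "'i \<Rightarrow> 'a::field vec"
  by (induction xs) (auto simp: vec_apply)

section \<open>The operator E, its eigenvectors, and the deletion of x\<close>

context qshuffle
begin

text \<open>A q^2-commutator of the two deletions, scaled so that the mixed terms cancel when a
  factor \<open>gW t\<close> is split off on the left. For \<open>gG t\<close> and
  \<open>gP t\<close> they cancel if the remaining product has no word starting with x; the order of
  the three blocks guarantees this.\<close>

definition E :: "'a vec \<Rightarrow> 'a vec" where
  "E f = dL Y (dL X f) - sc (q\<^sup>2) (dL X (dL Y f))"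

lemma local_linear_E: "local_linear E"
  unfolding E_def by (intro local_linear_diff local_linear_scale local_linear_comp[OF local_linear_dL local_linear_dL])

lemma E_gW: "E (gW t \<star> f) = sc t (gW t \<star> f) + gW t \<star> E f"
proof
  fix w show "E (gW t \<star> f) w = (sc t (gW t \<star> f) + gW t \<star> E f) w"
    using q_nz by (simp add: E_def)
qed

lemma E_gG:
  assumes "dL X f = 0"
  shows "E (gG t \<star> f) = sc (- q\<^sup>2 * t) (gG t \<star> f) + gG t \<star> E f"
proof
  fix w show "E (gG t \<star> f) w = (sc (- q\<^sup>2 * t) (gG t \<star> f) + gG t \<star> E f) w"
    by (simp add: E_def assms) (simp add: vec_apply algebra_simps)
qed

lemma E_gP:
  assumes "dL X f = 0"
  shows "E (gP t \<star> f) = sc (- q\<^sup>2 * t) (gP t \<star> f) + gP t \<star> E f"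
proof
  fix w show "E (gP t \<star> f) w = (sc (- q\<^sup>2 * t) (gP t \<star> f) + gP t \<star> E f) w"
    using q_nz by (simp add: E_def assms) (simp add: vec_apply algebra_simps)
qed

lemma E_step: "E (F \<star> f) = sc x (F \<star> f) + F \<star> E f \<Longrightarrow> E f = sc y f \<Longrightarrow> E (F \<star> f) = sc (x + y) (F \<star> f)"
  by (simp only: star_sc_right fn.scale_left_distrib)

lemma E_one: "E one = sc 0 one"
  by (simp add: E_def)

definition PW :: "'a list \<Rightarrow> 'a vec \<Rightarrow> 'a vec" where
  "PW ts h = foldr (\<lambda>t f. gW t \<star> f) ts h"

definition PG :: "'a list \<Rightarrow> 'a vec \<Rightarrow> 'a vec" where
  "PG ts h = foldr (\<lambda>t f. gG t \<star> f) ts h"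

definition PP :: "'a list \<Rightarrow> 'a vec" where
  "PP ts = foldr (\<lambda>t f. gP t \<star> f) ts one"

lemma PW_simps [simp]: "PW [] h = h" "PW (t # ts) h = gW t \<star> PW ts h"
  and PG_simps [simp]: "PG [] h = h" "PG (t # ts) h = gG t \<star> PG ts h"
  and PP_simps [simp]: "PP [] = one" "PP (t # ts) = gP t \<star> PP ts"
  by (simp_all add: PW_def PG_def PP_def)

definition Psi :: "'a list \<Rightarrow> 'a list \<Rightarrow> 'a list \<Rightarrow> 'a vec" where
  "Psi t s r = PW t (PG s (PP r))"

lemma dLX_PP: "dL X (PP r) = 0"
  by (induction r) simp_all

lemma dLX_PG: "dL X h = 0 \<Longrightarrow> dL X (PG s h) = 0"
  by (induction s) simp_all

lemma E_PP: "E (PP r) = sc (- q\<^sup>2 * sum_list r) (PP r)"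
proof (induction r)
  case (Cons a r)
  show ?case using E_step[OF E_gP[OF dLX_PP] Cons, of a] by (simp only: PP_simps sum_list.Cons distrib_left)
qed (simp add: E_one)

lemma E_PG:
  assumes "dL X h = 0" "E h = sc \<mu> h"
  shows "E (PG s h) = sc (- q\<^sup>2 * sum_list s + \<mu>) (PG s h)"
proof (induction s)
  case (Cons a s)
  show ?case using E_step[OF E_gG[OF dLX_PG[OF assms(1)]] Cons, of a]
    by (simp only: PG_simps sum_list.Cons distrib_left add.assoc)
qed (use assms in simp)

lemma E_PW:
  assumes "E h = sc \<mu> h"
  shows "E (PW t h) = sc (sum_list t + \<mu>) (PW t h)"
proof (induction t)
  case (Cons a t)
  show ?case using E_step[OF E_gW Cons, of a] by (simp only: PW_simps sum_list.Cons add.assoc)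
qed (use assms in simp)

lemma E_Psi: "E (Psi t s r) = sc (sum_list t - q\<^sup>2 * (sum_list s + sum_list r)) (Psi t s r)"
proof -
  have "sum_list t + (- q\<^sup>2 * sum_list s + - q\<^sup>2 * sum_list r) = sum_list t - q\<^sup>2 * (sum_list s + sum_list r)"
    by (simp add: distrib_left)
  then show ?thesis
    unfolding Psi_def using E_PW[OF E_PG[OF dLX_PP E_PP], of t s r] by (simp only:)
qed

lemma E_PG_one: "E (PG s one) = sc (- q\<^sup>2 * sum_list s) (PG s one)"
  using E_PG[OF dL_one E_one, of s] by (simp only: add_0_right)

text \<open>The two relations between the four products with parameters s and t are linear.
  Eliminating \<open>gG s \<star> gW t\<close> leaves this two-term rule with denominator t -
  s.\<close>

lemma gG_gW_exchange:
  assumes "t \<noteq> s"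
  shows "gG t \<star> gW s = sc ((q\<^sup>2 * t - s) / (t - s)) (gW s \<star> gG t) - sc ((q\<^sup>2 - 1) * t / (t - s)) (gW t \<star> gG s)"
proof
  fix w
  define a b c d where "a = (gW s \<star> gG t) w" and "b = (gG t \<star> gW s) w"
    and "c = (gW t \<star> gG s) w" and "d = (gG s \<star> gW t) w"
  have "q\<^sup>2 * a - b = q\<^sup>2 * c - d"
    using fun_cong[OF gW_gG_sym[of s t], of w] by (simp add: vec_apply a_def b_def c_def d_def)
  then have d: "d = q\<^sup>2 * c - q\<^sup>2 * a + b" by (simp add: algebra_simps)
  have "s * (a - b) = t * (c - d)"
    using fun_cong[OF gW_gG_scale[of s t], of w] by (simp add: vec_apply a_def b_def c_def d_def)
  then have "b * (t - s) = (q\<^sup>2 * t - s) * a - (q\<^sup>2 - 1) * t * c"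
    unfolding d by (simp add: algebra_simps)
  then have "b = ((q\<^sup>2 * t - s) * a - (q\<^sup>2 - 1) * t * c) / (t - s)"
    using assms by (metis eq_divide_imp right_minus_eq)
  moreover have "(x * a - y * c) / (t - s) = x / (t - s) * a - y / (t - s) * c" for x y
    by (simp add: diff_divide_distrib)
  ultimately have "b = (q\<^sup>2 * t - s) / (t - s) * a - (q\<^sup>2 - 1) * t / (t - s) * c"
    by (simp only:)
  then show "(gG t \<star> gW s) w
    = (sc ((q\<^sup>2 * t - s) / (t - s)) (gW s \<star> gG t) - sc ((q\<^sup>2 - 1) * t / (t - s)) (gW t \<star> gG s)) w"
    by (simp only: diff_fun_apply sc_apply a_def b_def c_def)
qed

text \<open>A partial fraction identity. It adds the two ways in which u can end up in
  \<open>gW\<close> and v in \<open>gG\<close>: by a direct exchange of u with v, or with t as an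
  intermediate.\<close>

lemma exchange_scalar:
  fixes p t u v :: 'a
  assumes "u \<noteq> t" "v \<noteq> u" "v \<noteq> t"
  shows "(p * u - t) / (u - t) * ((p - 1) * u / (u - v)) - (p - 1) * u / (u - t) * ((p - 1) * t / (t - v))
    = (p * v - t) / (v - t) * ((p - 1) * u / (u - v))"
proof -
  define x y z where "x = u - t" and "y = u - v" and "z = t - v"
  have nz: "x \<noteq> 0" "y \<noteq> 0" "z \<noteq> 0" using assms by (auto simp: x_def y_def z_def)
  have n: "(p * u - t) * z - (p - 1) * t * y = - ((p * v - t) * x)"
    unfolding x_def y_def z_def by algebra
  then have 1: "((p * u - t) * z - (p - 1) * t * y) / (x * y * z) = (p * v - t) / - z / y"
    unfolding n using nz by simp
  have "(p * u - t) / x * ((p - 1) * u / y) - (p - 1) * u / x * ((p - 1) * t / z)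
    = (p - 1) * u * (((p * u - t) * z - (p - 1) * t * y) / (x * y * z))"
    using nz by (simp add: divide_simps) algebra
  also have "\<dots> = (p * v - t) / - z * ((p - 1) * u / y)"
    unfolding 1 by simp
  finally show ?thesis by (simp add: x_def y_def z_def)
qed

text \<open>The first term keeps u in \<open>gG\<close>; in the others u has been exchanged for some
  v of the list. Passing one more factor \<open>gW t\<close> reaches the same exchanged term in two
  ways, and \<open>exchange_scalar\<close> shows that the sum is again a selection scalar.\<close>

lemma gG_PW:
  assumes "distinct (u # ts)"
  shows "gG u \<star> PW ts h = sc (\<Prod>x\<leftarrow>ts. (q\<^sup>2 * u - x) / (u - x)) (PW ts (gG u \<star> h))
    - (\<Sum>(c, v, vs)\<leftarrow>sel q ts. sc (c * ((q\<^sup>2 - 1) * u / (u - v))) (gW u \<star> PW vs (gG v \<star> h)))"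
  using assms
proof (induction ts arbitrary: u)
  case (Cons t ts)
  define \<alpha> \<beta> where "\<alpha> = (q\<^sup>2 * u - t) / (u - t)" and "\<beta> = (q\<^sup>2 - 1) * u / (u - t)"
  define p where "p x = (\<Prod>y\<leftarrow>ts. (q\<^sup>2 * x - y) / (x - y))" for x
  have ut: "u \<noteq> t" using Cons.prems by auto
  have eq: "(\<alpha> * (c * ((q\<^sup>2 - 1) * u / (u - v)))) - \<beta> * (c * ((q\<^sup>2 - 1) * t / (t - v)))
      = c * ((q\<^sup>2 * v - t) / (v - t)) * ((q\<^sup>2 - 1) * u / (u - v))"
    if "v \<noteq> u" "v \<noteq> t" for c v
    using arg_cong[OF exchange_scalar[OF ut that, of "q\<^sup>2"], of "\<lambda>x. c * x"]
    unfolding \<alpha>_def \<beta>_def by (simp only: right_diff_distrib ac_simps)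
  define A B where "A = (\<Sum>(c, v, vs)\<leftarrow>sel q ts. sc (c * ((q\<^sup>2 - 1) * u / (u - v))) (gW u \<star> PW vs (gG v \<star> h)))"
    and "B = (\<Sum>(c, v, vs)\<leftarrow>sel q ts. sc (c * ((q\<^sup>2 - 1) * t / (t - v))) (gW t \<star> PW vs (gG v \<star> h)))"
  have S: "sc \<alpha> (gW t \<star> A) - sc \<beta> (gW u \<star> B)
    = (\<Sum>(c, v, vs)\<leftarrow>sel q ts. sc (c * ((q\<^sup>2 * v - t) / (v - t)) * ((q\<^sup>2 - 1) * u / (u - v)))
        (gW u \<star> PW (t # vs) (gG v \<star> h)))"
    unfolding A_def B_def
    unfolding star_sum_list_right sc_sum_list sum_list_subtractf[symmetric]
  proof (intro arg_cong[of _ _ sum_list] map_cong refl, clarify)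
    fix c v vs assume "(c, v, vs) \<in> set (sel q ts)"
    then have "v \<in> set ts" by (rule sel_props)
    then have v: "v \<noteq> u" "v \<noteq> t" using Cons.prems by auto
    have "gW t \<star> gW u \<star> F = gW u \<star> gW t \<star> F" for F
      by (metis gW_commute star_assoc)
    then show "sc \<alpha> (gW t \<star> sc (c * ((q\<^sup>2 - 1) * u / (u - v))) (gW u \<star> PW vs (gG v \<star> h)))
      - sc \<beta> (gW u \<star> sc (c * ((q\<^sup>2 - 1) * t / (t - v))) (gW t \<star> PW vs (gG v \<star> h)))
      = sc (c * ((q\<^sup>2 * v - t) / (v - t)) * ((q\<^sup>2 - 1) * u / (u - v))) (gW u \<star> PW (t # vs) (gG v \<star> h))"
      unfolding eq[OF v, of c, symmetric] by (simp add: fn.scale_left_diff_distrib)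
  qed
  have "gG u \<star> PW (t # ts) h = sc \<alpha> (gW t \<star> (gG u \<star> PW ts h)) - sc \<beta> (gW u \<star> (gG t \<star> PW ts h))"
    using arg_cong[OF gG_gW_exchange[OF ut], of "\<lambda>F. F \<star> PW ts h"] by (simp add: star_assoc \<alpha>_def \<beta>_def)
  also have "\<dots> = sc (\<alpha> * p u) (gW t \<star> PW ts (gG u \<star> h)) - sc (\<beta> * p t) (gW u \<star> PW ts (gG t \<star> h))
    - (sc \<alpha> (gW t \<star> A) - sc \<beta> (gW u \<star> B))"
  proof -
    have "gG u \<star> PW ts h = sc (p u) (PW ts (gG u \<star> h)) - A" "gG t \<star> PW ts h = sc (p t) (PW ts (gG t \<star> h)) - B"
      unfolding A_def B_def p_def by (rule Cons.IH, use Cons.prems in simp)+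
    then show ?thesis by (simp add: fn.scale_right_diff_distrib)
  qed
  also have "\<dots> = sc (\<Prod>x\<leftarrow>t # ts. (q\<^sup>2 * u - x) / (u - x)) (PW (t # ts) (gG u \<star> h))
    - (\<Sum>(c, v, vs)\<leftarrow>sel q (t # ts). sc (c * ((q\<^sup>2 - 1) * u / (u - v))) (gW u \<star> PW vs (gG v \<star> h)))"
    unfolding S by (simp add: p_def \<alpha>_def \<beta>_def case_prod_unfold comp_def mult.commute)
  finally show ?case .
qed simp

text \<open>Deleting x from the first factor leaves \<open>gG t\<close>, to be moved to the right;
  deleting it further on costs q^2. For each v the scalar q^2 and that of the exchange of t with v
  combine to (q^2 v - t)/(v - t), the factor by which the selection of v passes t.\<close>

lemma dLX_PW:
  assumes "dL X h = 0" "distinct ts"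
  shows "dL X (PW ts h) = (\<Sum>(c, u, us)\<leftarrow>sel q ts. sc c (PW us (gG u \<star> h)))"
  using assms(2)
proof (induction ts)
  case (Cons t ts)
  have eq: "c * q\<^sup>2 - c * ((q\<^sup>2 - 1) * t / (t - v)) = c * ((q\<^sup>2 * v - t) / (v - t))" if "v \<noteq> t" for c v
  proof -
    have "(q\<^sup>2 * v - t) / (v - t) = (t - q\<^sup>2 * v) / (t - v)"
      by (metis minus_diff_eq minus_divide_divide)
    also have "\<dots> = q\<^sup>2 - (q\<^sup>2 - 1) * t / (t - v)"
      using that by (simp add: divide_simps) (simp add: algebra_simps)
    finally show ?thesis by (simp add: right_diff_distrib)
  qed
  have S: "sc (q\<^sup>2) (gW t \<star> (\<Sum>(c, u, us)\<leftarrow>sel q ts. sc c (PW us (gG u \<star> h))))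
      - (\<Sum>(c, v, vs)\<leftarrow>sel q ts. sc (c * ((q\<^sup>2 - 1) * t / (t - v))) (gW t \<star> PW vs (gG v \<star> h)))
    = (\<Sum>(c, v, vs)\<leftarrow>sel q ts. sc (c * ((q\<^sup>2 * v - t) / (v - t))) (PW (t # vs) (gG v \<star> h)))"
    unfolding star_sum_list_right sc_sum_list sum_list_subtractf[symmetric]
  proof (intro arg_cong[of _ _ sum_list] map_cong refl, clarify)
    fix c v vs assume "(c, v, vs) \<in> set (sel q ts)"
    then have "v \<in> set ts" by (rule sel_props)
    then have v: "v \<noteq> t" using Cons.prems by auto
    show "sc (q\<^sup>2) (gW t \<star> sc c (PW vs (gG v \<star> h))) - sc (c * ((q\<^sup>2 - 1) * t / (t - v))) (gW t \<star> PW vs (gG v \<star> h))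
      = sc (c * ((q\<^sup>2 * v - t) / (v - t))) (PW (t # vs) (gG v \<star> h))"
      unfolding eq[OF v, of c, symmetric] by (simp add: fn.scale_left_diff_distrib mult.commute)
  qed
  have "dL X (PW (t # ts) h) = gG t \<star> PW ts h + sc (q\<^sup>2) (gW t \<star> dL X (PW ts h))"
    by simp
  also have "\<dots> = sc (\<Prod>x\<leftarrow>ts. (q\<^sup>2 * t - x) / (t - x)) (PW ts (gG t \<star> h))
    + (sc (q\<^sup>2) (gW t \<star> (\<Sum>(c, u, us)\<leftarrow>sel q ts. sc c (PW us (gG u \<star> h))))
      - (\<Sum>(c, v, vs)\<leftarrow>sel q ts. sc (c * ((q\<^sup>2 - 1) * t / (t - v))) (gW t \<star> PW vs (gG v \<star> h))))"
    using Cons gG_PW[of t ts h] by (simp add: algebra_simps)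
  also have "\<dots> = (\<Sum>(c, u, us)\<leftarrow>sel q (t # ts). sc c (PW us (gG u \<star> h)))"
    unfolding S by (simp add: case_prod_unfold comp_def)
  finally show ?case .
qed (use assms in simp)

lemma dLX_Psi:
  assumes "distinct t"
  shows "dL X (Psi t s r) = (\<Sum>(c, u, us)\<leftarrow>sel q t. sc c (Psi us (u # s) r))"
  unfolding Psi_def by (subst dLX_PW[OF dLX_PG[OF dLX_PP] assms]) simp

section \<open>Gaussian integers and the sum of the selection scalars\<close>

definition qint :: "nat \<Rightarrow> 'a" where
  "qint n = (\<Sum>i<n. (q\<^sup>2) ^ i)"

lemma qint_Suc: "qint (Suc n) = 1 + q\<^sup>2 * qint n"
  by (simp add: qint_def sum.lessThan_Suc_shift sum_distrib_left del: sum.lessThan_Suc)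

lemma qint_nz: "n > 0 \<Longrightarrow> qint n \<noteq> 0"
  using q2_pow_ne[of n] power_diff_1_eq[of "q\<^sup>2" n] by (auto simp: qint_def)

lemma gG_X_power: "(gG t \<star> f) (replicate n X) = f (replicate n X)"
  by (induction n arbitrary: f) (simp_all add: zero_fun_apply, simp add: dL_apply)

text \<open>At a power of x only the word x of \<open>gW t\<close> and the empty word of
  \<open>gG t\<close> contribute, so the parameter disappears.\<close>

lemma gW_X_power: "(gW t \<star> f) (replicate (Suc n) X) = qint (Suc n) * f (replicate n X)"
proof (induction n arbitrary: f)
  case 0
  show ?case by (simp add: sc_apply qint_def)
next
  case (Suc n)
  have "(gW t \<star> f) (replicate (Suc (Suc n)) X)
    = (gG t \<star> f) (replicate (Suc n) X) + q\<^sup>2 * (gW t \<star> dL X f) (replicate (Suc n) X)"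
    by (simp add: sc_apply)
  then show ?case
    unfolding Suc gG_X_power by (simp add: qint_Suc dL_apply algebra_simps)
qed

lemma PW_X_power: "PW ts h (replicate (length ts) X) = (\<Prod>i<length ts. qint (Suc i)) * h []"
proof (induction ts)
  case (Cons t ts)
  then show ?case using gW_X_power[of t "PW ts h" "length ts"] by simp
qed simp

text \<open>The deletion formula is evaluated at the word x^n. There all products of n factors
  \<open>gW\<close> have the same value p, whatever their parameters, so the sum of the rational
  scalars is a quotient of two q-factorials.\<close>

lemma sel_sum:
  assumes "distinct ts" "length ts = Suc n"
  shows "(\<Sum>(c, u, us)\<leftarrow>sel q ts. c) = qint (Suc n)"
proof -
  define p where "p = (\<Prod>i<n. qint (Suc i))"
  have p: "p \<noteq> 0" by (simp add: p_def qint_nz)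
  have "dL X (PW ts one) (replicate n X) = qint (Suc n) * p"
    using PW_X_power[of ts one] assms(2) by (simp add: dL_apply p_def)
  moreover have "dL X (PW ts one) (replicate n X) = (\<Sum>(c, u, us)\<leftarrow>sel q ts. c * p)"
    unfolding dLX_PW[OF dL_one assms(1)] sum_list_fun_apply
  proof (intro arg_cong[of _ _ sum_list] map_cong refl, clarify)
    fix c u us assume "(c, u, us) \<in> set (sel q ts)"
    then have "length us = n" using sel_props(1) assms(2) by fastforce
    then show "sc c (PW us (gG u \<star> one)) (replicate n X) = c * p"
      using PW_X_power[of us "gG u"] by (simp add: sc_apply p_def)
  qed
  moreover have "(\<Sum>(c, u, us)\<leftarrow>sel q ts. c * p) = (\<Sum>(c, u, us)\<leftarrow>sel q ts. c) * p"
    by (simp add: case_prod_unfold sum_list_mult_const)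
  ultimately show ?thesis using p by simp
qed

section \<open>Operators with prescribed scalars\<close>

lemma PG_perm: "mset xs = mset ys \<Longrightarrow> PG xs h = PG ys h"
proof -
  have c: "gG x \<star> gG y \<star> f = gG y \<star> gG x \<star> f" for x y f
    by (metis gG_commute star_assoc)
  assume "mset xs = mset ys"
  then have m: "mset (rev xs) = mset (rev ys)" by simp
  have "fold (\<lambda>t f. gG t \<star> f) (rev xs) = fold (\<lambda>t f. gG t \<star> f) (rev ys)"
    by (rule fold_multiset_equiv[OF _ m], rule ext, simp only: comp_apply, rule c)
  then show ?thesis by (simp only: PG_def foldr_conv_fold)
qed

text \<open>The vanishing clause lets \<open>T\<close> isolate, in a linear relation, the monomials with the longest outer blocks.\<close>
definition realises :: "('a vec \<Rightarrow> 'a vec) \<Rightarrow> nat \<Rightarrow> nat \<Rightarrow> ('a list \<Rightarrow> 'a list \<Rightarrow> 'a) \<Rightarrow> bool" where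
  "realises T a b P \<longleftrightarrow> local_linear T \<and> (\<forall>t s r. distinct t \<longrightarrow> distinct r \<longrightarrow>
    (length t = a \<longrightarrow> length r = b \<longrightarrow> T (Psi t s r) = sc (P t r) (PG (t @ s @ r) one)) \<and>
    (length t < a \<or> length r < b \<longrightarrow> T (Psi t s r) = 0))"

definition realisable :: "nat \<Rightarrow> nat \<Rightarrow> ('a list \<Rightarrow> 'a list \<Rightarrow> 'a) \<Rightarrow> bool" where
  "realisable a b P \<longleftrightarrow> (\<exists>T. realises T a b P)"

lemma realises_local_linear: "realises T a b P \<Longrightarrow> local_linear T"
  and realises_eq: "realises T a b P \<Longrightarrow> distinct t \<Longrightarrow> distinct r \<Longrightarrow> length t = a \<Longrightarrow> length r = b
    \<Longrightarrow> T (Psi t s r) = sc (P t r) (PG (t @ s @ r) one)"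
  and realises_zero: "realises T a b P \<Longrightarrow> distinct t \<Longrightarrow> distinct r \<Longrightarrow> length t < a \<or> length r < b
    \<Longrightarrow> T (Psi t s r) = 0"
  unfolding realises_def by blast+

lemma realisable_I:
  assumes "local_linear T"
    and "\<And>t s r. distinct t \<Longrightarrow> distinct r \<Longrightarrow> length t = a \<Longrightarrow> length r = b \<Longrightarrow> T (Psi t s r) = sc (P t r) (PG (t @ s @ r) one)"
    and "\<And>t s r. distinct t \<Longrightarrow> distinct r \<Longrightarrow> length t < a \<or> length r < b \<Longrightarrow> T (Psi t s r) = 0"
  shows "realisable a b P"
  unfolding realisable_def realises_def using assms by blast

lemma realisable_E: "realisable a b P \<Longrightarrow> (\<And>T. realises T a b P \<Longrightarrow> thesis) \<Longrightarrow> thesis"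
  unfolding realisable_def by blast

lemma realisable_cong:
  assumes "realisable a b P" "\<And>t r. distinct t \<Longrightarrow> length t = a \<Longrightarrow> length r = b \<Longrightarrow> P t r = P' t r"
  shows "realisable a b P'"
proof -
  obtain T where T: "realises T a b P"
    using realisable_E[OF assms(1)] .
  show ?thesis
    by (rule realisable_I[OF realises_local_linear[OF T]]) (simp_all only: realises_eq[OF T] realises_zero[OF T] assms(2))
qed

lemma realisable_add:
  assumes "realisable a b P" "realisable a b P'"
  shows "realisable a b (\<lambda>t r. P t r + P' t r)"
proof -
  obtain T where T: "realises T a b P"
    using realisable_E[OF assms(1)] .
  obtain T' where T': "realises T' a b P'"
    using realisable_E[OF assms(2)] .
  show ?thesis
    by (rule realisable_I[OF local_linear_plus[OF realises_local_linear[OF T] realises_local_linear[OF T']]])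
      (simp_all only: realises_eq[OF T] realises_zero[OF T] realises_eq[OF T'] realises_zero[OF T']
        fn.scale_left_distrib add_0)
qed

lemma realisable_scale:
  assumes "realisable a b P"
  shows "realisable a b (\<lambda>t r. x * P t r)"
proof -
  obtain T where T: "realises T a b P"
    using realisable_E[OF assms(1)] .
  show ?thesis
    by (rule realisable_I[OF local_linear_scale[OF realises_local_linear[OF T], of x]])
      (simp_all only: realises_eq[OF T] realises_zero[OF T] sc_sc sc_zero)
qed

lemma realisable_sum:
  assumes "finite A" "A \<noteq> {}" "\<And>i. i \<in> A \<Longrightarrow> realisable a b (P i)"
  shows "realisable a b (\<lambda>t r. \<Sum>i\<in>A. P i t r)"
  using assms
proof (induction A rule: finite_ne_induct)
  case (insert i A)
  then show ?case using realisable_add[of a b "P i"] by simp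
qed simp

text \<open>E has eigenvalue \<open>sum_list t\<close> minus q^2 times the other parameters before T
  is applied, and minus q^2 times all parameters afterwards. The difference is (1 + q^2)
  \<open>sum_list t\<close>, so the commutator of T with E multiplies P by this sum.\<close>

lemma realisable_sum_list:
  assumes "realisable a b P"
  shows "realisable a b (\<lambda>t r. sum_list t * P t r)"
proof -
  obtain T where T: "realises T a b P"
    using realisable_E[OF assms] .
  have q1: "1 + q\<^sup>2 \<noteq> 0" using q2_pow_plus[of 1] by (simp add: add.commute)
  let ?T = "\<lambda>f. sc (inverse (1 + q\<^sup>2)) (T (E f) - E (T f))"
  have "local_linear ?T" by (intro local_linear_scale local_linear_diff local_linear_comp[OF realises_local_linear[OF T] local_linear_E] local_linear_comp[OF local_linear_E realises_local_linear[OF T]])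
  moreover have "?T (Psi t s r) = sc (sum_list t * P t r) (PG (t @ s @ r) one)"
    if "distinct t" "distinct r" "length t = a" "length r = b" for t s r
  proof -
    have "T (E (Psi t s r)) - E (T (Psi t s r)) = sc ((1 + q\<^sup>2) * (sum_list t * P t r)) (PG (t @ s @ r) one)"
      unfolding E_Psi local_linear_sc[OF realises_local_linear[OF T]] realises_eq[OF T that] local_linear_sc[OF local_linear_E] E_PG_one sc_sc fn.scale_left_diff_distrib[symmetric]
      by (rule arg_cong[of _ _ "\<lambda>x. sc x _"]) (simp add: algebra_simps)
    then show ?thesis using q1 by simp
  qed
  moreover have "?T (Psi t s r) = 0" if "distinct t" "distinct r" "length t < a \<or> length r < b" for t s r
    using realises_zero[OF T that] by (simp add: E_Psi local_linear_sc[OF realises_local_linear[OF T]] local_linear_zero[OF local_linear_E])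
  ultimately show ?thesis by (rule realisable_I)
qed

text \<open>For k = 0 the operator is composed with the deletion of x. One more factor u is the sum
  of t minus the sum of us: the former multiplies the whole expression, the latter is absorbed into
  P, which therefore varies in the induction.\<close>

lemma realisable_dX:
  assumes "realisable a b P"
  shows "realisable (Suc a) b (\<lambda>t r. \<Sum>(c, u, us)\<leftarrow>sel q t. c * u ^ k * P us r)"
  using assms
proof (induction k arbitrary: P)
  case 0
  obtain T where T: "realises T a b P"
    using realisable_E[OF 0] .
  have e: "T (dL X (Psi t s r)) = (\<Sum>(c, u, us)\<leftarrow>sel q t. sc c (T (Psi us (u # s) r)))"
    if "distinct t" for t s r
    unfolding dLX_Psi[OF that] local_linear_sum_list[OF realises_local_linear[OF T]] by (simp add: case_prod_unfold local_linear_sc[OF realises_local_linear[OF T]])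
  have "T (dL X (Psi t s r)) = sc (\<Sum>(c, u, us)\<leftarrow>sel q t. c * u ^ 0 * P us r) (PG (t @ s @ r) one)"
    if t: "distinct t" "distinct r" "length t = Suc a" "length r = b" for t s r
  proof -
    have "T (dL X (Psi t s r)) = (\<Sum>(c, u, us)\<leftarrow>sel q t. sc (c * P us r) (PG (t @ s @ r) one))"
      unfolding e[OF t(1)]
    proof (intro arg_cong[of _ _ sum_list] map_cong refl, clarify)
      fix c u us assume s: "(c, u, us) \<in> set (sel q t)"
      have "PG (us @ (u # s) @ r) one = PG (t @ s @ r) one"
        by (rule PG_perm) (simp add: sel_mset[OF s])
      then show "sc c (T (Psi us (u # s) r)) = sc (c * P us r) (PG (t @ s @ r) one)"
        using realises_eq[OF T, of us r "u # s"] sel_props(1,3)[OF s] t by simp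
    qed
    also have "\<dots> = sc (\<Sum>(c, u, us)\<leftarrow>sel q t. c * u ^ 0 * P us r) (PG (t @ s @ r) one)"
    proof -
      have "(\<Sum>(c, u, us)\<leftarrow>xs. sc (c * P us r) G) = sc (\<Sum>(c, u, us)\<leftarrow>xs. c * u ^ 0 * P us r) G" for xs G
        by (induction xs) (auto simp: fn.scale_left_distrib)
      then show ?thesis .
    qed
    finally show ?thesis .
  qed
  moreover have "T (dL X (Psi t s r)) = 0" if t: "distinct t" "distinct r" "length t < Suc a \<or> length r < b" for t s r
  proof -
    have "T (dL X (Psi t s r)) = (\<Sum>(c, u, us)\<leftarrow>sel q t. 0)"
      unfolding e[OF t(1)]
    proof (intro arg_cong[of _ _ sum_list] map_cong refl, clarify)
      fix c u us assume s: "(c, u, us) \<in> set (sel q t)"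
      show "sc c (T (Psi us (u # s) r)) = 0"
        using realises_zero[OF T, of us r "u # s"] sel_props(1,3)[OF s] t by auto
    qed
    then show ?thesis by (simp add: case_prod_unfold)
  qed
  ultimately show ?case
    by (rule realisable_I[OF local_linear_comp[OF realises_local_linear[OF T] local_linear_dL]])
next
  case (Suc k)
  have "realisable (Suc a) b (\<lambda>t r. sum_list t * (\<Sum>(c, u, us)\<leftarrow>sel q t. c * u ^ k * P us r)
    + (-1) * (\<Sum>(c, u, us)\<leftarrow>sel q t. c * u ^ k * (sum_list us * P us r)))"
    by (intro realisable_add realisable_scale realisable_sum_list Suc)
  then show ?case
  proof (rule realisable_cong)
    fix t r
    have "(\<Sum>(c, u, us)\<leftarrow>sel q t. c * u ^ Suc k * P us r)
      = (\<Sum>(c, u, us)\<leftarrow>sel q t. sum_list t * (c * u ^ k * P us r) - c * u ^ k * (sum_list us * P us r))"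
      by (intro arg_cong[of _ _ sum_list] map_cong refl, clarify)
        (simp add: sel_props(5) algebra_simps)
    then show "sum_list t * (\<Sum>(c, u, us)\<leftarrow>sel q t. c * u ^ k * P us r)
      + (-1) * (\<Sum>(c, u, us)\<leftarrow>sel q t. c * u ^ k * (sum_list us * P us r))
      = (\<Sum>(c, u, us)\<leftarrow>sel q t. c * u ^ Suc k * P us r)"
      by (simp add: case_prod_unfold sum_list_subtractf sum_list_const_mult)
  qed
qed

text \<open>With weight \<phi>(u) every selection contributes c times the same product over all of
  t. The scalars c add up to \<open>qint (Suc a)\<close>, which is invertible.\<close>

lemma realisable_poly_step:
  assumes "realisable a b (\<lambda>t r. (\<Prod>x\<leftarrow>t. poly \<phi> x) * K r)"
  shows "realisable (Suc a) b (\<lambda>t r. (\<Prod>x\<leftarrow>t. poly \<phi> x) * K r)"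
proof -
  let ?P = "\<lambda>t r. (\<Prod>x\<leftarrow>t. poly \<phi> x) * K r"
  have "realisable (Suc a) b (\<lambda>t r. inverse (qint (Suc a)) * (\<Sum>k\<le>degree \<phi>. coeff \<phi> k * (\<Sum>(c, u, us)\<leftarrow>sel q t. c * u ^ k * ?P us r)))"
    by (intro realisable_scale realisable_sum realisable_dX[OF assms]) simp_all
  then show ?thesis
  proof (rule realisable_cong)
    fix t r :: "'a list" assume t: "distinct t" "length t = Suc a"
    have "(\<Sum>k\<le>degree \<phi>. coeff \<phi> k * (\<Sum>(c, u, us)\<leftarrow>xs. c * u ^ k * ?P us r))
      = (\<Sum>(c, u, us)\<leftarrow>xs. c * (poly \<phi> u * ?P us r))" for xs
      by (induction xs) (auto simp: distrib_left sum.distrib poly_altdef sum_distrib_left sum_distrib_right algebra_simps)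
    also have "(\<Sum>(c, u, us)\<leftarrow>sel q t. c * (poly \<phi> u * ?P us r)) = (\<Sum>(c, u, us)\<leftarrow>sel q t. c * ?P t r)"
      by (intro arg_cong[of _ _ sum_list] map_cong refl, clarify) (simp add: sel_props(4))
    also have "\<dots> = qint (Suc a) * ?P t r"
      using sel_sum[OF t] by (simp add: case_prod_unfold sum_list_mult_const)
    finally show "inverse (qint (Suc a)) * (\<Sum>k\<le>degree \<phi>. coeff \<phi> k * (\<Sum>(c, u, us)\<leftarrow>sel q t. c * u ^ k * ?P us r)) = ?P t r"
      using qint_nz[of "Suc a"] by simp
  qed
qed

lemma foldr_star: "foldr (\<lambda>t f. H t \<star> f) xs h = foldr (\<lambda>t f. H t \<star> f) xs one \<star> h"
  by (induction xs) (simp_all add: star_assoc)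

lemma rev_swap_foldr: "rev_swap (foldr (\<lambda>t f. F t \<star> f) ts h) = rev_swap h \<star> foldr (\<lambda>t f. rev_swap (F t) \<star> f) (rev ts) one"
proof (induction ts)
  case (Cons t ts)
  have "foldr (\<lambda>t f. rev_swap (F t) \<star> f) (rev ts) (rev_swap (F t)) = foldr (\<lambda>t f. rev_swap (F t) \<star> f) (rev ts) one \<star> rev_swap (F t)"
    by (rule foldr_star)
  then show ?case using Cons by (simp add: rev_swap_star star_assoc)
qed simp

lemma rev_swap_Psi: "rev_swap (Psi t s r) = Psi (rev r) (rev s) (rev t)"
proof -
  have "rev_swap (Psi t s r) = (PW (rev r) one \<star> PG (rev s) one) \<star> PP (rev t)"
    by (simp add: Psi_def PW_def PG_def PP_def rev_swap_foldr rev_swap_gW)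
  also have "\<dots> = Psi (rev r) (rev s) (rev t)"
    using foldr_star[of gW "rev r" "PG (rev s) (PP (rev t))"] foldr_star[of gG "rev s" "PP (rev t)"]
    by (simp add: Psi_def PW_def PG_def star_assoc)
  finally show ?thesis .
qed

lemma rev_swap_PG: "rev_swap (PG s one) = PG s one"
proof -
  have "rev_swap (PG s one) = PG (rev s) one" by (simp add: PG_def rev_swap_foldr)
  then show ?thesis using PG_perm[of "rev s" s] by simp
qed

text \<open>Conjugation by \<open>rev_swap\<close> exchanges the two outer families and fixes
  products of \<open>gG\<close>, since these commute.\<close>

lemma realisable_swap:
  assumes "realisable a b P"
  shows "realisable b a (\<lambda>t r. P (rev r) (rev t))"
proof -
  obtain T where T: "realises T a b P"
    using realisable_E[OF assms] .
  have "local_linear (\<lambda>f. rev_swap (T (rev_swap f)))"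
    by (rule local_linear_comp[OF local_linear_rev_swap local_linear_comp[OF realises_local_linear[OF T] local_linear_rev_swap]])
  moreover have "rev_swap (T (rev_swap (Psi t s r))) = sc (P (rev r) (rev t)) (PG (t @ s @ r) one)"
    if "distinct t" "distinct r" "length t = b" "length r = a" for t s r
    using realises_eq[OF T, of "rev r" "rev t" "rev s"] that PG_perm[of "rev r @ rev s @ rev t" "t @ s @ r"]
    by (simp add: rev_swap_Psi rev_swap_PG)
  moreover have "rev_swap (T (rev_swap (Psi t s r))) = 0"
    if "distinct t" "distinct r" "length t < b \<or> length r < a" for t s r
    using realises_zero[OF T, of "rev r" "rev t" "rev s"] that by (auto simp: rev_swap_Psi)
  ultimately show ?thesis by (rule realisable_I)
qed

text \<open>A step enlarges the left block only. So the block for \<chi> is built on the left,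
  carried to the right by the swap, and then the block for \<phi> is added.\<close>

lemma realisable_poly: "realisable a b (\<lambda>t r. (\<Prod>x\<leftarrow>t. poly \<phi> x) * (\<Prod>x\<leftarrow>r. poly \<chi> x))"
proof -
  have "realisable 0 0 (\<lambda>t r. 1)"
    by (rule realisable_I[OF local_linear_id]) (simp_all add: Psi_def)
  then have "realisable 0 0 (\<lambda>t r. (\<Prod>x\<leftarrow>t. poly \<chi> x) * 1)"
    by (rule realisable_cong) simp
  then have "realisable b 0 (\<lambda>t r. (\<Prod>x\<leftarrow>t. poly \<chi> x) * 1)"
    by (induction b) (simp, rule realisable_poly_step)
  then have "realisable 0 b (\<lambda>t r. (\<Prod>x\<leftarrow>rev r. poly \<chi> x) * 1)"
    by (rule realisable_swap)
  then have "realisable 0 b (\<lambda>t r. (\<Prod>x\<leftarrow>t. poly \<phi> x) * (\<Prod>x\<leftarrow>r. poly \<chi> x))"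
    by (rule realisable_cong) (simp add: prod_list.rev flip: rev_map)
  then show ?thesis
    by (induction a) (simp, rule realisable_poly_step)
qed

end

section \<open>Linear independence for the first order\<close>

definition tuples :: "nat \<Rightarrow> nat \<Rightarrow> nat list set" where
  "tuples n B = {l. length l = n \<and> set l \<subseteq> {..<B}}"

lemma tuples_0: "tuples 0 B = {[]}"
  by (auto simp: tuples_def)

lemma sum_tuples_Suc: "(\<Sum>l\<in>tuples (Suc n) B. g l) = (\<Sum>i<B. \<Sum>l\<in>tuples n B. g (i # l))"
proof -
  have "tuples (Suc n) B = (\<lambda>(i, l). i # l) ` ({..<B} \<times> tuples n B)"
    by (auto simp: tuples_def length_Suc_conv image_iff)
  moreover have "inj_on (\<lambda>(i, l). i # l) ({..<B} \<times> tuples n B)"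
    by (auto simp: inj_on_def)
  ultimately have "(\<Sum>l\<in>tuples (Suc n) B. g l) = (\<Sum>x\<in>{..<B} \<times> tuples n B. g (fst x # snd x))"
    by (simp add: sum.reindex case_prod_unfold)
  then show ?thesis by (simp add: sum.cartesian_product case_prod_unfold)
qed

definition monomial :: "'a::comm_monoid_mult list \<Rightarrow> nat list \<Rightarrow> 'a" where
  "monomial zs l = prod_list (map2 (^) zs l)"

lemma monomial_simps [simp]: "monomial [] [] = 1" "monomial (z # zs) (i # l) = z ^ i * monomial zs l"
  by (simp_all add: monomial_def)

text \<open>For fixed distinct zs the sum is a polynomial in one further variable that vanishes
  outside the finite set of the zs, hence is zero; its coefficients are sums in one variable
  less.\<close>

lemma poly_vanish:
  assumes "infinite (UNIV :: 'a::field set)"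
    and "\<And>zs :: 'a list. length zs = n \<Longrightarrow> distinct zs \<Longrightarrow> (\<Sum>l\<in>tuples n B. monomial zs l * c l) = 0"
    and "l \<in> tuples n B"
  shows "c l = 0"
  using assms(2,3)
proof (induction n arbitrary: c l)
  case 0
  then show ?case by (simp add: tuples_0)
next
  case (Suc n)
  obtain i l' where l: "l = i # l'" "i < B" "l' \<in> tuples n B"
    using Suc.prems(2) by (auto simp: tuples_def length_Suc_conv)
  show ?case
    unfolding l(1)
  proof (rule Suc.IH[where c = "\<lambda>l. c (i # l)", OF _ l(3)])
    fix zs :: "'a list" assume zs: "length zs = n" "distinct zs"
    define p where "p = (\<Sum>i<B. monom (\<Sum>l\<in>tuples n B. monomial zs l * c (i # l)) i)"
    have "poly p z = 0" if "z \<notin> set zs" for z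
    proof -
      have "poly p z = (\<Sum>l\<in>tuples (Suc n) B. monomial (z # zs) l * c l)"
        unfolding sum_tuples_Suc p_def
        by (simp add: poly_sum poly_monom sum_distrib_left sum_distrib_right mult_ac)
      then show ?thesis using Suc.prems(1)[of "z # zs"] zs that by simp
    qed
    then have "- set zs \<subseteq> {z. poly p z = 0}" by auto
    moreover have "infinite (- set zs)"
      using assms(1) by (simp add: Compl_eq_Diff_UNIV)
    ultimately have "p = 0" using poly_roots_finite finite_subset by blast
    then have "coeff p i = 0" by simp
    then show "(\<Sum>l\<in>tuples n B. monomial zs l * c (i # l)) = 0"
      using l(2) by (simp add: p_def coeff_sum)
  qed
qed

lemma base_digits_unique:
  fixes a b :: "nat \<Rightarrow> nat"
  assumes "\<And>i. a i < N" "\<And>i. b i < N" "(\<Sum>i<n. a i * N ^ i) = (\<Sum>i<n. b i * N ^ i)" "i < n"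
  shows "a i = b i"
  using assms
proof (induction n arbitrary: a b i)
  case (Suc n)
  have shift: "(\<Sum>i<Suc n. f i * N ^ i) = f 0 + N * (\<Sum>i<n. f (Suc i) * N ^ i)" for f :: "nat \<Rightarrow> nat"
    by (simp add: sum.lessThan_Suc_shift sum_distrib_left mult_ac del: sum.lessThan_Suc)
  have eq: "a 0 + N * (\<Sum>i<n. a (Suc i) * N ^ i) = b 0 + N * (\<Sum>i<n. b (Suc i) * N ^ i)"
    using Suc.prems(3) unfolding shift .
  then have "(a 0 + N * (\<Sum>i<n. a (Suc i) * N ^ i)) mod N = (b 0 + N * (\<Sum>i<n. b (Suc i) * N ^ i)) mod N"
    by simp
  then have 0: "a 0 = b 0" using Suc.prems(1,2)[of 0] by simp
  have "N > 0" using Suc.prems(1)[of 0] by simp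
  then have "(\<Sum>i<n. a (Suc i) * N ^ i) = (\<Sum>i<n. b (Suc i) * N ^ i)"
    using eq 0 by simp
  then have "a (Suc j) = b (Suc j)" if "j < n" for j
    using Suc.IH[of "\<lambda>i. a (Suc i)" "\<lambda>i. b (Suc i)" j] Suc.prems(1,2) that by blast
  then show ?case using 0 Suc.prems(4) by (cases i) auto
qed simp

text \<open>The sum is a number in base N whose digits are the multiplicities; with fewer than N
  entries there is no carry.\<close>

lemma power_code_inj:
  fixes xs ys :: "nat list"
  assumes "length xs < N" "length ys < N" "(\<Sum>x\<leftarrow>xs. N ^ x) = (\<Sum>x\<leftarrow>ys. N ^ x)"
  shows "mset xs = mset ys"
proof -
  obtain n where n: "set xs \<union> set ys \<subseteq> {..<n}"
    using finite_nat_iff_bounded[of "set xs \<union> set ys"] by auto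
  have s: "(\<Sum>x\<leftarrow>zs. N ^ x) = (\<Sum>i<n. count (mset zs) i * N ^ i)" if "set zs \<subseteq> {..<n}" for zs
    using that
  proof (induction zs)
    case (Cons z zs)
    have "(\<Sum>i<n. count (mset (z # zs)) i * N ^ i) = (\<Sum>i<n. count (mset zs) i * N ^ i + (if i = z then N ^ i else 0))"
      by (intro sum.cong) auto
    also have "\<dots> = (\<Sum>i<n. count (mset zs) i * N ^ i) + N ^ z"
      using Cons.prems by (simp add: sum.distrib)
    finally show ?case using Cons by simp
  qed simp
  have c: "count (mset zs) i \<le> length zs" for zs :: "nat list" and i
    by (metis count_le_size size_mset)
  show ?thesis
  proof (rule multiset_eqI)
    fix i
    show "count (mset xs) i = count (mset ys) i"
    proof (cases "i < n")
      case True
      show ?thesis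
      proof (rule base_digits_unique[OF _ _ _ True])
        show "count (mset xs) i < N" "count (mset ys) i < N" for i
          using c[of xs i] c[of ys i] assms(1,2) by simp_all
        show "(\<Sum>i<n. count (mset xs) i * N ^ i) = (\<Sum>i<n. count (mset ys) i * N ^ i)"
          using s[of xs] s[of ys] n assms(3) by simp
      qed
    next
      case False
      then have "i \<notin> set xs" "i \<notin> set ys" using n by auto
      then show ?thesis by (metis count_eq_zero_iff set_mset_mset)
    qed
  qed
qed

section \<open>Coefficients of series and leading terms in an auxiliary scalar\<close>

lemma Gg_eq_0: "length w < j \<Longrightarrow> Gg j w = 0"
proof -
  have "length (G_word j) = 2 * j" by (induction j) (auto simp: G_word_def)
  then show "length w < j \<Longrightarrow> Gg j w = 0" by (auto simp: Gg_def word_def)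
qed

text \<open>The coefficient of x^i in the series \<phi>(x) \<open>gG x\<close>.\<close>

definition gG_times_coeff :: "'a::field poly \<Rightarrow> nat \<Rightarrow> 'a vec" where
  "gG_times_coeff \<phi> i = (\<Sum>m\<le>i. sc (coeff \<phi> m) (Gg (i - m)))"

lemma gen_gG_times_coeff: "gen (\<lambda>x. sc (poly \<phi> x) (gG x)) (gG_times_coeff \<phi>)" for \<phi> :: "'a::field poly"
  unfolding gen_def
proof (intro exI[of _ "degree \<phi> + 1"] allI impI)
  fix x B and w :: "letter list" assume B: "length w + (degree \<phi> + 1) \<le> B"
  \<comment> \<open>At the fixed word w the series \<open>gG x\<close> is a polynomial in x, so the
    claim reduces to the coefficients of a product of two polynomials.\<close>
  define \<psi> :: "'a poly" where "\<psi> = (\<Sum>j\<le>length w. monom (Gg j w) j)"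
  have c: "coeff \<psi> j = Gg j w" for j
    using Gg_eq_0[of w j] by (auto simp: \<psi>_def coeff_sum)
  have "degree \<psi> \<le> length w"
    unfolding \<psi>_def by (intro degree_sum_le) (auto intro: order.trans[OF degree_monom_le])
  then have d: "degree (\<phi> * \<psi>) < B"
    using degree_mult_le[of \<phi> \<psi>] B by simp
  have "poly \<psi> x = gG x w"
    using gW_gG_sum[of w "Suc (length w)" x]
    by (simp add: \<psi>_def poly_sum poly_monom mult.commute lessThan_Suc_atMost del: sum.lessThan_Suc)
  then have "sc (poly \<phi> x) (gG x) w = poly (\<phi> * \<psi>) x"
    by (simp add: sc_apply)
  also have "\<dots> = (\<Sum>i\<le>degree (\<phi> * \<psi>). coeff (\<phi> * \<psi>) i * x ^ i)"
    by (rule poly_altdef)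
  also have "\<dots> = (\<Sum>i<B. coeff (\<phi> * \<psi>) i * x ^ i)"
    using d by (intro sum.mono_neutral_left) (auto simp: coeff_eq_0)
  also have "\<dots> = (\<Sum>i<B. x ^ i * gG_times_coeff \<phi> i w)"
    by (simp add: coeff_mult c gG_times_coeff_def sum_fun_apply sc_apply mult.commute)
  finally show "sc (poly \<phi> x) (gG x) w = (\<Sum>i<B. x ^ i * gG_times_coeff \<phi> i w)" .
qed

definition poly_below :: "nat \<Rightarrow> ('a::field \<Rightarrow> 'a vec) \<Rightarrow> bool" where
  "poly_below d F \<longleftrightarrow> (\<exists>p. \<forall>u. F u = (\<Sum>k<d. sc (u ^ k) (p k)))"

lemma poly_below_single: "k < d \<Longrightarrow> poly_below d (\<lambda>u. sc (u ^ k) v)"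
proof -
  assume k: "k < d"
  have "sc (u ^ k) v = (\<Sum>i<d. sc (u ^ i) (if i = k then v else 0))" for u
  proof -
    have "(\<Sum>i<d. sc (u ^ i) (if i = k then v else 0)) = (\<Sum>i<d. if i = k then sc (u ^ i) v else 0)"
      by (intro sum.cong) auto
    then show ?thesis using k by simp
  qed
  then show ?thesis unfolding poly_below_def by (intro exI[of _ "\<lambda>i. if i = k then v else 0"]) blast
qed

lemma poly_below_add: "poly_below d F \<Longrightarrow> poly_below d H \<Longrightarrow> poly_below d (\<lambda>u. F u + H u)"
proof -
  assume "poly_below d F" "poly_below d H"
  then obtain p p' where p: "\<And>u. F u = (\<Sum>k<d. sc (u ^ k) (p k))" "\<And>u. H u = (\<Sum>k<d. sc (u ^ k) (p' k))"
    unfolding poly_below_def by blast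
  show ?thesis
    unfolding poly_below_def by (rule exI[of _ "\<lambda>k. p k + p' k"]) (simp add: p sum.distrib sc_add)
qed

lemma poly_below_sc: "poly_below d F \<Longrightarrow> poly_below d (\<lambda>u. sc c (F u))"
proof -
  assume "poly_below d F"
  then obtain p where p: "\<And>u. F u = (\<Sum>k<d. sc (u ^ k) (p k))"
    unfolding poly_below_def by blast
  show ?thesis
    unfolding poly_below_def by (rule exI[of _ "\<lambda>k. sc c (p k)"]) (simp add: p fn.scale_sum_right mult.commute)
qed

lemma poly_below_zero: "poly_below d (\<lambda>u. 0)"
  unfolding poly_below_def by (rule exI[of _ "\<lambda>k. 0"]) simp

lemma poly_below_sum: "(\<And>i. i \<in> A \<Longrightarrow> poly_below d (F i)) \<Longrightarrow> poly_below d (\<lambda>u. \<Sum>i\<in>A. F i u)"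
  by (induction A rule: infinite_finite_induct) (simp_all add: poly_below_zero poly_below_add)

lemma poly_below_mono: "poly_below d F \<Longrightarrow> d \<le> d' \<Longrightarrow> poly_below d' F"
proof -
  assume "poly_below d F" and d: "d \<le> d'"
  then obtain p where p: "\<And>u. F u = (\<Sum>k<d. sc (u ^ k) (p k))"
    unfolding poly_below_def by blast
  have "poly_below d' (\<lambda>u. \<Sum>k<d. sc (u ^ k) (p k))"
    using d by (intro poly_below_sum poly_below_single) auto
  then show ?thesis by (simp add: p poly_below_def)
qed

lemma poly_below_star_power: "poly_below d F \<Longrightarrow> poly_below (d + e) (\<lambda>u. star q (F u) (sc (u ^ e) h))"
  and poly_below_power_star: "poly_below d F \<Longrightarrow> poly_below (d + e) (\<lambda>u. star q (sc (u ^ e) h) (F u))"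
proof -
  assume "poly_below d F"
  then obtain p where p: "\<And>u. F u = (\<Sum>k<d. sc (u ^ k) (p k))"
    unfolding poly_below_def by blast
  have "poly_below (d + e) (\<lambda>u. \<Sum>k<d. sc (u ^ (e + k)) (star q (p k) h))"
    "poly_below (d + e) (\<lambda>u. \<Sum>k<d. sc (u ^ (k + e)) (star q h (p k)))"
    by (intro poly_below_sum poly_below_single; simp)+
  then show "poly_below (d + e) (\<lambda>u. star q (F u) (sc (u ^ e) h))" "poly_below (d + e) (\<lambda>u. star q (sc (u ^ e) h) (F u))"
    by (simp_all add: p star_sum_left star_sum_right fn.scale_sum_right power_add)
qed

lemma poly_below_star: "poly_below d F \<Longrightarrow> poly_below e H \<Longrightarrow> poly_below (d + e) (\<lambda>u. star q (F u) (H u))"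
proof -
  assume F: "poly_below d F" and "poly_below e H"
  then obtain p where p: "\<And>u. H u = (\<Sum>k<e. sc (u ^ k) (p k))"
    unfolding poly_below_def by blast
  have "poly_below (d + e) (\<lambda>u. \<Sum>k<e. star q (F u) (sc (u ^ k) (p k)))"
    by (intro poly_below_sum poly_below_mono[OF poly_below_star_power[OF F]]) simp
  then show ?thesis by (simp add: p star_sum_right del: star_sc_right)
qed

text \<open>The coefficient f may vanish, so d is only an upper bound for the degree.\<close>

definition leading :: "nat \<Rightarrow> ('a::field \<Rightarrow> 'a vec) \<Rightarrow> 'a vec \<Rightarrow> bool" where
  "leading d F f \<longleftrightarrow> (\<exists>A. poly_below d A \<and> (\<forall>u. F u = sc (u ^ d) f + A u))"

lemma leading_const: "leading 0 (\<lambda>u. f) f"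
  unfolding leading_def by (rule exI[of _ "\<lambda>u. 0"]) (simp add: poly_below_zero)

lemma leading_poly_below: "leading d F f \<Longrightarrow> d < d' \<Longrightarrow> poly_below d' F"
proof -
  assume "leading d F f" and d: "d < d'"
  then obtain A where A: "poly_below d A" "\<And>u. F u = sc (u ^ d) f + A u" unfolding leading_def by blast
  have "poly_below d' (\<lambda>u. sc (u ^ d) f + A u)"
    using d by (intro poly_below_add poly_below_single poly_below_mono[OF A(1)]) auto
  then show ?thesis by (simp add: A(2) poly_below_def)
qed

lemma leading_star: "leading d F f \<Longrightarrow> leading e H h \<Longrightarrow> leading (d + e) (\<lambda>u. star q (F u) (H u)) (star q f h)"
proof -
  assume "leading d F f" "leading e H h"
  then obtain A C where A: "poly_below d A" "\<And>u. F u = sc (u ^ d) f + A u" and C: "poly_below e C" "\<And>u. H u = sc (u ^ e) h + C u"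
    unfolding leading_def by blast
  have "poly_below (d + e) (\<lambda>u. star q (sc (u ^ d) f) (C u))"
    using poly_below_power_star[OF C(1)] by (simp only: add.commute)
  then have 1: "poly_below (d + e) (\<lambda>u. star q (sc (u ^ d) f) (C u) + star q (A u) (sc (u ^ e) h) + star q (A u) (C u))"
    by (intro poly_below_add[OF poly_below_add] poly_below_star_power[OF A(1)] poly_below_star[OF A(1) C(1)])
  have "star q (F u) (H u) = sc (u ^ (d + e)) (star q f h)
    + (star q (sc (u ^ d) f) (C u) + star q (A u) (sc (u ^ e) h) + star q (A u) (C u))" for u
    by (simp add: A(2) C(2) power_add sc_add mult.commute)
  then show ?thesis unfolding leading_def using 1 by blast
qed

lemma leading_star_list:
  assumes "\<And>x. x \<in> set xs \<Longrightarrow> leading (d x) (F x) (f x)"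
  shows "leading (\<Sum>x\<leftarrow>xs. d x) (\<lambda>u. star_list q (map (\<lambda>x. F x u) xs)) (star_list q (map f xs))"
  using assms by (induction xs) (simp_all add: leading_const leading_star)

lemma leading_zero:
  assumes "infinite (UNIV :: 'a::field set)" "leading d F f" "\<And>u :: 'a. F u = 0"
  shows "f = 0"
proof
  fix w
  obtain A where "poly_below d A" "\<And>u. F u = sc (u ^ d) f + A u" using assms(2) unfolding leading_def by blast
  then obtain p where p: "\<And>u. F u = sc (u ^ d) f + (\<Sum>k<d. sc (u ^ k) (p k))"
    unfolding poly_below_def by metis
  define P where "P = monom (f w) d + (\<Sum>k<d. monom (p k w) k)"
  have "poly P u = F u w" for u
    by (simp add: p P_def poly_sum poly_monom vec_apply sum_fun_apply mult.commute)
  then have "{u. poly P u = 0} = UNIV" using assms(3) by (simp add: zero_fun_apply)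
  then have "P = 0" using poly_roots_finite assms(1) by fastforce
  moreover have "coeff P d = f w" by (simp add: P_def coeff_sum)
  ultimately show "f w = 0 w" by (simp add: zero_fun_apply)
qed

section \<open>Extraction of coefficients\<close>

context qshuffle
begin

lemma infinite_field: "infinite (UNIV :: 'a set)"
proof -
  have "q ^ m \<noteq> q ^ n" if "m < n" for m n
  proof
    assume "q ^ m = q ^ n"
    moreover have "q ^ n = q ^ m * q ^ (n - m)" using that by (simp flip: power_add)
    ultimately have "q ^ (n - m) = 1" using q_nz by simp
    then show False using q_nru[of "n - m"] that by simp
  qed
  then have "inj (\<lambda>n. q ^ n)" by (metis injI linorder_neqE_nat)
  then show ?thesis using finite_subset infinite_iff_countable_subset by blast
qed

abbreviation gen_prod :: "(('a \<Rightarrow> 'a vec) \<times> (nat \<Rightarrow> 'a vec)) list \<Rightarrow> 'a list \<Rightarrow> 'a vec" where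
  "gen_prod Z zs \<equiv> star_list q (map2 (\<lambda>z x. fst z x) Z zs)"

abbreviation coeff_prod :: "(('a \<Rightarrow> 'a vec) \<times> (nat \<Rightarrow> 'a vec)) list \<Rightarrow> nat list \<Rightarrow> 'a vec" where
  "coeff_prod Z l \<equiv> star_list q (map2 (\<lambda>z i. snd z i) Z l)"

text \<open>At a given word the truncation bound B is uniform in the parameters zs; this makes the
  value of the product a polynomial in zs.\<close>

lemma gen_prod_expand:
  assumes "\<forall>z\<in>set Z. gen (fst z) (snd z)"
  shows "\<exists>D. \<forall>w B zs. length w + D \<le> B \<longrightarrow> length zs = length Z
    \<longrightarrow> gen_prod Z zs w = (\<Sum>l\<in>tuples (length Z) B. sc (monomial zs l) (coeff_prod Z l)) w"
  using assms
proof (induction Z)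
  case Nil
  show ?case by (simp add: tuples_0)
next
  case (Cons z Z)
  obtain D1 where D1: "gen_prod Z zs w = (\<Sum>l\<in>tuples (length Z) B. sc (monomial zs l) (coeff_prod Z l)) w"
    if "length w + D1 \<le> B" "length zs = length Z" for w B zs
    using Cons.IH Cons.prems by auto
  obtain D2 where D2: "fst z x w = (\<Sum>i<B. x ^ i * snd z i w)" if "length w + D2 \<le> B" for x w B
    using Cons.prems unfolding gen_def by auto
  show ?case
  proof (intro exI[of _ "max D1 D2"] allI impI)
    fix w :: "letter list" and B and zs :: "'a list"
    assume B: "length w + max D1 D2 \<le> B" and "length zs = length (z # Z)"
    then obtain x xs where zs: "zs = x # xs" "length xs = length Z" by (cases zs) auto
    have "gen_prod (z # Z) zs w = (fst z x \<star> gen_prod Z xs) w" by (simp add: zs)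
    also have "\<dots> = ((\<Sum>i<B. sc (x ^ i) (snd z i)) \<star> (\<Sum>l\<in>tuples (length Z) B. sc (monomial xs l) (coeff_prod Z l))) w"
    proof (rule star_cong)
      fix v :: "letter list" assume v: "length v \<le> length w"
      show "fst z x v = (\<Sum>i<B. sc (x ^ i) (snd z i)) v"
        using D2[of v B x] v B by (simp add: sum_fun_apply sc_apply)
      show "gen_prod Z xs v = (\<Sum>l\<in>tuples (length Z) B. sc (monomial xs l) (coeff_prod Z l)) v"
        using D1[of v B xs] v B zs by simp
    qed
    also have "\<dots> = (\<Sum>l\<in>tuples (length (z # Z)) B. sc (monomial zs l) (coeff_prod (z # Z) l)) w"
      by (simp add: star_sum_left sum_tuples_Suc zs) (simp add: star_sum_right fn.scale_sum_right)
    finally show "gen_prod (z # Z) zs w = (\<Sum>l\<in>tuples (length (z # Z)) B. sc (monomial zs l) (coeff_prod (z # Z) l)) w" .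
  qed
qed

lemma T_gen_prod_expand:
  assumes "\<forall>z\<in>set Z. gen (fst z) (snd z)" "local_linear T"
  shows "\<exists>D. \<forall>B zs. D \<le> B \<longrightarrow> length zs = length Z
    \<longrightarrow> T (gen_prod Z zs) w = (\<Sum>l\<in>tuples (length Z) B. monomial zs l * T (coeff_prod Z l) w)"
proof -
  obtain D where D: "gen_prod Z zs w = (\<Sum>l\<in>tuples (length Z) B. sc (monomial zs l) (coeff_prod Z l)) w"
    if "length w + D \<le> B" "length zs = length Z" for w B zs
    using gen_prod_expand[OF assms(1)] by blast
  obtain d where d: "T f w = T g w" if "\<forall>v. length v \<le> length w + d \<longrightarrow> f v = g v" for w f g
    using assms(2) unfolding local_linear_def by blast
  show ?thesis
  proof (intro exI[of _ "length w + d + D"] allI impI)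
    fix B and zs :: "'a list" assume B: "length w + d + D \<le> B" "length zs = length Z"
    have "T (gen_prod Z zs) w = T (\<Sum>l\<in>tuples (length Z) B. sc (monomial zs l) (coeff_prod Z l)) w"
      by (rule d) (use D B in auto)
    then show "T (gen_prod Z zs) w = (\<Sum>l\<in>tuples (length Z) B. monomial zs l * T (coeff_prod Z l) w)"
      by (simp add: local_linear_sum[OF assms(2)] local_linear_sc[OF assms(2)] sum_fun_apply sc_apply)
  qed
qed

text \<open>At a fixed word both sides are polynomials in the parameters and are determined by their
  values at distinct points. An identity between products of series thus passes to products of
  single words.\<close>

lemma extract_coefficients:
  assumes Z: "\<forall>z\<in>set Z. gen (fst z) (snd z)" and Z': "\<forall>z\<in>set Z'. gen (fst z) (snd z)"
    and T: "local_linear T" "local_linear T'" and len: "length Z' = length Z" "length l = length Z"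
    and eq: "\<And>zs. length zs = length Z \<Longrightarrow> distinct zs \<Longrightarrow> T (gen_prod Z zs) = T' (gen_prod Z' zs)"
  shows "T (coeff_prod Z l) = T' (coeff_prod Z' l)"
proof
  fix w
  obtain D where D: "T (gen_prod Z zs) w = (\<Sum>l\<in>tuples (length Z) B. monomial zs l * T (coeff_prod Z l) w)"
    if "D \<le> B" "length zs = length Z" for B zs
    using T_gen_prod_expand[OF Z T(1)] by blast
  obtain D' where D': "T' (gen_prod Z' zs) w = (\<Sum>l\<in>tuples (length Z) B. monomial zs l * T' (coeff_prod Z' l) w)"
    if "D' \<le> B" "length zs = length Z" for B zs
    using T_gen_prod_expand[OF Z' T(2), of w] unfolding len(1) by blast
  obtain n where n: "set l \<subseteq> {..<n}"
    using finite_nat_iff_bounded[of "set l"] by auto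
  define B where "B = max (max D D') n"
  have "T (coeff_prod Z l) w - T' (coeff_prod Z' l) w = 0"
  proof (rule poly_vanish[OF infinite_field])
    show "l \<in> tuples (length Z) B" using n len by (auto simp: tuples_def B_def)
    fix zs :: "'a list" assume zs: "length zs = length Z" "distinct zs"
    have "T (gen_prod Z zs) w = T' (gen_prod Z' zs) w" using eq[OF zs] by simp
    then show "(\<Sum>l\<in>tuples (length Z) B. monomial zs l * (T (coeff_prod Z l) w - T' (coeff_prod Z' l) w)) = 0"
      using D[of B zs] D'[of B zs] zs by (simp add: B_def right_diff_distrib sum_subtractf)
  qed
  then show "T (coeff_prod Z l) w = T' (coeff_prod Z' l) w" by simp
qed

lemma map2_replicate: "length t = a \<Longrightarrow> map2 f (replicate a z) t = map (f z) t"
  by (induction t arbitrary: a) auto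

lemma Psi_star_list: "Psi t s r = star_list q (map gW t @ map gG s @ map gP r)"
proof -
  have "foldr (\<lambda>t f. F t \<star> f) t h = star_list q (map F t) \<star> h" for F :: "'a \<Rightarrow> 'a vec" and t h
    by (induction t) (simp_all add: star_assoc)
  then show ?thesis by (simp add: Psi_def PW_def PG_def PP_def star_list_append)
qed

text \<open>\<open>Z\<close> pairs each factor of \<open>Psi\<close> with its coefficients,
  \<open>Z'\<close> does so for the image under T, where the outer factors are \<phi> and \<chi>
  times \<open>gG\<close>. Extracting coefficients transfers the action of T from \<open>Psi\<close>
  to monomials.\<close>

lemma M_coefficient:
  assumes "realises T a b (\<lambda>t r. (\<Prod>x\<leftarrow>t. poly \<phi> x) * (\<Prod>x\<leftarrow>r. poly \<chi> x))"
  shows M_coefficient_eq: "length is = a \<Longrightarrow> length ks = b \<Longrightarrow>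
      T (M is js ks) = star_list q (map (gG_times_coeff \<phi>) is @ map Gg js @ map (gG_times_coeff \<chi>) ks)"
    and M_coefficient_zero: "length is < a \<or> length ks < b \<Longrightarrow> T (M is js ks) = 0"
proof -
  define Z :: "(('a \<Rightarrow> 'a vec) \<times> (nat \<Rightarrow> 'a vec)) list" where "Z = replicate (length is) (gW, Wm) @ replicate (length js) (gG, Gg) @ replicate (length ks) (gP, Wp)"
  define Z' :: "(('a \<Rightarrow> 'a vec) \<times> (nat \<Rightarrow> 'a vec)) list" where "Z' = replicate (length is) (\<lambda>x. sc (poly \<phi> x) (gG x), gG_times_coeff \<phi>)
    @ replicate (length js) (gG, Gg) @ replicate (length ks) (\<lambda>x. sc (poly \<chi> x) (gG x), gG_times_coeff \<chi>)"
  have gen: "\<forall>z\<in>set Z. gen (fst z) (snd z)" "\<forall>z\<in>set Z'. gen (fst z) (snd z)"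
    by (auto simp: Z_def Z'_def gen_gW gen_gG gen_gP gen_gG_times_coeff)
  have len: "length Z' = length Z" "length (is @ js @ ks) = length Z"
    by (simp_all add: Z_def Z'_def)
  have M: "M is js ks = coeff_prod Z (is @ js @ ks)"
    by (simp add: M_def Z_def map2_replicate)
  have split: "\<exists>t s r. zs = t @ s @ r \<and> length t = length is \<and> length s = length js \<and> length r = length ks"
    if "length zs = length Z" for zs :: "'a list"
  proof -
    have "zs = take (length is) zs @ take (length js) (drop (length is) zs) @ drop (length js) (drop (length is) zs)"
      by (simp del: drop_drop)
    moreover have "length zs = length is + (length js + length ks)" using that by (simp add: Z_def)
    ultimately show ?thesis
      by (metis append_eq_conv_conj diff_add_inverse length_append length_drop length_take min_absorb2 le_add1)
  qed
  have Psi: "gen_prod Z (t @ s @ r) = Psi t s r"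
    if "length t = length is" "length s = length js" "length r = length ks" for t s r
    using that by (simp add: Z_def map2_replicate Psi_star_list)
  have scale: "star_list q (map (\<lambda>x. sc (poly p x) (gG x)) t) = sc (\<Prod>x\<leftarrow>t. poly p x) (star_list q (map gG t))" for p t
    by (induction t) (simp_all add: mult.commute)
  have PG: "PG t one = star_list q (map gG t)" for t
    by (induction t) simp_all
  have G: "gen_prod Z' (t @ s @ r) = sc ((\<Prod>x\<leftarrow>t. poly \<phi> x) * (\<Prod>x\<leftarrow>r. poly \<chi> x)) (PG (t @ s @ r) one)"
    if "length t = length is" "length s = length js" "length r = length ks" for t s r
    using that by (simp add: Z'_def map2_replicate PG star_list_append scale mult.commute)
  show "T (M is js ks) = star_list q (map (gG_times_coeff \<phi>) is @ map Gg js @ map (gG_times_coeff \<chi>) ks)"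
    if l: "length is = a" "length ks = b"
  proof -
    have "T (coeff_prod Z (is @ js @ ks)) = coeff_prod Z' (is @ js @ ks)"
    proof (rule extract_coefficients[OF gen realises_local_linear[OF assms] local_linear_id len])
      fix zs :: "'a list" assume zs: "length zs = length Z" "distinct zs"
      then obtain t s r where "zs = t @ s @ r" "length t = length is" "length s = length js" "length r = length ks"
        using split by blast
      then show "T (gen_prod Z zs) = gen_prod Z' zs"
        using zs l by (simp only: Psi G) (rule realises_eq[OF assms], auto)
    qed
    then show ?thesis by (simp add: M) (simp add: Z'_def map2_replicate)
  qed
  show "T (M is js ks) = 0" if l: "length is < a \<or> length ks < b"
  proof -
    have "local_linear (\<lambda>f :: 'a vec. 0)" unfolding local_linear_def by simp
    then have "T (coeff_prod Z (is @ js @ ks)) = 0"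
    proof (rule extract_coefficients[OF gen(1) gen(1) realises_local_linear[OF assms] _ refl len(2), where T' = "\<lambda>f. 0"])
      fix zs :: "'a list" assume zs: "length zs = length Z" "distinct zs"
      then obtain t s r where "zs = t @ s @ r" "length t = length is" "length s = length js" "length r = length ks"
        using split by blast
      then show "T (gen_prod Z zs) = 0"
        using zs l by (simp only: Psi) (rule realises_zero[OF assms], auto)
    qed
    then show ?thesis by (simp add: M)
  qed
qed

text \<open>Specialising the coefficients of \<open>\<phi>\<close> and \<open>\<chi>\<close> to rapidly growing powers of \<open>u\<close>, the coefficient of the
  highest power of \<open>u\<close> singles out one choice of the outer two blocks.\<close>
lemma leading_block:
  fixes K :: "(nat list \<times> nat list \<times> nat list) set" and c :: "nat list \<times> nat list \<times> nat list \<Rightarrow> 'a"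
  assumes fin: "finite K" and "K \<noteq> {}"
    and srt0: "\<forall>(is, js, ks)\<in>K. length is = a \<and> length ks = b \<and> sorted is \<and> sorted ks"
    and zero: "\<And>\<phi> \<chi>. (\<Sum>(is, js, ks)\<in>K. sc (c (is, js, ks)) (star_list q (map (gG_times_coeff \<phi>) is @ map Gg js @ map (gG_times_coeff \<chi>) ks))) = 0"
  obtains is0 ks0 where "\<exists>js. (is0, js, ks0) \<in> K"
    "(\<Sum>js | (is0, js, ks0) \<in> K. sc (c (is0, js, ks0)) (star_list q (map Gg js))) = 0"
proof -
  have srt: "length is = a \<and> length ks = b \<and> sorted is \<and> sorted ks" if "(is, js, ks) \<in> K" for "is" js ks
    using srt0 that by auto
  have "finite (\<Union>(is, js, ks)\<in>K. set is \<union> set ks)" using fin by auto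
  then obtain B where "(\<Union>(is, js, ks)\<in>K. set is \<union> set ks) \<subseteq> {..<B}"
    unfolding finite_nat_iff_bounded by blast
  then have B: "\<And>is js ks i. (is, js, ks) \<in> K \<Longrightarrow> i \<in> set is \<Longrightarrow> i < B" "\<And>is js ks i. (is, js, ks) \<in> K \<Longrightarrow> i \<in> set ks \<Longrightarrow> i < B"
    by fastforce+
  \<comment> \<open>The base exceeds the number a + b of entries in a code, and it is at least 2, so
    that its powers increase strictly.\<close>
  define N where "N = a + b + 2"
  \<comment> \<open>All indices lie below B, so the shift by B places the exponents for ks above
    those for is and both blocks can be recovered from one code.\<close>
  define code where "code = (\<lambda>(is, js :: nat list, ks). (\<Sum>i\<leftarrow>is. N ^ i) + (\<Sum>k\<leftarrow>ks. N ^ (B + k)))"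
  define P where "P s u = (\<Sum>m<B. monom (u ^ (N ^ (s + m))) m)" for s and u :: 'a
  have coeffP: "coeff (P s u) m = (if m < B then u ^ (N ^ (s + m)) else 0)" for s u m
    by (simp add: P_def coeff_sum)
  \<comment> \<open>The summand m = i carries the highest power of u, and its word is
    \<open>Gg 0\<close> = 1: in the leading coefficient the outer blocks disappear.\<close>
  have top: "leading (N ^ (s + i)) (\<lambda>u. gG_times_coeff (P s u) i) one" if "i < B" for s i
  proof -
    have less: "N ^ (s + m) < N ^ (s + i)" if "m < i" for m
      using that by (intro power_strict_increasing) (auto simp: N_def)
    have "gG_times_coeff (P s u) i = sc (u ^ (N ^ (s + i))) one + (\<Sum>m<i. sc (u ^ (N ^ (s + m))) (Gg (i - m)))" for u
    proof -
      have "gG_times_coeff (P s u) i = (\<Sum>m\<le>i. sc (u ^ (N ^ (s + m))) (Gg (i - m)))"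
        unfolding gG_times_coeff_def using that by (intro sum.cong) (auto simp: coeffP)
      then show ?thesis by (simp add: lessThan_Suc_atMost[symmetric])
    qed
    moreover have "poly_below (N ^ (s + i)) (\<lambda>u. \<Sum>m<i. sc (u ^ (N ^ (s + m))) (Gg (i - m)))"
      by (intro poly_below_sum poly_below_single) (use less in auto)
    ultimately show ?thesis unfolding leading_def by blast
  qed
  have star_list_one: "star_list q (map (\<lambda>_. one) xs) = one" for xs :: "nat list"
    by (induction xs) simp_all
  define F where "F = (\<lambda>(is, js, ks) u. star_list q (map (gG_times_coeff (P 0 u)) is @ map Gg js @ map (gG_times_coeff (P B u)) ks))"
  have topF: "leading (code x) (F x) (star_list q (map Gg (fst (snd x))))" if "x \<in> K" for x
  proof -
    obtain "is" js ks where x: "x = (is, js, ks)" by (cases x)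
    have "leading (\<Sum>i\<leftarrow>is. N ^ i) (\<lambda>u. star_list q (map (\<lambda>i. gG_times_coeff (P 0 u) i) is)) (star_list q (map (\<lambda>_. one) is))"
      by (rule leading_star_list) (use top[where s = 0] B(1) that x in auto)
    moreover have "leading (\<Sum>i\<leftarrow>ks. N ^ (B + i)) (\<lambda>u. star_list q (map (\<lambda>i. gG_times_coeff (P B u) i) ks)) (star_list q (map (\<lambda>_. one) ks))"
      by (rule leading_star_list) (use top[where s = B] B(2) that x in auto)
    ultimately have "leading ((\<Sum>i\<leftarrow>is. N ^ i) + (0 + (\<Sum>i\<leftarrow>ks. N ^ (B + i))))
      (\<lambda>u. star_list q (map (\<lambda>i. gG_times_coeff (P 0 u) i) is) \<star> (star_list q (map Gg js) \<star> star_list q (map (\<lambda>i. gG_times_coeff (P B u) i) ks)))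
      (one \<star> (star_list q (map Gg js) \<star> one))"
      unfolding star_list_one by (intro leading_star leading_const)
    then show ?thesis by (simp add: x code_def F_def star_list_append)
  qed
  define C where "C = Max (code ` K)"
  define K3 where "K3 = {x \<in> K. code x = C}"
  have C: "code x \<le> C" if "x \<in> K" for x using fin that by (simp add: C_def)
  have "C \<in> code ` K" unfolding C_def using fin \<open>K \<noteq> {}\<close> by (intro Max_in) auto
  then obtain is0 js0 ks0 where x0: "(is0, js0, ks0) \<in> K" "code (is0, js0, ks0) = C" by auto
  have "leading C (\<lambda>u. \<Sum>x\<in>K. sc (c x) (F x u)) (\<Sum>x\<in>K3. sc (c x) (star_list q (map Gg (fst (snd x)))))"
  proof -
    have "\<forall>x\<in>K3. \<exists>A. poly_below C A \<and> (\<forall>u. F x u = sc (u ^ C) (star_list q (map Gg (fst (snd x)))) + A u)"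
      using topF unfolding K3_def leading_def by blast
    then obtain A where A: "\<And>x. x \<in> K3 \<Longrightarrow> poly_below C (A x)"
      "\<And>x u. x \<in> K3 \<Longrightarrow> F x u = sc (u ^ C) (star_list q (map Gg (fst (snd x)))) + A x u"
      by metis
    have low: "poly_below C (F x)" if "x \<in> K - K3" for x
    proof (rule leading_poly_below[OF topF])
      show "x \<in> K" using that by simp
      then show "code x < C" using that C[of x] by (simp add: K3_def)
    qed
    have "poly_below C (\<lambda>u. (\<Sum>x\<in>K3. sc (c x) (A x u)) + (\<Sum>x\<in>K - K3. sc (c x) (F x u)))"
      by (intro poly_below_add poly_below_sum poly_below_sc A low)
    moreover have "(\<Sum>x\<in>K. sc (c x) (F x u)) = sc (u ^ C) (\<Sum>x\<in>K3. sc (c x) (star_list q (map Gg (fst (snd x)))))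
      + ((\<Sum>x\<in>K3. sc (c x) (A x u)) + (\<Sum>x\<in>K - K3. sc (c x) (F x u)))" for u
    proof -
      have "(\<Sum>x\<in>K. sc (c x) (F x u)) = (\<Sum>x\<in>K - K3. sc (c x) (F x u)) + (\<Sum>x\<in>K3. sc (c x) (F x u))"
        using fin by (intro sum.subset_diff) (auto simp: K3_def)
      also have "(\<Sum>x\<in>K3. sc (c x) (F x u))
        = (\<Sum>x\<in>K3. sc (u ^ C) (sc (c x) (star_list q (map Gg (fst (snd x))))) + sc (c x) (A x u))"
        by (intro sum.cong refl) (simp add: A(2) sc_add mult.commute)
      finally show ?thesis by (simp add: sum.distrib fn.scale_sum_right)
    qed
    ultimately show ?thesis unfolding leading_def by blast
  qed
  moreover have "(\<Sum>x\<in>K. sc (c x) (F x u)) = 0" for u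
    using zero[of "P 0 u" "P B u"] by (simp add: F_def case_prod_unfold)
  ultimately have Z: "(\<Sum>x\<in>K3. sc (c x) (star_list q (map Gg (fst (snd x))))) = 0"
    using leading_zero[OF infinite_field] by blast
  \<comment> \<open>Equal codes give equal multisets. The list is followed by the shifted ks is
    sorted, so the lists agree, and the common length a separates the two parts.\<close>
  have inj: "is = is0 \<and> ks = ks0" if x: "(is, js, ks) \<in> K3" for "is" js ks
  proof -
    have xK: "(is, js, ks) \<in> K" and cx: "code (is, js, ks) = C" using x by (auto simp: K3_def)
    have e: "(\<Sum>i\<leftarrow>xs @ map ((+) B) ys. N ^ i) = code (xs, zs, ys)" for xs ys zs
      by (simp add: code_def comp_def)
    have "mset (is @ map ((+) B) ks) = mset (is0 @ map ((+) B) ks0)"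
    proof (rule power_code_inj)
      show "length (is @ map ((+) B) ks) < N" "length (is0 @ map ((+) B) ks0) < N"
        using srt[OF xK] srt[OF x0(1)] by (simp_all add: N_def)
    qed (use e[of "is" ks js] e[of is0 ks0 js0] cx x0(2) in simp)
    moreover have "sorted (ys @ map ((+) B) zs)" if "(ys, j, zs) \<in> K" for ys j zs
      using srt[OF that] B(1)[OF that] by (auto simp: sorted_append sorted_map le_add1 intro: trans_le_add1 less_imp_le
          elim!: sorted_wrt_mono_rel[rotated])
    ultimately have "is @ map ((+) B) ks = is0 @ map ((+) B) ks0"
      using xK x0(1) by (metis properties_for_sort)
    moreover have "length is = length is0" using srt[OF xK] srt[OF x0(1)] by simp
    moreover have "inj ((+) B)" by simp
    ultimately show ?thesis by (simp add: inj_map_eq_map)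
  qed
  have "K3 = (\<lambda>js. (is0, js, ks0)) ` {js. (is0, js, ks0) \<in> K}"
  proof
    show "K3 \<subseteq> (\<lambda>js. (is0, js, ks0)) ` {js. (is0, js, ks0) \<in> K}"
      using inj by (fastforce simp: K3_def)
    show "(\<lambda>js. (is0, js, ks0)) ` {js. (is0, js, ks0) \<in> K} \<subseteq> K3"
      using x0(2) by (auto simp: K3_def code_def)
  qed
  then have "(\<Sum>js | (is0, js, ks0) \<in> K. sc (c (is0, js, ks0)) (star_list q (map Gg js))) = 0"
    using Z by (simp add: sum.reindex inj_on_def)
  then show ?thesis using that x0(1) by blast
qed

section \<open>Independence of products of W_-, of products of G, and of all ordered
  monomials\<close>

lemma Wm_independent:
  assumes "finite J" "\<And>is. is \<in> J \<Longrightarrow> sorted is \<and> length is = a"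
    and "(\<Sum>is\<in>J. sc (c is) (star_list q (map Wm is))) = 0" "\<And>is. is \<in> J \<Longrightarrow> c is \<noteq> 0"
  shows "J = {}"
proof (rule ccontr)
  assume "J \<noteq> {}"
  define K where "K = (\<lambda>is. (is, [] :: nat list, [] :: nat list)) ` J"
  have K: "finite K" "K \<noteq> {}" using assms(1) \<open>J \<noteq> {}\<close> by (auto simp: K_def)
  have inj: "inj_on (\<lambda>is. (is, [] :: nat list, [] :: nat list)) J" by (auto simp: inj_on_def)
  define c2 where "c2 x = c (fst x)" for x :: "nat list \<times> nat list \<times> nat list"
  have z: "(\<Sum>(is, js, ks)\<in>K. sc (c2 (is, js, ks)) (star_list q (map (gG_times_coeff \<phi>) is @ map Gg js @ map (gG_times_coeff \<chi>) ks))) = 0" for \<phi> \<chi>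
  proof -
    obtain T where T: "realises T a 0 (\<lambda>t r. (\<Prod>x\<leftarrow>t. poly \<phi> x) * (\<Prod>x\<leftarrow>r. poly \<chi> x))"
      using realisable_E[OF realisable_poly] .
    have "0 = T (\<Sum>is\<in>J. sc (c is) (M is [] []))"
      using assms(3) local_linear_zero[OF realises_local_linear[OF T]] by (simp add: M_def)
    also have "\<dots> = (\<Sum>is\<in>J. sc (c is) (T (M is [] [])))"
      by (simp add: local_linear_sum[OF realises_local_linear[OF T]] local_linear_sc[OF realises_local_linear[OF T]])
    also have "\<dots> = (\<Sum>is\<in>J. sc (c is) (star_list q (map (gG_times_coeff \<phi>) is @ map Gg [] @ map (gG_times_coeff \<chi>) [])))"
      by (intro sum.cong refl, subst M_coefficient_eq[OF T]) (use assms(2) in auto)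
    finally show ?thesis by (simp add: K_def c2_def sum.reindex[OF inj])
  qed
  have s: "\<forall>(is, js, ks)\<in>K. length is = a \<and> length ks = 0 \<and> sorted is \<and> sorted ks"
    using assms(2) by (auto simp: K_def)
  obtain is0 ks0 where "\<exists>js. (is0, js, ks0) \<in> K"
    and e: "(\<Sum>js | (is0, js, ks0) \<in> K. sc (c2 (is0, js, ks0)) (star_list q (map Gg js))) = 0"
    using leading_block[OF K s z] by blast
  then have "is0 \<in> J" "{js. (is0, js, ks0) \<in> K} = {[]}" by (auto simp: K_def)
  \<comment> \<open>Only the empty js occurs, so the relation left by the leading coefficient is a
    multiple of 1.\<close>
  then have "sc (c is0) one = 0" using e by (simp add: c2_def)
  then have "sc (c is0) one [] = (0 :: 'a vec) []" by (rule fun_cong)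
  then show False using assms(4)[OF \<open>is0 \<in> J\<close>] by (simp add: sc_apply word_def zero_fun_apply)
qed

definition qint_inv :: "nat \<Rightarrow> 'a" where
  "qint_inv n = (\<Sum>i<n. inverse (q\<^sup>2) ^ i)"

lemma qint_inv_Suc: "qint_inv (Suc n) = 1 + inverse (q\<^sup>2) * qint_inv n"
  by (simp add: qint_inv_def sum.lessThan_Suc_shift sum_distrib_left del: sum.lessThan_Suc)

lemma qint_inv_nz: "n > 0 \<Longrightarrow> qint_inv n \<noteq> 0"
proof -
  assume n: "n > 0"
  have "inverse (q\<^sup>2) ^ n \<noteq> 1" using q2_pow_ne[OF n] by (simp add: power_inverse)
  then show ?thesis using power_diff_1_eq[of "inverse (q\<^sup>2)" n] by (auto simp: qint_inv_def)
qed

text \<open>A deleted y turns \<open>Gg (Suc j)\<close> into \<open>Wm j\<close>, which has no word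
  starting with y. So at most one deletion hits this factor, and each later one contributes q^-2;
  the possible positions sum to a Gaussian integer.\<close>

lemma dLY_power: "(dL Y ^^ Suc n) (Gg (Suc j) \<star> f) = Gg (Suc j) \<star> (dL Y ^^ Suc n) f + sc (qint_inv (Suc n)) (Wm j \<star> (dL Y ^^ n) f)"
proof (induction n)
  case 0
  show ?case by (simp add: qint_inv_def add.commute)
next
  case (Suc n)
  have "(dL Y ^^ Suc (Suc n)) (Gg (Suc j) \<star> f) = dL Y ((dL Y ^^ Suc n) (Gg (Suc j) \<star> f))"
    by simp
  also have "\<dots> = Gg (Suc j) \<star> (dL Y ^^ Suc (Suc n)) f + (sc 1 (Wm j \<star> (dL Y ^^ Suc n) f)
      + sc (inverse (q\<^sup>2) * qint_inv (Suc n)) (Wm j \<star> (dL Y ^^ Suc n) f))"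
    unfolding Suc by (simp add: mult.commute add.commute add.left_commute)
  also have "\<dots> = Gg (Suc j) \<star> (dL Y ^^ Suc (Suc n)) f + sc (qint_inv (Suc (Suc n))) (Wm j \<star> (dL Y ^^ Suc n) f)"
    by (simp only: qint_inv_Suc[of "Suc n"] fn.scale_left_distrib)
  finally show ?case .
qed

lemma dLY_power_zero: "(dL Y ^^ n) (0 :: 'a vec) = 0"
  by (induction n) simp_all

text \<open>Each factor absorbs at most one deletion of y, so n deletions kill products of fewer
  than n factors and turn every one of exactly n factors into a \<open>Wm\<close>.\<close>

lemma dLY_Gg:
  "length js \<le> n \<Longrightarrow> (dL Y ^^ n) (star_list q (map (\<lambda>j. Gg (Suc j)) js))
    = (if length js = n then sc (\<Prod>i<n. qint_inv (Suc i)) (star_list q (map Wm js)) else 0)"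
proof (induction js arbitrary: n)
  case Nil
  have "(dL Y ^^ n) (one :: 'a vec) = (if n = 0 then one else 0)"
    by (cases n) (simp_all add: funpow_Suc_right dLY_power_zero del: funpow.simps(2))
  then show ?case by auto
next
  case (Cons j js)
  then obtain m where m: "n = Suc m" "length js \<le> m" by (cases n) auto
  show ?case
    unfolding m(1) list.map star_list_simps dLY_power
    using Cons.IH[of m] Cons.IH[of "Suc m"] m(2) by (simp del: funpow.simps(2))
qed

text \<open>As many deletions of y as the longest product has factors leave a relation between
  products of \<open>Wm\<close>, where independence is known.\<close>

lemma Gg_independent:
  assumes "finite J" "\<And>js. js \<in> J \<Longrightarrow> sorted js"
    and "(\<Sum>js\<in>J. sc (c js) (star_list q (map (\<lambda>j. Gg (Suc j)) js))) = 0" "\<And>js. js \<in> J \<Longrightarrow> c js \<noteq> 0"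
  shows "J = {}"
proof (rule ccontr)
  assume ne: "J \<noteq> {}"
  define p where "p = Max (length ` J)"
  define J' where "J' = {js \<in> J. length js = p}"
  have p: "length js \<le> p" if "js \<in> J" for js using assms(1) that by (simp add: p_def)
  have "p \<in> length ` J" unfolding p_def using assms(1) ne by (intro Max_in) auto
  then have "J' \<noteq> {}" by (auto simp: J'_def)
  have lin: "(dL Y ^^ p) (sum F A) = (\<Sum>i\<in>A. (dL Y ^^ p) (F i))" "(dL Y ^^ p) (sc a f) = sc a ((dL Y ^^ p) f)"
    for F :: "nat list \<Rightarrow> 'a vec" and A and a :: 'a and f
    by (induction p) simp_all
  have "0 = (\<Sum>js\<in>J. sc (c js) ((dL Y ^^ p) (star_list q (map (\<lambda>j. Gg (Suc j)) js))))"
    using arg_cong[OF assms(3), of "dL Y ^^ p"] by (simp add: lin dLY_power_zero)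
  also have "\<dots> = (\<Sum>js\<in>J. if length js = p then sc (c js * (\<Prod>i<p. qint_inv (Suc i))) (star_list q (map Wm js)) else 0)"
    by (intro sum.cong refl) (use p in \<open>simp add: dLY_Gg\<close>)
  also have "\<dots> = (\<Sum>js\<in>J'. sc (c js * (\<Prod>i<p. qint_inv (Suc i))) (star_list q (map Wm js)))"
    unfolding J'_def using assms(1) by (simp add: sum.inter_filter)
  finally have "J' = {}"
    using assms by (intro Wm_independent[where a = p and c = "\<lambda>js. c js * (\<Prod>i<p. qint_inv (Suc i))"]) (auto simp: J'_def qint_inv_nz)
  then show False using \<open>J' \<noteq> {}\<close> by blast
qed

text \<open>The length of is is maximised first, then that of ks among the monomials left. The
  operators for this pair (a, b) kill all other monomials with nonzero coefficient, and the leading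
  block leaves a relation among products of \<open>Gg\<close> alone.\<close>

lemma M_independent:
  assumes fin: "finite K" and srt: "\<And>is js ks. (is, js, ks) \<in> K \<Longrightarrow> sorted is \<and> sorted js \<and> sorted ks"
    and zero: "(\<Sum>(is, js, ks)\<in>K. sc (c (is, js, ks)) (M is (map Suc js) ks)) = 0"
    and x: "x \<in> K"
  shows "c x = 0"
proof (rule ccontr)
  assume "c x \<noteq> 0"
  define K1 where "K1 = {x \<in> K. c x \<noteq> 0}"
  have "x \<in> K1" using x \<open>c x \<noteq> 0\<close> by (simp add: K1_def)
  moreover have "finite K1" using fin by (simp add: K1_def)
  ultimately have K1: "finite K1" "K1 \<noteq> {}" by blast+
  define a where "a = Max ((\<lambda>x. length (fst x)) ` K1)"
  define K2 where "K2 = {x \<in> K1. length (fst x) = a}"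
  have a: "length (fst x) \<le> a" if "x \<in> K1" for x using K1(1) that by (simp add: a_def)
  have "a \<in> (\<lambda>x. length (fst x)) ` K1" unfolding a_def using K1 by (intro Max_in) auto
  then obtain y where "y \<in> K1" "a = length (fst y)" by blast
  then have "y \<in> K2" by (simp add: K2_def)
  then have K2: "finite K2" "K2 \<noteq> {}" using K1(1) by (simp add: K2_def, blast)
  define b where "b = Max ((\<lambda>x. length (snd (snd x))) ` K2)"
  define K3 where "K3 = {x \<in> K2. length (snd (snd x)) = b}"
  have b: "length (snd (snd x)) \<le> b" if "x \<in> K2" for x using K2(1) that by (simp add: b_def)
  have "b \<in> (\<lambda>x. length (snd (snd x))) ` K2" unfolding b_def using K2 by (intro Max_in) auto
  then obtain z where "z \<in> K2" "b = length (snd (snd z))" by blast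
  then have "z \<in> K3" by (simp add: K3_def)
  then have K3: "finite K3" "K3 \<noteq> {}" using K2(1) by (simp add: K3_def, blast)
  define K4 where "K4 = (\<lambda>(is, js, ks). (is, map Suc js, ks)) ` K3"
  have inj: "inj_on (\<lambda>(is, js, ks). (is, map Suc js, ks)) K3"
    by (auto simp: inj_on_def)
  \<comment> \<open>This undoes \<open>map Suc\<close>; K4 contains only shifted lists, so the
    truncated subtraction is exact there.\<close>
  define c' where "c' = (\<lambda>(is, js, ks). c (is, map (\<lambda>j. j - 1) js, ks))"
  have c': "c' (is, map Suc js, ks) = c (is, js, ks)" for "is" js ks
    by (simp add: c'_def comp_def)
  have z: "(\<Sum>(is, js, ks)\<in>K4. sc (c' (is, js, ks)) (star_list q (map (gG_times_coeff \<phi>) is @ map Gg js @ map (gG_times_coeff \<chi>) ks))) = 0" for \<phi> \<chi>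
  proof -
    obtain T where T: "realises T a b (\<lambda>t r. (\<Prod>x\<leftarrow>t. poly \<phi> x) * (\<Prod>x\<leftarrow>r. poly \<chi> x))"
      using realisable_E[OF realisable_poly] .
    have "0 = T (\<Sum>(is, js, ks)\<in>K. sc (c (is, js, ks)) (M is (map Suc js) ks))"
      using zero local_linear_zero[OF realises_local_linear[OF T]] by simp
    also have "\<dots> = (\<Sum>(is, js, ks)\<in>K. sc (c (is, js, ks)) (T (M is (map Suc js) ks)))"
      by (simp add: local_linear_sum[OF realises_local_linear[OF T]] local_linear_sc[OF realises_local_linear[OF T]] case_prod_unfold)
    also have "\<dots> = (\<Sum>(is, js, ks)\<in>K3. sc (c (is, js, ks)) (T (M is (map Suc js) ks)))"
    proof (intro sum.mono_neutral_right fin ballI)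
      show "K3 \<subseteq> K" by (auto simp: K3_def K2_def K1_def)
      fix y assume y: "y \<in> K - K3"
      obtain "is" js ks where yy: "y = (is, js, ks)" by (cases y)
      have "c y = 0 \<or> length is < a \<or> length ks < b"
        using y a[of y] b[of y] by (auto simp: yy K3_def K2_def K1_def le_less)
      then show "(case y of (is, js, ks) \<Rightarrow> sc (c (is, js, ks)) (T (M is (map Suc js) ks))) = 0"
        using M_coefficient_zero[OF T] by (auto simp: yy)
    qed
    also have "\<dots> = (\<Sum>(is, js, ks)\<in>K3. sc (c (is, js, ks)) (star_list q (map (gG_times_coeff \<phi>) is @ map Gg (map Suc js) @ map (gG_times_coeff \<chi>) ks)))"
      by (intro sum.cong refl, clarify, subst M_coefficient_eq[OF T]) (auto simp: K3_def K2_def)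
    finally show ?thesis
      unfolding K4_def by (subst sum.reindex[OF inj]) (simp add: case_prod_unfold c' comp_def)
  qed
  have s: "\<forall>(is, js, ks)\<in>K4. length is = a \<and> length ks = b \<and> sorted is \<and> sorted ks"
    using srt by (auto simp: K4_def K3_def K2_def K1_def)
  have "finite K4" "K4 \<noteq> {}" using K3 by (auto simp: K4_def)
  then obtain is0 ks0 where n: "\<exists>js. (is0, js, ks0) \<in> K4"
    and e: "(\<Sum>js | (is0, js, ks0) \<in> K4. sc (c' (is0, js, ks0)) (star_list q (map Gg js))) = 0"
    using leading_block[OF _ _ s z] by blast
  define J where "J = {js. (is0, js, ks0) \<in> K3}"
  have J: "{js. (is0, js, ks0) \<in> K4} = map Suc ` J" by (auto simp: K4_def J_def intro: rev_image_eqI)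
  have "inj_on (map Suc) J" by (simp add: inj_on_def)
  then have "(\<Sum>js\<in>J. sc (c (is0, js, ks0)) (star_list q (map (\<lambda>j. Gg (Suc j)) js))) = 0"
    using e unfolding J by (simp add: sum.reindex c' comp_def)
  moreover have "J \<subseteq> (\<lambda>x. fst (snd x)) ` K3" unfolding J_def by force
  then have "finite J" using K3(1) finite_subset by blast
  ultimately have "J = {}"
    by (intro Gg_independent[where c = "\<lambda>js. c (is0, js, ks0)"])
      (use srt in \<open>auto simp: J_def K3_def K2_def K1_def\<close>)
  then show False using n J by auto
qed

end

section \<open>The six orders\<close>

fun oclass :: "omega \<Rightarrow> nat" where
  "oclass (Wneg i) = 0"
| "oclass (Gs j) = 1"
| "oclass (Wpos k) = 2"

definition orders :: "(nat \<times> nat \<times> nat) set" where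
  "orders = {(0, 1, 2), (0, 2, 1), (1, 0, 2), (2, 1, 0), (1, 2, 0), (2, 0, 1)}"

definition block :: "nat \<Rightarrow> omega list \<Rightarrow> omega list" where
  "block c as = filter (\<lambda>a. oclass a = c) as"

definition block_prod :: "'a::field \<Rightarrow> nat \<times> nat \<times> nat \<Rightarrow> omega list \<Rightarrow> 'a vec" where
  "block_prod q = (\<lambda>(c1, c2, c3) as. star_list q (map omega_elt (block c1 as @ block c2 as @ block c3 as)))"

lemma block_append: "block c (xs @ ys) = block c xs @ block c ys"
  by (simp add: block_def)

lemma block_maps [simp]:
  "block 0 (map Wneg is) = map Wneg is" "block (Suc 0) (map Wneg is) = []" "block 2 (map Wneg is) = []"
  "block 0 (map Gs is) = []" "block (Suc 0) (map Gs is) = map Gs is" "block 2 (map Gs is) = []"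
  "block 0 (map Wpos is) = []" "block (Suc 0) (map Wpos is) = []" "block 2 (map Wpos is) = map Wpos is"
  by (induction "is") (auto simp: block_def)

lemma has_weight_omega_elt: "\<exists>a. has_weight a (omega_elt x)"
  unfolding omega_elt_def using has_weight_word by blast

section \<open>The grading by word length\<close>

definition homogeneous :: "nat \<Rightarrow> 'a::field vec \<Rightarrow> bool" where
  "homogeneous d f \<longleftrightarrow> (\<forall>w. f w \<noteq> 0 \<longrightarrow> length w = d)"

lemma homogeneous_star: "homogeneous m f \<Longrightarrow> homogeneous n g \<Longrightarrow> homogeneous (m + n) (star q f g)"
proof -
  have "star q f g w \<noteq> 0 \<Longrightarrow> homogeneous m f \<Longrightarrow> homogeneous n g \<Longrightarrow> length w = m + n" for w
  proof (induction w arbitrary: f g m n)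
    case Nil
    then have "f [] \<noteq> 0" "g [] \<noteq> 0" by auto
    then show ?case using Nil by (metis homogeneous_def add_0 list.size(3))
  next
    case (Cons c w)
    from Cons.prems(1) consider "star q (dL c f) g w \<noteq> 0" | "star q (twist q c f) (dL c g) w \<noteq> 0"
      by fastforce
    then show ?case
    proof cases
      case 1
      show ?thesis
      proof (cases m)
        case 0
        then have "dL c f = 0" using Cons.prems(2) by (force simp: homogeneous_def fun_eq_iff vec_apply)
        then show ?thesis using 1 by (simp add: zero_fun_apply)
      next
        case (Suc m')
        then have "homogeneous m' (dL c f)" using Cons.prems(2) by (force simp: homogeneous_def dL_def)
        then show ?thesis using Cons.IH[OF 1] Cons.prems(3) Suc by simp
      qed
    next
      case 2
      show ?thesis
      proof (cases n)
        case 0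
        then have "dL c g = 0" using Cons.prems(3) by (force simp: homogeneous_def fun_eq_iff vec_apply)
        then show ?thesis using 2 by (simp add: zero_fun_apply)
      next
        case (Suc n')
        then have "homogeneous n' (dL c g)" using Cons.prems(3) by (force simp: homogeneous_def dL_def)
        moreover have "homogeneous m (twist q c f)" using Cons.prems(2) by (auto simp: homogeneous_def twist_def)
        ultimately show ?thesis using Cons.IH[OF 2] Suc by simp
      qed
    qed
  qed
  then show "homogeneous m f \<Longrightarrow> homogeneous n g \<Longrightarrow> ?thesis" by (auto simp: homogeneous_def)
qed

lemma homogeneous_star_list: "homogeneous (\<Sum>a\<leftarrow>as. length (omega_word a)) (star_list q (map omega_elt as))"
proof (induction as)
  case Nil
  show ?case by (simp add: homogeneous_def word_def)
next
  case (Cons a as)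
  have "homogeneous (length (omega_word a)) (omega_elt a)" by (simp add: homogeneous_def omega_elt_def word_def)
  then show ?case using homogeneous_star Cons by auto
qed

definition proj :: "nat \<Rightarrow> 'a::field vec \<Rightarrow> 'a vec" where
  "proj d f = (\<lambda>w. if length w = d then f w else 0)"

lemma proj_add: "proj d (f + g) = proj d f + proj d g" and proj_sc: "proj d (sc c f) = sc c (proj d f)"
  and proj_zero: "proj d 0 = 0"
  by (auto simp: proj_def fun_eq_iff vec_apply)

lemma proj_sum: "proj d (sum F A) = (\<Sum>i\<in>A. proj d (F i))"
  by (induction A rule: infinite_finite_induct) (simp_all add: proj_add proj_zero)

lemma proj_homogeneous: "homogeneous e f \<Longrightarrow> proj d f = (if e = d then f else 0)"
  by (auto simp: proj_def homogeneous_def fun_eq_iff zero_fun_apply)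

definition deg :: "omega multiset \<Rightarrow> nat" where
  "deg m = (\<Sum>a\<in>#m. length (omega_word a))"

lemma deg_mset: "deg (mset as) = (\<Sum>a\<leftarrow>as. length (omega_word a))"
  by (simp add: deg_def flip: sum_mset_sum_list)

text \<open>Every word of Omega is nonempty, and its length bounds its index. A given degree thus
  allows boundedly many factors, taken from a finite set.\<close>

lemma finite_deg: "finite {m. deg m = d}"
proof -
  have len: "length (concat (replicate n [a, b])) = 2 * n" for n and a b :: letter
    by (induction n) auto
  define A where "A = Wneg ` {..d} \<union> Gs ` {..d} \<union> Wpos ` {..d}"
  have A: "finite A" by (simp add: A_def)
  have a1: "a \<in> A" if "length (omega_word a) \<le> d" for a
    using that by (cases a) (auto simp: A_def W_neg_word_def W_pos_word_def G_word_def len simp del: replicate_Suc)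
  have pos: "length (omega_word a) > 0" for a
    by (cases a) (auto simp: W_neg_word_def W_pos_word_def G_word_def)
  have "{m. deg m = d} \<subseteq> mset ` {as. set as \<subseteq> A \<and> length as \<le> d}"
  proof
    fix m assume m: "m \<in> {m. deg m = d}"
    obtain as where as: "m = mset as" using ex_mset by metis
    have d: "(\<Sum>a\<leftarrow>as. length (omega_word a)) = d" using m by (simp add: as deg_mset)
    have "length as \<le> (\<Sum>a\<leftarrow>as. length (omega_word a))"
    proof (induction as)
      case (Cons a as)
      then show ?case using pos[of a] by (simp del: length_greater_0_conv)
    qed simp
    moreover have "length (omega_word a) \<le> d" if "a \<in> set as" for a
      unfolding d[symmetric] by (rule member_le_sum_list) (use that in auto)
    ultimately show "m \<in> mset ` {as. set as \<subseteq> A \<and> length as \<le> d}"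
      using a1 d by (auto simp: as)
  qed
  then show ?thesis
    using finite_lists_length_le[OF A, of d] finite_subset by blast
qed

lemma orders_distinct: "(c1, c2, c3) \<in> orders \<Longrightarrow> c1 \<noteq> c2 \<and> c1 \<noteq> c3 \<and> c2 \<noteq> c3"
  by (auto simp: orders_def)

lemma orders_cover: "(c1, c2, c3) \<in> orders \<Longrightarrow> oclass a = c1 \<or> oclass a = c2 \<or> oclass a = c3"
  by (cases a) (auto simp: orders_def)

lemma mset_blocks:
  assumes "(c1, c2, c3) \<in> orders"
  shows "mset (block c1 as @ block c2 as @ block c3 as) = mset as"
proof (induction as)
  case (Cons a as)
  then show ?case
    using orders_distinct[OF assms] orders_cover[OF assms, of a] by (auto simp: block_def)
qed (simp add: block_def)

text \<open>For an earlier a and a later b the two implications exclude exactly the pairs of classes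
  in the wrong order: (c2, c1), (c3, c1) and (c3, c2).\<close>

lemma sorted_blocks:
  assumes "sorted_wrt (\<lambda>a b. (oclass b = c1 \<longrightarrow> oclass a = c1) \<and> (oclass a = c3 \<longrightarrow> oclass b = c3)) as"
    and "(c1, c2, c3) \<in> orders"
  shows "block c1 as @ block c2 as @ block c3 as = as"
  using assms(1)
proof (induction as)
  case (Cons a as)
  have IH: "block c1 as @ block c2 as @ block c3 as = as" using Cons by simp
  have ne: "c1 \<noteq> c2" "c1 \<noteq> c3" "c2 \<noteq> c3" using orders_distinct[OF assms(2)] by auto
  consider "oclass a = c1" | "oclass a = c2" | "oclass a = c3"
    using orders_cover[OF assms(2)] by blast
  then show ?case
  proof cases
    case 1
    then show ?thesis using IH ne by (simp add: block_def)
  next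
    case 2
    then have "block c1 as = []" using Cons.prems ne by (auto simp: block_def filter_empty_conv)
    then show ?thesis using IH ne 2 by (simp add: block_def)
  next
    case 3
    then have "block c1 as = []" "block c2 as = []" using Cons.prems ne by (auto simp: block_def filter_empty_conv)
    then show ?thesis using IH ne 3 by (simp add: block_def)
  qed
qed (simp add: block_def)

section \<open>Spanning for all six orders\<close>

context qshuffle
begin

lemma star_list_map: "star_list q (map F xs) = foldr (\<lambda>x f. F x \<star> f) xs one"
  by (induction xs) simp_all

lemma omega_commute: "oclass a = oclass b \<Longrightarrow> omega_elt a \<star> omega_elt b = omega_elt b \<star> (omega_elt a :: 'a vec)"
  by (cases a; cases b) (simp_all add: Wm_commute Gg_commute Wp_commute)

lemma star_list_block_perm:
  assumes "mset as = mset bs"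
  shows "star_list q (map omega_elt (block c as)) = star_list q (map omega_elt (block c bs))"
proof -
  have m: "mset (rev (block c as)) = mset (rev (block c bs))"
    using assms by (simp add: block_def mset_filter)
  have "fold (\<lambda>x f. omega_elt x \<star> f) (rev (block c as)) = fold (\<lambda>x f. omega_elt x \<star> f) (rev (block c bs))"
  proof (rule fold_multiset_equiv[OF _ m])
    fix a b assume "a \<in> set (rev (block c as))" "b \<in> set (rev (block c as))"
    then have "oclass a = oclass b" by (simp add: block_def)
    then have "omega_elt a \<star> omega_elt b \<star> f = omega_elt b \<star> omega_elt a \<star> (f :: 'a vec)" for f
      by (metis omega_commute star_assoc)
    then show "(\<star>) (omega_elt a) \<circ> (\<star>) (omega_elt b) = (\<star>) (omega_elt b) \<circ> (\<star>) (omega_elt a :: 'a vec)"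
      by (intro ext) (simp only: comp_apply)
  qed
  then show ?thesis by (simp only: star_list_map foldr_conv_fold)
qed

lemma block_prod_perm: "mset as = mset bs \<Longrightarrow> block_prod q cs as = block_prod q cs bs"
  using star_list_block_perm[of as bs] by (cases cs) (simp add: block_prod_def star_list_append)

lemma block_prod_homogeneous: "cs \<in> orders \<Longrightarrow> homogeneous (deg (mset as)) (block_prod q cs as)"
proof -
  assume cs: "cs \<in> orders"
  obtain c1 c2 c3 where c: "cs = (c1, c2, c3)" by (cases cs)
  have "mset (block c1 as @ block c2 as @ block c3 as) = mset as"
    using mset_blocks cs unfolding c by blast
  then have "deg (mset as) = (\<Sum>a\<leftarrow>block c1 as @ block c2 as @ block c3 as. length (omega_word a))"
    by (metis deg_mset)
  then show ?thesis unfolding c block_prod_def by (simp only: prod.case homogeneous_star_list)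
qed

lemma block_prod_in_U: "block_prod q cs as \<in> U_alg q"
  by (cases cs) (simp only: block_prod_def prod.case star_list_omega_in_U)

lemma blocks_exist:
  "\<exists>as. star_list q (map omega_elt (block 0 as)) = star_list q (map Wm is) \<and> star_list q (map omega_elt (block 1 as)) = star_list q (map Gg js)
    \<and> star_list q (map omega_elt (block 2 as)) = star_list q (map Wp ks)"
proof -
  \<comment> \<open>Entries 0 of js stand for the factor 1, which is not in Omega; they are dropped,
    and the others are lowered because \<open>Gs j\<close> is G_{j+1}.\<close>
  define js' where "js' = map (\<lambda>j. j - 1) (filter (\<lambda>j. j \<noteq> 0) js)"
  have "star_list q (map (\<lambda>j. Gg (Suc j)) js') = star_list q (map Gg js)"
    unfolding js'_def by (induction js) auto
  then show ?thesis
    by (intro exI[of _ "map Wneg is @ map Gs js' @ map Wpos ks"]) (simp add: block_append comp_def)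
qed

text \<open>One factor A is carried through a product of C at a time. Each exchange may change its
  index, so the index is arbitrary in the induction.\<close>

lemma swap_blocks:
  fixes A C :: "nat \<Rightarrow> 'a vec"
  assumes swap: "\<And>k l. A k \<star> C l \<in> fn.span {C b \<star> A a |a b. a + b = k + l}"
  shows "star_list q (map A xs) \<star> star_list q (map C ys) \<in> fn.span {star_list q (map C ys) \<star> star_list q (map A xs) |xs ys. True}"
proof -
  let ?V = "fn.span {star_list q (map C ys) \<star> star_list q (map A xs) |xs ys. True}"
  have base: "star_list q (map C ys) \<star> star_list q (map A xs) \<in> ?V" for xs ys
    by (blast intro: fn.span_base)
  have C: "C b \<star> f \<in> ?V" if "f \<in> ?V" for b f
    using that
  proof (rule span_closed_right[OF _ fn.subspace_span])
    fix g assume "g \<in> {star_list q (map C ys) \<star> star_list q (map A xs) |xs ys. True}"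
    then obtain xs ys where "g = star_list q (map C ys) \<star> star_list q (map A xs)" by blast
    then show "C b \<star> g \<in> ?V" using base[of "b # ys" xs] by (simp add: star_assoc)
  qed
  have A0: "A k \<star> star_list q (map C ys) \<star> star_list q (map A xs) \<in> ?V" for k xs ys
  proof (induction ys arbitrary: k)
    case Nil
    show ?case using base[of "[]" "k # xs"] by simp
  next
    case (Cons y ys)
    have "(A k \<star> C y) \<star> (star_list q (map C ys) \<star> star_list q (map A xs)) \<in> ?V"
    proof (rule span_closed_left[OF swap fn.subspace_span])
      fix g assume "g \<in> {C b \<star> A a |a b. a + b = k + y}"
      then obtain a b where "g = C b \<star> A a" by blast
      then show "g \<star> (star_list q (map C ys) \<star> star_list q (map A xs)) \<in> ?V"
        using C[OF Cons[of a]] by (simp add: star_assoc)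
    qed
    then show ?case by (simp add: star_assoc)
  qed
  have A1: "A k \<star> f \<in> ?V" if "f \<in> ?V" for k f
    using that by (rule span_closed_right[OF _ fn.subspace_span]) (use A0 in auto)
  show ?thesis
  proof (induction xs)
    case Nil
    show ?case using base[of ys "[]"] by simp
  next
    case (Cons x xs)
    then show ?case using A1[OF Cons, of x] by (simp add: star_assoc)
  qed
qed

text \<open>In these orders W_- stays before W_+, so only the block of G has to move, past one
  neighbouring block.\<close>

lemma U_span_block_prod_half:
  assumes "cs \<in> {(0, 1, 2), (0, 2, 1), (1, 0, 2)}"
  shows "U_alg q \<subseteq> fn.span (range (block_prod q cs))"
proof -
  let ?V = "fn.span (range (block_prod q cs))"
  have "M is js ks \<in> ?V" for "is" js ks
  proof -
    have M: "M is js ks = star_list q (map Wm is) \<star> star_list q (map Gg js) \<star> star_list q (map Wp ks)"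
      by (simp add: M_def star_list_append)
    consider "cs = (0, 1, 2)" | "cs = (0, 2, 1)" | "cs = (1, 0, 2)" using assms by auto
    then show ?thesis
    proof cases
      case 1
      obtain as where "star_list q (map omega_elt (block 0 as)) = star_list q (map Wm is)" "star_list q (map omega_elt (block 1 as)) = star_list q (map Gg js)"
        "star_list q (map omega_elt (block 2 as)) = star_list q (map Wp ks)" using blocks_exist by blast
      then have "block_prod q cs as = M is js ks" by (simp add: block_prod_def 1 M star_list_append)
      then show ?thesis by (metis fn.span_base rangeI)
    next
      case 2
      have "star_list q (map Wm is) \<star> (star_list q (map Gg js) \<star> star_list q (map Wp ks)) \<in> ?V"
      proof (rule span_closed_right[OF swap_blocks[OF _, of Gg Wp js ks] fn.subspace_span])
        show "Gg k \<star> Wp l \<in> fn.span {Wp b \<star> Gg a |a b. a + b = k + l}" for k l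
        proof -
          have "{Wp a \<star> Gg b |a b. a + b = l + k} \<subseteq> {Wp b \<star> Gg a |a b. a + b = k + l}"
            by (clarsimp, intro exI conjI, rule refl, simp)
          then show ?thesis using Gg_Wp_span[of k l] fn.span_mono by blast
        qed
        fix g :: "'a vec" assume "g \<in> {star_list q (map Wp ys) \<star> star_list q (map Gg xs) |xs ys. True}"
        then obtain xs ys where g: "g = star_list q (map Wp ys) \<star> star_list q (map Gg xs)" by blast
        obtain as where "star_list q (map omega_elt (block 0 as)) = star_list q (map Wm is)" "star_list q (map omega_elt (block 1 as)) = star_list q (map Gg xs)"
          "star_list q (map omega_elt (block 2 as)) = star_list q (map Wp ys)" using blocks_exist by blast
        then have "block_prod q cs as = star_list q (map Wm is) \<star> g" by (simp add: block_prod_def 2 g star_list_append)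
        then show "star_list q (map Wm is) \<star> g \<in> ?V" by (metis fn.span_base rangeI)
      qed
      then show ?thesis by (simp add: M)
    next
      case 3
      have "(star_list q (map Wm is) \<star> star_list q (map Gg js)) \<star> star_list q (map Wp ks) \<in> ?V"
      proof (rule span_closed_left[OF swap_blocks[OF Wm_Gg_span, of "is" js] fn.subspace_span])
        fix g :: "'a vec" assume "g \<in> {star_list q (map Gg ys) \<star> star_list q (map Wm xs) |xs ys. True}"
        then obtain xs ys where g: "g = star_list q (map Gg ys) \<star> star_list q (map Wm xs)" by blast
        obtain as where "star_list q (map omega_elt (block 0 as)) = star_list q (map Wm xs)" "star_list q (map omega_elt (block 1 as)) = star_list q (map Gg ys)"
          "star_list q (map omega_elt (block 2 as)) = star_list q (map Wp ks)" using blocks_exist by blast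
        then have "block_prod q cs as = g \<star> star_list q (map Wp ks)" by (simp add: block_prod_def 3 g star_list_append star_assoc)
        then show "g \<star> star_list q (map Wp ks) \<in> ?V" by (metis fn.span_base rangeI)
      qed
      then show ?thesis by (simp add: M star_assoc)
    qed
  qed
  then have "{M is js ks |is js ks. True} \<subseteq> ?V" by blast
  then show ?thesis using U_subset_M fn.span_minimal[OF _ fn.subspace_span] by blast
qed

lemma qshuffle_inverse: "qshuffle (inverse q)"
proof
  show "inverse q \<noteq> 0" using q_nz by simp
  show "inverse q ^ n \<noteq> 1" if "n > 0" for n
    using q_nru[OF that] by (simp add: power_inverse)
qed

lemma star_list_inverse:
  assumes "\<forall>f\<in>set fs. \<exists>a. has_weight a f"
  shows "(\<exists>a. has_weight a (star_list q fs)) \<and> (\<exists>c. c \<noteq> 0 \<and> star_list q fs = sc c (star_list (inverse q) (rev fs)))"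
  using assms
proof (induction fs)
  case Nil
  then show ?case using has_weight_one by (auto intro: exI[of _ 1])
next
  case (Cons f fs)
  interpret iq: qshuffle "inverse q" by (rule qshuffle_inverse)
  obtain a where a: "has_weight a f" using Cons.prems by auto
  obtain b c where b: "has_weight b (star_list q fs)" and c: "c \<noteq> 0" "star_list q fs = sc c (star_list (inverse q) (rev fs))"
    using Cons by auto
  have "star_list q (f # fs) = sc (q powi (2 * a * b)) (star (inverse q) (star_list q fs) f)"
    using star_inverse[OF a b] by simp
  also have "\<dots> = sc (q powi (2 * a * b) * c) (star_list (inverse q) (rev (f # fs)))"
    by (simp add: c(2) iq.star_list_append)
  finally have "star_list q (f # fs) = sc (q powi (2 * a * b) * c) (star_list (inverse q) (rev (f # fs)))" .
  moreover have "q powi (2 * a * b) * c \<noteq> 0" using c(1) q_nz by simp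
  moreover have "has_weight (a + b) (star_list q (f # fs))" using has_weight_star[OF a b] by simp
  ultimately show ?case by blast
qed

text \<open>For weight vectors the two products agree up to order and a scalar. Hence the span of
  the weight vectors in the subalgebra for \<open>inverse q\<close> contains 1 and is stable under
  left multiplication by x and y with respect to the product for q.\<close>

lemma U_inverse: "U_alg q \<subseteq> U_alg (inverse q)"
proof -
  interpret iq: qshuffle "inverse q" by (rule qshuffle_inverse)
  let ?T = "fn.span {f \<in> U_alg (inverse q). \<exists>a. has_weight a f}"
  have left: "x \<star> g \<in> ?T" if x: "x \<in> U_alg (inverse q)" "has_weight a x" and g: "g \<in> ?T" for x g a
    using g
  proof (rule span_closed_right[OF _ fn.subspace_span])
    fix f assume "f \<in> {f \<in> U_alg (inverse q). \<exists>a. has_weight a f}"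
    then obtain b where f: "f \<in> U_alg (inverse q)" "has_weight b f" by blast
    have "x \<star> f \<in> U_alg (inverse q)"
      unfolding star_inverse[OF x(2) f(2)] by (intro U_sc U_star f x)
    then show "x \<star> f \<in> ?T" using has_weight_star[OF x(2) f(2)] by (blast intro: fn.span_base)
  qed
  have "U_alg q \<subseteq> ?T"
  proof (rule U_subset[OF fn.subspace_span])
    show "one \<in> ?T" using U_alg.one has_weight_one by (blast intro: fn.span_base)
  qed (use left iq.alternating_in_U has_weight_Wm has_weight_Wp in blast)+
  also have "?T \<subseteq> U_alg (inverse q)"
    by (rule fn.span_minimal[OF _ U_subspace]) blast
  finally show ?thesis .
qed

lemma U_span_block_prod:
  assumes "cs \<in> orders"
  shows "U_alg q \<subseteq> fn.span (range (block_prod q cs))"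
proof (cases "cs \<in> {(0, 1, 2), (0, 2, 1), (1, 0, 2)}")
  case True
  then show ?thesis by (rule U_span_block_prod_half)
next
  case False
  interpret iq: qshuffle "inverse q" by (rule qshuffle_inverse)
  obtain c1 c2 c3 where c: "cs = (c1, c2, c3)" by (cases cs)
  have c': "(c3, c2, c1) \<in> {(0, 1, 2), (0, 2, 1), (1, 0, 2)}"
    using assms False by (auto simp: c orders_def)
  have "block_prod (inverse q) (c3, c2, c1) as \<in> fn.span (range (block_prod q cs))" for as
  proof -
    have "\<forall>f\<in>set (map omega_elt (block c3 as @ block c2 as @ block c1 as)). \<exists>a. has_weight a (f :: 'a vec)"
      using has_weight_omega_elt by auto
    then obtain x where "block_prod (inverse q) (c3, c2, c1) as
      = sc x (star_list q (rev (map omega_elt (block c3 as @ block c2 as @ block c1 as))))"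
      using iq.star_list_inverse unfolding block_prod_def prod.case inverse_inverse_eq by blast
    also have "rev (map omega_elt (block c3 as @ block c2 as @ block c1 as))
      = map omega_elt (block c1 (rev as) @ block c2 (rev as) @ block c3 (rev as))"
      by (simp add: block_def rev_map rev_filter)
    finally have "block_prod (inverse q) (c3, c2, c1) as = sc x (block_prod q cs (rev as))"
      by (simp add: c block_prod_def)
    then show ?thesis by (simp add: fn.span_scale fn.span_base)
  qed
  then have "fn.span (range (block_prod (inverse q) (c3, c2, c1))) \<subseteq> fn.span (range (block_prod q cs))"
    by (intro fn.span_minimal fn.subspace_span) auto
  then show ?thesis using U_inverse iq.U_span_block_prod_half[OF c'] by blast
qed

section \<open>Independence for all six orders\<close>

definition pbw_elt :: "nat \<times> nat \<times> nat \<Rightarrow> omega multiset \<Rightarrow> 'a vec" where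
  "pbw_elt cs m = block_prod q cs (SOME as. mset as = m)"

text \<open>Elements of one class commute, so a block product depends only on the multiset of its
  factors. Multisets are the common index set of the six families.\<close>

lemma pbw_elt_mset: "pbw_elt cs (mset as) = block_prod q cs as"
  unfolding pbw_elt_def by (rule block_prod_perm) (rule someI_ex, blast)

lemma range_pbw_elt: "range (pbw_elt cs) = range (block_prod q cs)"
proof
  show "range (pbw_elt cs) \<subseteq> range (block_prod q cs)" by (auto simp: pbw_elt_def)
  show "range (block_prod q cs) \<subseteq> range (pbw_elt cs)" by (metis pbw_elt_mset image_subsetI rangeI)
qed

lemma pbw_elt_homogeneous: "cs \<in> orders \<Longrightarrow> homogeneous (deg m) (pbw_elt cs m)"
  by (metis block_prod_homogeneous pbw_elt_mset ex_mset)

lemma pbw_elt_independent_first: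
  assumes fin: "finite F" and zero: "(\<Sum>m\<in>F. sc (c m) (pbw_elt (0, 1, 2) m)) = 0" and m: "m \<in> F"
  shows "c m = 0"
proof -
  define lst where "lst = (\<lambda>(is, js, ks). map Wneg is @ map Gs js @ map Wpos ks)"
  have ex: "\<exists>is js ks. sorted is \<and> sorted js \<and> sorted ks \<and> mset (lst (is, js, ks)) = m" for m
  proof (induction m)
    case empty
    show ?case by (intro exI[of _ "[]"]) (simp add: lst_def)
  next
    case (add a m)
    then obtain "is" js ks where *: "sorted is" "sorted js" "sorted ks" "mset (lst (is, js, ks)) = m" by blast
    show ?case
    proof (cases a)
      case (Wneg i)
      show ?thesis
        by (rule exI[of _ "insort i is"], rule exI[of _ js], rule exI[of _ ks])
          (use * in \<open>auto simp: lst_def Wneg sorted_insort\<close>)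
    next
      case (Gs i)
      show ?thesis
        by (rule exI[of _ "is"], rule exI[of _ "insort i js"], rule exI[of _ ks])
          (use * in \<open>auto simp: lst_def Gs sorted_insort\<close>)
    next
      case (Wpos i)
      show ?thesis
        by (rule exI[of _ "is"], rule exI[of _ js], rule exI[of _ "insort i ks"])
          (use * in \<open>auto simp: lst_def Wpos sorted_insort\<close>)
    qed
  qed
  have "\<forall>m. \<exists>x. sorted (fst x) \<and> sorted (fst (snd x)) \<and> sorted (snd (snd x)) \<and> mset (lst x) = m"
    using ex by (metis fst_conv snd_conv)
  then obtain tr where tr: "\<And>m. sorted (fst (tr m)) \<and> sorted (fst (snd (tr m))) \<and> sorted (snd (snd (tr m)))"
    "\<And>m. mset (lst (tr m)) = m"
    by metis
  have inj: "inj_on tr F" by (metis inj_onI tr(2))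
  have VM: "pbw_elt (0, 1, 2) (mset (lst (is, js, ks))) = M is (map Suc js) ks" for "is" js ks
    unfolding pbw_elt_mset by (simp add: block_prod_def lst_def block_append M_def comp_def)
  have "(\<Sum>(is, js, ks)\<in>tr ` F. sc (c (mset (lst (is, js, ks)))) (M is (map Suc js) ks)) = 0"
    using zero tr(2) by (simp add: sum.reindex[OF inj] case_prod_unfold flip: VM)
  then have "c (mset (lst (tr m))) = 0"
    by (rule M_independent[where c = "\<lambda>x. c (mset (lst x))", rotated 2]) (use fin m tr(1) in auto, (metis fst_conv snd_conv tr(1))+)
  then show ?thesis by (simp add: tr(2))
qed

text \<open>In degree d both families have the same finite index set D. The first is independent and
  lies in the span of the second, so the second cannot be spanned by fewer than
  \<open>card D\<close> vectors; a repetition or a linear dependence would allow exactly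
  that.\<close>

lemma pbw_elt_degree_independent:
  assumes cs: "cs \<in> orders"
  shows "inj_on (pbw_elt cs) {m. deg m = d} \<and> fn.independent (pbw_elt cs ` {m. deg m = d})"
proof -
  define D where "D = {m. deg m = d}"
  define u where "u = pbw_elt (0, 1, 2)"
  have fin: "finite D" by (simp add: D_def finite_deg)
  have u0: "(0, 1, 2) \<in> orders" by (simp add: orders_def)
  have inj: "inj_on u D"
  proof (rule inj_onI, rule ccontr)
    fix m n assume "m \<in> D" "n \<in> D" "u m = u n" "m \<noteq> n"
    then have "(\<Sum>x\<in>{m, n}. sc (if x = m then 1 else -1) (u x)) = 0" by simp
    then have "(if m = m then 1 else -1 :: 'a) = 0"
      unfolding u_def by (rule pbw_elt_independent_first[rotated]) simp_all
    then show False by simp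
  qed
  have ind: "fn.independent (u ` D)"
    unfolding fn.dependent_explicit
  proof clarify
    fix S c v assume S: "finite S" "S \<subseteq> u ` D" "v \<in> S" "c v \<noteq> 0" "(\<Sum>v\<in>S. sc (c v) v) = 0"
    obtain F where F: "F \<subseteq> D" "S = u ` F" using S(2) by (meson subset_imageE)
    have "inj_on u F" using inj F(1) inj_on_subset by blast
    then have "(\<Sum>m\<in>F. sc (c (u m)) (u m)) = 0" using S(5) by (simp add: F(2) sum.reindex)
    moreover have "finite F" using F(1) fin finite_subset by blast
    moreover obtain m where "m \<in> F" "v = u m" using S(3) F(2) by blast
    ultimately show False using pbw_elt_independent_first[of F "\<lambda>m. c (u m)" m] S(4) by (simp add: u_def)
  qed
  have span: "u m \<in> fn.span (pbw_elt cs ` D)" if m: "m \<in> D" for m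
  proof -
    have "u m \<in> U_alg q" unfolding u_def by (simp add: pbw_elt_def block_prod_in_U)
    then have "u m \<in> fn.span (range (pbw_elt cs))" using U_span_block_prod[OF cs] range_pbw_elt by auto
    \<comment> \<open>Spanning is known for all degrees together. All vectors are homogeneous, so
      projecting to length d leaves only those indexed by D.\<close>
    then have "proj d (u m) \<in> fn.span (pbw_elt cs ` D)"
    proof (rule span_closed[OF _ fn.subspace_span _ proj_add proj_sc proj_zero])
      fix b assume "b \<in> range (pbw_elt cs)"
      then obtain n where b: "b = pbw_elt cs n" by blast
      show "proj d b \<in> fn.span (pbw_elt cs ` D)"
        unfolding b proj_homogeneous[OF pbw_elt_homogeneous[OF cs]] by (simp add: fn.span_zero) (simp add: D_def fn.span_base)
    qed
    moreover have "proj d (u m) = u m"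
      using proj_homogeneous[OF pbw_elt_homogeneous[OF u0, of m], of d] m by (simp add: u_def D_def)
    ultimately show ?thesis by simp
  qed
  have bound: "card D \<le> card T" if "finite T" "pbw_elt cs ` D \<subseteq> fn.span T" for T
  proof -
    have "u ` D \<subseteq> fn.span T"
      using span fn.span_minimal[OF that(2) fn.subspace_span] by blast
    then have "card (u ` D) \<le> card T" using fn.independent_span_bound[OF that(1) ind] by blast
    then show ?thesis using card_image[OF inj] by simp
  qed
  have "card D \<le> card (pbw_elt cs ` D)"
    by (rule bound[OF _ fn.span_superset]) (use fin in simp)
  then have c: "card (pbw_elt cs ` D) = card D" using card_image_le[OF fin, of "pbw_elt cs"] by simp
  then have "inj_on (pbw_elt cs) D" using eq_card_imp_inj_on[OF fin] by blast
  moreover have "fn.independent (pbw_elt cs ` D)"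
  proof
    assume "fn.dependent (pbw_elt cs ` D)"
    then obtain b where b: "b \<in> pbw_elt cs ` D" "b \<in> fn.span (pbw_elt cs ` D - {b})" unfolding fn.dependent_def by blast
    have "pbw_elt cs ` D \<subseteq> fn.span (pbw_elt cs ` D - {b})"
    proof
      fix x assume "x \<in> pbw_elt cs ` D"
      then show "x \<in> fn.span (pbw_elt cs ` D - {b})" using b(2) by (cases "x = b") (auto intro: fn.span_base)
    qed
    then have "card D \<le> card (pbw_elt cs ` D - {b})" using fin by (intro bound) auto
    moreover have "card (pbw_elt cs ` D - {b}) < card (pbw_elt cs ` D)"
      using b(1) fin by (intro psubset_card_mono) auto
    ultimately show False using c by simp
  qed
  ultimately show ?thesis by (simp add: D_def)
qed

lemma pbw_elt_independent:
  assumes cs: "cs \<in> orders" and fin: "finite F" and zero: "(\<Sum>m\<in>F. sc (c m) (pbw_elt cs m)) = 0" and m: "m \<in> F"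
  shows "c m = 0"
proof -
  define D where "D = {n \<in> F. deg n = deg m}"
  have "0 = proj (deg m) (\<Sum>n\<in>F. sc (c n) (pbw_elt cs n))" by (simp add: zero proj_zero)
  also have "\<dots> = (\<Sum>n\<in>F. if deg n = deg m then sc (c n) (pbw_elt cs n) else 0)"
    unfolding proj_sum proj_sc proj_homogeneous[OF pbw_elt_homogeneous[OF cs]] by (intro sum.cong) auto
  also have "\<dots> = (\<Sum>n\<in>D. sc (c n) (pbw_elt cs n))"
    unfolding D_def using fin by (simp add: sum.inter_filter)
  finally have s: "(\<Sum>n\<in>D. sc (c n) (pbw_elt cs n)) = 0" by simp
  have D: "D \<subseteq> {n. deg n = deg m}" "m \<in> D" "finite D" using m fin by (auto simp: D_def)
  have inj: "inj_on (pbw_elt cs) D"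
    using pbw_elt_degree_independent[OF cs, of "deg m"] D(1) inj_on_subset by blast
  define g where "g v = c (the_inv_into D (pbw_elt cs) v)" for v
  have g: "g (pbw_elt cs n) = c n" if "n \<in> D" for n
    using that by (simp add: g_def the_inv_into_f_f[OF inj])
  have "(\<Sum>v\<in>pbw_elt cs ` D. sc (g v) v) = 0"
    using s by (simp add: sum.reindex[OF inj] g)
  then have "g (pbw_elt cs m) = 0"
    using pbw_elt_degree_independent[OF cs, of "deg m"] D
    by (intro fn.independentD[of "pbw_elt cs ` {n. deg n = deg m}" "pbw_elt cs ` D" g]) auto
  then show ?thesis using g D(2) by simp
qed

end

section \<open>Sorted lists, multisets and admissible orders\<close>

lemma insert_sorted_wrt:
  assumes "linear_order_on UNIV r" "sorted_wrt (\<lambda>a b. (a, b) \<in> r) as"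
  shows "\<exists>bs. mset bs = add_mset a (mset as) \<and> sorted_wrt (\<lambda>a b. (a, b) \<in> r) bs"
  using assms(2)
proof (induction as)
  case Nil
  show ?case by (intro exI[of _ "[a]"]) simp
next
  case (Cons b as)
  have r: "refl r" "trans r" "total r"
    using assms(1) by (auto simp: linear_order_on_def partial_order_on_def preorder_on_def)
  show ?case
  proof (cases "(a, b) \<in> r")
    case True
    then show ?thesis
      using Cons.prems r(2) by (intro exI[of _ "a # b # as"]) (auto dest: transD)
  next
    case False
    then have ba: "(b, a) \<in> r" using r(1,3) by (metis UNIV_I reflD total_on_def)
    obtain bs where bs: "mset bs = add_mset a (mset as)" "sorted_wrt (\<lambda>a b. (a, b) \<in> r) bs"
      using Cons by auto
    have "set bs = insert a (set as)" using bs(1) by (metis set_mset_add_mset_insert set_mset_mset)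
    then show ?thesis
      using bs Cons.prems ba by (intro exI[of _ "b # bs"]) auto
  qed
qed

text \<open>Totality of r gives a sorted arrangement of each multiset, antisymmetry its
  uniqueness.\<close>

lemma pbw_index_mset:
  assumes "linear_order_on UNIV r"
  shows "mset ` pbw_index r = UNIV" "inj_on mset (pbw_index r)"
proof -
  have "m \<in> mset ` pbw_index r" for m
  proof (induction m)
    case empty
    show ?case by (auto simp: pbw_index_def intro: image_eqI[of _ _ "[]"])
  next
    case (add a m)
    then obtain as where as: "mset as = m" "as \<in> pbw_index r" by blast
    then show ?case using insert_sorted_wrt[OF assms, of as a] unfolding pbw_index_def
      by (metis image_eqI mem_Collect_eq)
  qed
  then show "mset ` pbw_index r = UNIV" by blast
  have anti: "antisym r" using assms by (auto simp: linear_order_on_def partial_order_on_def)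
  show "inj_on mset (pbw_index r)"
  proof (rule inj_onI)
    fix xs ys assume "xs \<in> pbw_index r" "ys \<in> pbw_index r" "mset xs = mset ys"
    then show "xs = ys"
    proof (induction xs arbitrary: ys)
      case (Cons x xs)
      then obtain y zs where ys: "ys = y # zs" by (cases ys) auto
      have "x = y"
      proof (rule ccontr)
        assume "x \<noteq> y"
        have "set (x # xs) = set (y # zs)" using Cons.prems(3) unfolding ys by (rule mset_eq_setD)
        then have "x \<in> set zs" "y \<in> set xs" using \<open>x \<noteq> y\<close> by auto
        then have "(y, x) \<in> r" "(x, y) \<in> r" using Cons.prems(1,2) by (auto simp: pbw_index_def ys)
        then show False using anti \<open>x \<noteq> y\<close> by (auto dest: antisymD)
      qed
      then show ?case using Cons by (auto simp: pbw_index_def ys)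
    qed simp
  qed
qed

text \<open>Antisymmetry excludes from r every pair whose classes stand in the wrong order; the two
  implications express this in one form for the six conditions.\<close>

lemma admissible_blocks:
  assumes "linear_order_on UNIV r" "admissible_order r"
  obtains c1 c2 c3 where "(c1, c2, c3) \<in> orders" and
    "\<And>a b. (a, b) \<in> r \<Longrightarrow> (oclass b = c1 \<longrightarrow> oclass a = c1) \<and> (oclass a = c3 \<longrightarrow> oclass b = c3)"
proof -
  have anti: "antisym r" and tr: "trans r"
    using assms(1) by (auto simp: linear_order_on_def partial_order_on_def preorder_on_def)
  have asym: "(b, a) \<notin> r" if "lt_rel r a b" for a b
    using that anti by (auto simp: lt_rel_def dest: antisymD)
  have lt_trans: "lt_rel r a c" if "lt_rel r a b" "lt_rel r b c" for a b c
    using that anti tr unfolding lt_rel_def by (metis antisymD transD)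
  have main: "(oclass b = c1 \<longrightarrow> oclass a = c1) \<and> (oclass a = c3 \<longrightarrow> oclass b = c3)"
    if ord: "(c1, c2, c3) \<in> orders"
      and lt: "\<forall>a b. oclass a = c1 \<longrightarrow> oclass b = c2 \<longrightarrow> lt_rel r a b" "\<forall>a b. oclass a = c2 \<longrightarrow> oclass b = c3 \<longrightarrow> lt_rel r a b"
      and ex: "\<exists>b. oclass b = c2" and ab: "(a, b) \<in> r"
    for a b c1 c2 c3
  proof -
    \<comment> \<open>The conditions compare neighbouring classes; an element of the middle class
      links the outer two by transitivity.\<close>
    have "lt_rel r x y" if "oclass x = c1" "oclass y = c3" for x y
      using ex lt lt_trans that by blast
    then show ?thesis
      using ab asym lt orders_cover[OF ord, of a] orders_cover[OF ord, of b] by blast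
  qed
  have cls: "oclass a = 0 \<longleftrightarrow> (\<exists>i. a = Wneg i)" "oclass a = 1 \<longleftrightarrow> (\<exists>i. a = Gs i)" "oclass a = 2 \<longleftrightarrow> (\<exists>i. a = Wpos i)" for a
    by (cases a; simp)+
  have ex: "\<exists>b. oclass b = 0" "\<exists>b. oclass b = 1" "\<exists>b. oclass b = 2"
    unfolding cls by blast+
  from assms(2) consider
      "\<forall>i j k. lt_rel r (Wneg i) (Gs j) \<and> lt_rel r (Gs j) (Wpos k)"
    | "\<forall>i j k. lt_rel r (Wpos k) (Gs j) \<and> lt_rel r (Gs j) (Wneg i)"
    | "\<forall>i j k. lt_rel r (Wpos k) (Wneg i) \<and> lt_rel r (Wneg i) (Gs j)"
    | "\<forall>i j k. lt_rel r (Wneg i) (Wpos k) \<and> lt_rel r (Wpos k) (Gs j)"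
    | "\<forall>i j k. lt_rel r (Gs j) (Wpos k) \<and> lt_rel r (Wpos k) (Wneg i)"
    | "\<forall>i j k. lt_rel r (Gs j) (Wneg i) \<and> lt_rel r (Wneg i) (Wpos k)"
    unfolding admissible_order_def by blast
  then show thesis
  proof cases
    case 1
    show thesis
    proof (rule that)
      show ord: "(0, 1, 2) \<in> orders" by (simp add: orders_def)
      show "(oclass b = 0 \<longrightarrow> oclass a = 0) \<and> (oclass a = 2 \<longrightarrow> oclass b = 2)" if "(a, b) \<in> r" for a b
        by (rule main[OF ord _ _ _ that]) (use 1 ex in \<open>auto simp only: cls\<close>)
    qed
  next
    case 2
    show thesis
    proof (rule that)
      show ord: "(2, 1, 0) \<in> orders" by (simp add: orders_def)
      show "(oclass b = 2 \<longrightarrow> oclass a = 2) \<and> (oclass a = 0 \<longrightarrow> oclass b = 0)" if "(a, b) \<in> r" for a b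
        by (rule main[OF ord _ _ _ that]) (use 2 ex in \<open>auto simp only: cls\<close>)
    qed
  next
    case 3
    show thesis
    proof (rule that)
      show ord: "(2, 0, 1) \<in> orders" by (simp add: orders_def)
      show "(oclass b = 2 \<longrightarrow> oclass a = 2) \<and> (oclass a = 1 \<longrightarrow> oclass b = 1)" if "(a, b) \<in> r" for a b
        by (rule main[OF ord _ _ _ that]) (use 3 ex in \<open>auto simp only: cls\<close>)
    qed
  next
    case 4
    show thesis
    proof (rule that)
      show ord: "(0, 2, 1) \<in> orders" by (simp add: orders_def)
      show "(oclass b = 0 \<longrightarrow> oclass a = 0) \<and> (oclass a = 1 \<longrightarrow> oclass b = 1)" if "(a, b) \<in> r" for a b
        by (rule main[OF ord _ _ _ that]) (use 4 ex in \<open>auto simp only: cls\<close>)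
    qed
  next
    case 5
    show thesis
    proof (rule that)
      show ord: "(1, 2, 0) \<in> orders" by (simp add: orders_def)
      show "(oclass b = 1 \<longrightarrow> oclass a = 1) \<and> (oclass a = 0 \<longrightarrow> oclass b = 0)" if "(a, b) \<in> r" for a b
        by (rule main[OF ord _ _ _ that]) (use 5 ex in \<open>auto simp only: cls\<close>)
    qed
  next
    case 6
    show thesis
    proof (rule that)
      show ord: "(1, 0, 2) \<in> orders" by (simp add: orders_def)
      show "(oclass b = 1 \<longrightarrow> oclass a = 1) \<and> (oclass a = 2 \<longrightarrow> oclass b = 2)" if "(a, b) \<in> r" for a b
        by (rule main[OF ord _ _ _ that]) (use 6 ex in \<open>auto simp only: cls\<close>)
    qed
  qed
qed

theorem theorem10p2:
  fixes q :: "'a::field" and r :: "omega rel"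
  assumes "q \<noteq> 0"
    and "\<forall>n>0. q ^ n \<noteq> 1"
    and "linear_order_on UNIV r"
    and "admissible_order r"
  shows "(\<forall>as\<in>pbw_index r. pbw_prod q as \<in> U_alg q)
    \<and> (\<forall>S c. finite S \<and> S \<subseteq> pbw_index r \<and>
           (\<forall>w. (\<Sum>as\<in>S. c as * pbw_prod q as w) = 0) \<longrightarrow> (\<forall>as\<in>S. c as = 0))
    \<and> (\<forall>f\<in>U_alg q. \<exists>S c. finite S \<and> S \<subseteq> pbw_index r \<and>
           f = (\<lambda>w. \<Sum>as\<in>S. c as * pbw_prod q as w))"
proof -
  interpret qshuffle q by standard (use assms in auto)
  obtain c1 c2 c3 where cs: "(c1, c2, c3) \<in> orders"
    and mono: "\<And>a b. (a, b) \<in> r \<Longrightarrow> (oclass b = c1 \<longrightarrow> oclass a = c1) \<and> (oclass a = c3 \<longrightarrow> oclass b = c3)"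
    using admissible_blocks[OF assms(3,4)] by blast
  let ?V = "pbw_elt (c1, c2, c3)"
  have pbw: "pbw_prod q as = ?V (mset as)" if as: "as \<in> pbw_index r" for as
  proof -
    have "sorted_wrt (\<lambda>a b. (a, b) \<in> r) as" using as by (simp add: pbw_index_def)
    then have "sorted_wrt (\<lambda>a b. (oclass b = c1 \<longrightarrow> oclass a = c1) \<and> (oclass a = c3 \<longrightarrow> oclass b = c3)) as"
      by (rule sorted_wrt_mono_rel[rotated]) (rule mono)
    then show ?thesis
      using sorted_blocks[OF _ cs] by (simp only: pbw_elt_mset block_prod_def prod.case pbw_prod_eq)
  qed
  have sum_eq: "(\<Sum>as\<in>S. c as * pbw_prod q as w) = (\<Sum>as\<in>S. sc (c as) (pbw_prod q as)) w" for S c w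
    by (simp add: sum_fun_apply sc_apply)
  note inj = pbw_index_mset(2)[OF assms(3)]
  have "c as = 0"
    if S: "finite S" "S \<subseteq> pbw_index r" "\<forall>w. (\<Sum>as\<in>S. c as * pbw_prod q as w) = 0" "as \<in> S" for S c as
  proof -
    have injS: "inj_on mset S" using inj S(2) inj_on_subset by blast
    define g where "g m = c (the_inv_into S mset m)" for m
    have g: "g (mset xs) = c xs" if "xs \<in> S" for xs
      using that by (simp add: g_def the_inv_into_f_f[OF injS])
    have "(\<Sum>m\<in>mset ` S. sc (g m) (?V m)) = (\<Sum>xs\<in>S. sc (c xs) (pbw_prod q xs))"
      unfolding sum.reindex[OF injS] by (intro sum.cong) (use S(2) g pbw in auto)
    also have "\<dots> = 0" using S(3) unfolding sum_eq by (auto simp: fun_eq_iff zero_fun_apply)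
    finally have "g (mset as) = 0"
      by (rule pbw_elt_independent[OF cs, rotated]) (use S in auto)
    then show ?thesis using g S(4) by simp
  qed
  moreover have "\<exists>S c. finite S \<and> S \<subseteq> pbw_index r \<and> f = (\<lambda>w. \<Sum>as\<in>S. c as * pbw_prod q as w)"
    if f: "f \<in> U_alg q" for f
  proof -
    have "range ?V = ?V ` mset ` pbw_index r" by (simp add: pbw_index_mset(1)[OF assms(3)])
    also have "\<dots> = pbw_prod q ` pbw_index r" unfolding image_image by (intro image_cong refl) (simp add: pbw)
    finally have "f \<in> fn.span (pbw_prod q ` pbw_index r)"
      using f U_span_block_prod[OF cs] range_pbw_elt by auto
    then obtain t x where t: "finite t" "t \<subseteq> pbw_prod q ` pbw_index r" "f = (\<Sum>v\<in>t. sc (x v) v)"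
      unfolding fn.span_explicit by auto
    \<comment> \<open>The span yields a set t of vectors; choosing one list for each of them makes
      \<open>pbw_prod q\<close> injective on S, so the sum can be reindexed.\<close>
    obtain S where S: "S \<subseteq> pbw_index r" "inj_on (pbw_prod q) S" "t = pbw_prod q ` S"
      using t(2) unfolding subset_image_inj by blast
    have "finite S" using t(1) S(2,3) finite_imageD by blast
    moreover have "f = (\<lambda>w. \<Sum>as\<in>S. x (pbw_prod q as) * pbw_prod q as w)"
      unfolding sum_eq t(3) S(3) by (simp add: sum.reindex[OF S(2)])
    ultimately show ?thesis using S(1) by (intro exI[of _ S] exI[of _ "\<lambda>as. x (pbw_prod q as)"]) simp
  qed
  ultimately show ?thesis
    using star_list_omega_in_U by (auto simp: pbw_prod_eq)
qed

end
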